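(* Let $(M,\tau)$ be a tracial von Neumann algebra and let $N\subseteq M$ be a diffuse von Neumann subalgebra. Viewing $M\subseteq L^2(M)$, we have $$q^{1}\mathcal{N}_{M}(N)\subseteq \mathcal{H}_{s}(N\subseteq M)\quad\text{and}\quad \mathcal{N}_{M}^{wq}(N)\subseteq \mathcal{H}_{s}(N\subseteq M).$$
   Context: A tracial von Neumann algebra is a pair $(M,\tau)$ with $M$ a von Neumann algebra and $\tau$ a faithful normal tracial state; von Neumann subalgebras share the unit of $M$. The one-sided quasi-normalizer is $q^{1}\mathcal{N}_{M}(N)=\{x\in M:\text{ there exist } x_{1},\dots,x_{n}\in M \text{ with } xN\subseteq \sum_{j=1}^{n}Nx_{j}\}$, and the (step-1) wq-normalizer is $\mathcal{N}^{wq}_{M}(N)=\{u\in\mathcal{U}(M): u^{*}Nu\cap N\text{ is diffuse}\}$. Two $N$-$N$ bimodules are disjoint if there is no nonzero bounded $N$-$N$ bimodular map between them. The coarse bimodule $L^{2}(N)\otimes L^{2}(N^{op})$ is the Hilbert space tensor product in which left multiplication by $N$ acts on the first factor and right multiplication by $N$ acts on the second. For $\xi\in L^2(M)$, $L^{2}(N\xi N)$ is the $\|\cdot\|_2$-closure of $\{\sum_{j=1}^k x_j\xi y_j: k\in\mathbb{N},\ x_j,y_j\in N\}$. The singular subspace is $\mathcal{H}_{s}(N\subseteq M)=\{\xi\in L^{2}(M): L^{2}(N\xi N)\text{ is disjoint from }L^{2}(N)\otimes L^{2}(N^{op})\text{ as an }N\text{-}N\text{ bimodule}\}$. *)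

theory Defs
  imports "HOL-Analysis.Analysis"
begin

section \<open>Complex Hilbert spaces\<close>

class scaleC =
  fixes scaleC :: "complex \<Rightarrow> 'a \<Rightarrow> 'a" (infixr "*\<^sub>C" 75)

text \<open>The inner product is linear in its first argument; its real part is the real inner
  product of the library, so that norm and topology are those of \<^class>\<open>real_inner\<close>.\<close>

class complex_inner = real_inner + scaleC +
  fixes cinner :: "'a \<Rightarrow> 'a \<Rightarrow> complex"
  assumes scaleC_add_right: "c *\<^sub>C (x + y) = c *\<^sub>C x + c *\<^sub>C y"
    and scaleC_add_left: "(c + d) *\<^sub>C x = c *\<^sub>C x + d *\<^sub>C x"
    and scaleC_scaleC: "c *\<^sub>C (d *\<^sub>C x) = (c * d) *\<^sub>C x"
    and scaleR_scaleC: "r *\<^sub>R x = complex_of_real r *\<^sub>C x"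
    and cinner_commute: "cinner x y = cnj (cinner y x)"
    and cinner_add_left: "cinner (x + y) z = cinner x z + cinner y z"
    and cinner_scaleC_left: "cinner (c *\<^sub>C x) y = c * cinner x y"
    and inner_eq_Re_cinner: "inner x y = Re (cinner x y)"

class chilbert_space = complex_inner + complete_space


section \<open>Bounded operators\<close>

text \<open>The type \<^typ>\<open>'h \<Rightarrow>\<^sub>L 'h\<close> consists of real-linear bounded operators; \<open>B(H)\<close> is the
  set of the complex-linear ones.\<close>

definition bounded_ops :: "('h::chilbert_space \<Rightarrow>\<^sub>L 'h) set" where
  "bounded_ops = {x. \<forall>c \<xi>. blinfun_apply x (c *\<^sub>C \<xi>) = c *\<^sub>C blinfun_apply x \<xi>}"

definition op_scale :: "complex \<Rightarrow> ('h::chilbert_space \<Rightarrow>\<^sub>L 'h) \<Rightarrow> ('h \<Rightarrow>\<^sub>L 'h)" where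
  "op_scale c x = Blinfun (\<lambda>\<xi>. c *\<^sub>C blinfun_apply x \<xi>)"

definition op_adj :: "('h::chilbert_space \<Rightarrow>\<^sub>L 'h) \<Rightarrow> ('h \<Rightarrow>\<^sub>L 'h)" where
  "op_adj x = (THE y. y \<in> bounded_ops \<and>
     (\<forall>\<xi> \<eta>. cinner (blinfun_apply x \<xi>) \<eta> = cinner \<xi> (blinfun_apply y \<eta>)))"

definition op_pos :: "('h::chilbert_space \<Rightarrow>\<^sub>L 'h) \<Rightarrow> bool" where
  "op_pos x \<longleftrightarrow> x \<in> bounded_ops \<and>
     (\<forall>\<xi>. cinner (blinfun_apply x \<xi>) \<xi> \<in> \<real> \<and> 0 \<le> Re (cinner (blinfun_apply x \<xi>) \<xi>))"

definition op_le :: "('h::chilbert_space \<Rightarrow>\<^sub>L 'h) \<Rightarrow> ('h \<Rightarrow>\<^sub>L 'h) \<Rightarrow> bool" where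
  "op_le x y \<longleftrightarrow> op_pos (y - x)"

definition is_projection :: "('h::chilbert_space \<Rightarrow>\<^sub>L 'h) \<Rightarrow> bool" where
  "is_projection p \<longleftrightarrow> p \<in> bounded_ops \<and> p o\<^sub>L p = p \<and> op_adj p = p"


section \<open>Tracial von Neumann algebras\<close>

definition commutant :: "('h::chilbert_space \<Rightarrow>\<^sub>L 'h) set \<Rightarrow> ('h \<Rightarrow>\<^sub>L 'h) set" where
  "commutant S = {x \<in> bounded_ops. \<forall>y\<in>S. x o\<^sub>L y = y o\<^sub>L x}"

definition von_neumann_algebra :: "('h::chilbert_space \<Rightarrow>\<^sub>L 'h) set \<Rightarrow> bool" where
  "von_neumann_algebra M \<longleftrightarrow>
     M \<subseteq> bounded_ops \<and> (\<forall>x\<in>M. op_adj x \<in> M) \<and> commutant (commutant M) = M"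

text \<open>Both algebras contain the identity operator of the ambient Hilbert space, so the unit
  is shared.\<close>

definition von_neumann_subalgebra ::
  "('h::chilbert_space \<Rightarrow>\<^sub>L 'h) set \<Rightarrow> ('h \<Rightarrow>\<^sub>L 'h) set \<Rightarrow> bool" where
  "von_neumann_subalgebra N M \<longleftrightarrow> von_neumann_algebra N \<and> N \<subseteq> M"

definition complex_linear_on ::
  "('h::chilbert_space \<Rightarrow>\<^sub>L 'h) set \<Rightarrow> (('h \<Rightarrow>\<^sub>L 'h) \<Rightarrow> complex) \<Rightarrow> bool" where
  "complex_linear_on M \<tau> \<longleftrightarrow>
     (\<forall>x\<in>M. \<forall>y\<in>M. \<tau> (x + y) = \<tau> x + \<tau> y) \<and>
     (\<forall>c. \<forall>x\<in>M. \<tau> (op_scale c x) = c * \<tau> x)"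

definition state_on ::
  "('h::chilbert_space \<Rightarrow>\<^sub>L 'h) set \<Rightarrow> (('h \<Rightarrow>\<^sub>L 'h) \<Rightarrow> complex) \<Rightarrow> bool" where
  "state_on M \<tau> \<longleftrightarrow> complex_linear_on M \<tau> \<and>
     (\<forall>x\<in>M. \<tau> (op_adj x o\<^sub>L x) \<in> \<real> \<and> 0 \<le> Re (\<tau> (op_adj x o\<^sub>L x))) \<and>
     \<tau> id_blinfun = 1"

definition is_op_supremum ::
  "('h::chilbert_space \<Rightarrow>\<^sub>L 'h) set \<Rightarrow> ('h \<Rightarrow>\<^sub>L 'h) set \<Rightarrow> ('h \<Rightarrow>\<^sub>L 'h) \<Rightarrow> bool" where
  "is_op_supremum M D s \<longleftrightarrow> s \<in> M \<and> (\<forall>d\<in>D. op_le d s) \<and>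
     (\<forall>t\<in>M. (\<forall>d\<in>D. op_le d t) \<longrightarrow> op_le s t)"

text \<open>Normality: suprema of bounded increasing nets of positive elements are preserved; the
  nets are given by upward directed sets.\<close>

definition normal_on ::
  "('h::chilbert_space \<Rightarrow>\<^sub>L 'h) set \<Rightarrow> (('h \<Rightarrow>\<^sub>L 'h) \<Rightarrow> complex) \<Rightarrow> bool" where
  "normal_on M \<tau> \<longleftrightarrow>
     (\<forall>D s. D \<subseteq> M \<and> D \<noteq> {} \<and> (\<forall>d\<in>D. op_pos d) \<and>
        (\<forall>d\<in>D. \<forall>e\<in>D. \<exists>f\<in>D. op_le d f \<and> op_le e f) \<and> is_op_supremum M D s
        \<longrightarrow> Re (\<tau> s) = (SUP d\<in>D. Re (\<tau> d)))"

definition tracial_von_neumann_algebra ::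
  "('h::chilbert_space \<Rightarrow>\<^sub>L 'h) set \<Rightarrow> (('h \<Rightarrow>\<^sub>L 'h) \<Rightarrow> complex) \<Rightarrow> bool" where
  "tracial_von_neumann_algebra M \<tau> \<longleftrightarrow>
     von_neumann_algebra M \<and> state_on M \<tau> \<and> normal_on M \<tau> \<and>
     (\<forall>x\<in>M. \<tau> (op_adj x o\<^sub>L x) = 0 \<longrightarrow> x = 0) \<and>
     (\<forall>x\<in>M. \<forall>y\<in>M. \<tau> (x o\<^sub>L y) = \<tau> (y o\<^sub>L x))"

definition minimal_projection ::
  "('h::chilbert_space \<Rightarrow>\<^sub>L 'h) set \<Rightarrow> ('h \<Rightarrow>\<^sub>L 'h) \<Rightarrow> bool" where
  "minimal_projection A p \<longleftrightarrow> p \<in> A \<and> is_projection p \<and> p \<noteq> 0 \<and>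
     (\<forall>q\<in>A. is_projection q \<and> op_le q p \<longrightarrow> q = 0 \<or> q = p)"

definition diffuse :: "('h::chilbert_space \<Rightarrow>\<^sub>L 'h) set \<Rightarrow> bool" where
  "diffuse A \<longleftrightarrow> (\<nexists>p. minimal_projection A p)"

definition unitaries :: "('h::chilbert_space \<Rightarrow>\<^sub>L 'h) set \<Rightarrow> ('h \<Rightarrow>\<^sub>L 'h) set" where
  "unitaries M = {u \<in> M. op_adj u o\<^sub>L u = id_blinfun \<and> u o\<^sub>L op_adj u = id_blinfun}"


section \<open>Normalizers\<close>

definition one_sided_quasi_normalizer ::
  "('h::chilbert_space \<Rightarrow>\<^sub>L 'h) set \<Rightarrow> ('h \<Rightarrow>\<^sub>L 'h) set \<Rightarrow> ('h \<Rightarrow>\<^sub>L 'h) set" where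
  "one_sided_quasi_normalizer M N = {x \<in> M. \<exists>(n::nat) X. (\<forall>j<n. X j \<in> M) \<and>
     {x o\<^sub>L y | y. y \<in> N} \<subseteq> {\<Sum>j<n. a j o\<^sub>L X j | a. \<forall>j<n. a j \<in> N}}"

definition wq_normalizer ::
  "('h::chilbert_space \<Rightarrow>\<^sub>L 'h) set \<Rightarrow> ('h \<Rightarrow>\<^sub>L 'h) set \<Rightarrow> ('h \<Rightarrow>\<^sub>L 'h) set" where
  "wq_normalizer M N =
     {u \<in> unitaries M. diffuse ({op_adj u o\<^sub>L y o\<^sub>L u | y. y \<in> N} \<inter> N)}"


section \<open>The spaces \<open>L\<^sup>2(M)\<close> and \<open>L\<^sup>2(N)\<close>\<close>

text \<open>A completion of \<open>M\<close> for the inner product \<open>\<langle>x, y\<rangle> = \<tau>(y\<^sup>* x)\<close> is given by a linear map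
  \<open>\<Lambda>\<close> into some Hilbert space which carries this inner product to the one of the Hilbert space;
  \<open>L\<^sup>2(M)\<close> is the closure of the image of \<open>\<Lambda>\<close>, and \<open>\<Lambda>\<close> is the inclusion of \<open>M\<close> in \<open>L\<^sup>2(M)\<close>.
  It is unique up to a unitary.  For \<open>N \<subseteq> M\<close>, \<open>L\<^sup>2(N)\<close> is the closure of \<open>N\<close> in \<open>L\<^sup>2(M)\<close>,
  which is the completion of \<open>N\<close> for the restricted trace.\<close>

definition L2_embedding ::
  "('h::chilbert_space \<Rightarrow>\<^sub>L 'h) set \<Rightarrow> (('h \<Rightarrow>\<^sub>L 'h) \<Rightarrow> complex) \<Rightarrow>
   (('h \<Rightarrow>\<^sub>L 'h) \<Rightarrow> 'l::chilbert_space) \<Rightarrow> bool" where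
  "L2_embedding M \<tau> \<Lambda> \<longleftrightarrow>
     (\<forall>x\<in>M. \<forall>y\<in>M. \<Lambda> (x + y) = \<Lambda> x + \<Lambda> y) \<and>
     (\<forall>c. \<forall>x\<in>M. \<Lambda> (op_scale c x) = c *\<^sub>C \<Lambda> x) \<and>
     (\<forall>x\<in>M. \<forall>y\<in>M. cinner (\<Lambda> x) (\<Lambda> y) = \<tau> (op_adj y o\<^sub>L x))"

definition L2 ::
  "(('h::chilbert_space \<Rightarrow>\<^sub>L 'h) \<Rightarrow> 'l::chilbert_space) \<Rightarrow> ('h \<Rightarrow>\<^sub>L 'h) set \<Rightarrow> 'l set" where
  "L2 \<Lambda> M = closure (\<Lambda> ` M)"

text \<open>Left and right multiplication on \<open>L\<^sup>2(M)\<close> are the bounded extensions of multiplication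
  on \<open>M\<close>.  The extension is unique on \<^term>\<open>L2 \<Lambda> M\<close>, the only place where it is used; its
  values on the rest of the ambient Hilbert space are arbitrary.\<close>

definition L2_left ::
  "(('h::chilbert_space \<Rightarrow>\<^sub>L 'h) \<Rightarrow> 'l::chilbert_space) \<Rightarrow> ('h \<Rightarrow>\<^sub>L 'h) set \<Rightarrow>
   ('h \<Rightarrow>\<^sub>L 'h) \<Rightarrow> 'l \<Rightarrow> 'l" where
  "L2_left \<Lambda> M a = blinfun_apply
     (SOME T. T \<in> bounded_ops \<and> (\<forall>x\<in>M. blinfun_apply T (\<Lambda> x) = \<Lambda> (a o\<^sub>L x)))"

definition L2_right ::
  "(('h::chilbert_space \<Rightarrow>\<^sub>L 'h) \<Rightarrow> 'l::chilbert_space) \<Rightarrow> ('h \<Rightarrow>\<^sub>L 'h) set \<Rightarrow>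
   ('h \<Rightarrow>\<^sub>L 'h) \<Rightarrow> 'l \<Rightarrow> 'l" where
  "L2_right \<Lambda> M b = blinfun_apply
     (SOME T. T \<in> bounded_ops \<and> (\<forall>x\<in>M. blinfun_apply T (\<Lambda> x) = \<Lambda> (x o\<^sub>L b)))"


section \<open>Bimodules\<close>

text \<open>A bimodule lives on a closed subspace \<open>bspace\<close> of a Hilbert space; \<open>lact a \<xi>\<close> stands for
  \<open>a \<xi>\<close> and \<open>ract b \<xi>\<close> for \<open>\<xi> b\<close>.\<close>

record ('n, 'k) bimodule =
  bspace :: "'k set"
  lact :: "'n \<Rightarrow> 'k \<Rightarrow> 'k"
  ract :: "'n \<Rightarrow> 'k \<Rightarrow> 'k"

definition bounded_bimodular_map ::
  "'n set \<Rightarrow> ('n, 'k::chilbert_space) bimodule \<Rightarrow> ('n, 'l::chilbert_space) bimodule \<Rightarrow>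
   ('k \<Rightarrow> 'l) \<Rightarrow> bool" where
  "bounded_bimodular_map N H K T \<longleftrightarrow>
     (\<forall>\<xi>\<in>bspace H. T \<xi> \<in> bspace K) \<and>
     (\<forall>\<xi>\<in>bspace H. \<forall>\<eta>\<in>bspace H. T (\<xi> + \<eta>) = T \<xi> + T \<eta>) \<and>
     (\<forall>c. \<forall>\<xi>\<in>bspace H. T (c *\<^sub>C \<xi>) = c *\<^sub>C T \<xi>) \<and>
     (\<exists>C. \<forall>\<xi>\<in>bspace H. norm (T \<xi>) \<le> C * norm \<xi>) \<and>
     (\<forall>a\<in>N. \<forall>\<xi>\<in>bspace H. T (lact H a \<xi>) = lact K a (T \<xi>)) \<and>
     (\<forall>b\<in>N. \<forall>\<xi>\<in>bspace H. T (ract H b \<xi>) = ract K b (T \<xi>))"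

definition disjoint_bimodules ::
  "'n set \<Rightarrow> ('n, 'k::chilbert_space) bimodule \<Rightarrow> ('n, 'l::chilbert_space) bimodule \<Rightarrow> bool"
  where
  "disjoint_bimodules N H K \<longleftrightarrow>
     (\<forall>T. bounded_bimodular_map N H K T \<longrightarrow> (\<forall>\<xi>\<in>bspace H. T \<xi> = 0)) \<and>
     (\<forall>T. bounded_bimodular_map N K H T \<longrightarrow> (\<forall>\<eta>\<in>bspace K. T \<eta> = 0))"

definition cyclic_bimodule ::
  "(('h::chilbert_space \<Rightarrow>\<^sub>L 'h) \<Rightarrow> 'l::chilbert_space) \<Rightarrow> ('h \<Rightarrow>\<^sub>L 'h) set \<Rightarrow>
   ('h \<Rightarrow>\<^sub>L 'h) set \<Rightarrow> 'l \<Rightarrow> ('h \<Rightarrow>\<^sub>L 'h, 'l) bimodule" where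
  "cyclic_bimodule \<Lambda> M N \<xi> =
     \<lparr> bspace = closure {\<Sum>j<k. L2_left \<Lambda> M (x j) (L2_right \<Lambda> M (y j) \<xi>) | (k::nat) x y.
          \<forall>j<k. x j \<in> N \<and> y j \<in> N},
       lact = L2_left \<Lambda> M, ract = L2_right \<Lambda> M \<rparr>"

text \<open>\<open>t\<close> realizes the Hilbert space tensor product of the closed subspaces \<open>H\<close> and \<open>K\<close>: it is
  bilinear, \<open>\<langle>\<xi> \<otimes> \<eta>, \<xi>' \<otimes> \<eta>'\<rangle> = \<langle>\<xi>, \<xi>'\<rangle> \<langle>\<eta>, \<eta>'\<rangle>\<close>, and the tensor product is the closure of the
  set of finite sums of elementary tensors.\<close>

definition tensor_map ::
  "'k::chilbert_space set \<Rightarrow> 'l::chilbert_space set \<Rightarrow> ('k \<Rightarrow> 'l \<Rightarrow> 't::chilbert_space) \<Rightarrow> bool"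
  where
  "tensor_map H K t \<longleftrightarrow>
     (\<forall>\<xi>\<in>H. \<forall>\<xi>'\<in>H. \<forall>\<eta>\<in>K. t (\<xi> + \<xi>') \<eta> = t \<xi> \<eta> + t \<xi>' \<eta>) \<and>
     (\<forall>\<xi>\<in>H. \<forall>\<eta>\<in>K. \<forall>\<eta>'\<in>K. t \<xi> (\<eta> + \<eta>') = t \<xi> \<eta> + t \<xi> \<eta>') \<and>
     (\<forall>c. \<forall>\<xi>\<in>H. \<forall>\<eta>\<in>K. t (c *\<^sub>C \<xi>) \<eta> = c *\<^sub>C t \<xi> \<eta> \<and> t \<xi> (c *\<^sub>C \<eta>) = c *\<^sub>C t \<xi> \<eta>) \<and>
     (\<forall>\<xi>\<in>H. \<forall>\<xi>'\<in>H. \<forall>\<eta>\<in>K. \<forall>\<eta>'\<in>K.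
        cinner (t \<xi> \<eta>) (t \<xi>' \<eta>') = cinner \<xi> \<xi>' * cinner \<eta> \<eta>')"

definition tensor_space ::
  "'k::chilbert_space set \<Rightarrow> 'l::chilbert_space set \<Rightarrow> ('k \<Rightarrow> 'l \<Rightarrow> 't::chilbert_space) \<Rightarrow> 't set"
  where
  "tensor_space H K t =
     closure {\<Sum>j<n. t (\<xi> j) (\<eta> j) | (n::nat) \<xi> \<eta>. \<forall>j<n. \<xi> j \<in> H \<and> \<eta> j \<in> K}"

text \<open>The Hilbert space \<open>L\<^sup>2(N\<^sup>o\<^sup>p)\<close> is \<open>L\<^sup>2(N)\<close>, because \<open>\<tau>(x y\<^sup>*) = \<tau>(y\<^sup>* x)\<close>, and left
  multiplication by \<open>b\<^sup>o\<^sup>p\<close> on it is right multiplication by \<open>b\<close>.\<close>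

definition coarse_bimodule ::
  "(('h::chilbert_space \<Rightarrow>\<^sub>L 'h) \<Rightarrow> 'l::chilbert_space) \<Rightarrow> ('l \<Rightarrow> 'l \<Rightarrow> 't::chilbert_space) \<Rightarrow>
   ('h \<Rightarrow>\<^sub>L 'h) set \<Rightarrow> ('h \<Rightarrow>\<^sub>L 'h, 't) bimodule" where
  "coarse_bimodule \<Lambda> t N =
     \<lparr> bspace = tensor_space (L2 \<Lambda> N) (L2 \<Lambda> N) t,
       lact = (\<lambda>a. blinfun_apply (SOME T. T \<in> bounded_ops \<and>
         (\<forall>\<xi>\<in>L2 \<Lambda> N. \<forall>\<eta>\<in>L2 \<Lambda> N. blinfun_apply T (t \<xi> \<eta>) = t (L2_left \<Lambda> N a \<xi>) \<eta>))),
       ract = (\<lambda>b. blinfun_apply (SOME T. T \<in> bounded_ops \<and>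
         (\<forall>\<xi>\<in>L2 \<Lambda> N. \<forall>\<eta>\<in>L2 \<Lambda> N. blinfun_apply T (t \<xi> \<eta>) = t \<xi> (L2_right \<Lambda> N b \<eta>)))) \<rparr>"

definition singular_subspace ::
  "(('h::chilbert_space \<Rightarrow>\<^sub>L 'h) \<Rightarrow> 'l::chilbert_space) \<Rightarrow> ('l \<Rightarrow> 'l \<Rightarrow> 't::chilbert_space) \<Rightarrow>
   ('h \<Rightarrow>\<^sub>L 'h) set \<Rightarrow> ('h \<Rightarrow>\<^sub>L 'h) set \<Rightarrow> 'l set" where
  "singular_subspace \<Lambda> t N M =
     {\<xi> \<in> L2 \<Lambda> M. disjoint_bimodules N (cyclic_bimodule \<Lambda> M N \<xi>) (coarse_bimodule \<Lambda> t N)}"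

end

theory Submission
  imports Defs
begin

text \<open>Let \<open>x\<close> satisfy \<open>x N \<subseteq> \<Sum>\<^sub>j N X\<^sub>j\<close>, and let \<open>\<zeta>\<close>, \<open>\<zeta>\<^sub>j\<close> be the images of
  \<open>x\<close>, \<open>X\<^sub>j\<close> under a bimodular map from \<open>L\<^sup>2(N x N)\<close> to \<open>L\<^sup>2(N) \<otimes> L\<^sup>2(N)\<close>, extended by \<open>0\<close> on the
  orthogonal complement in \<open>L\<^sup>2(M)\<close>.  For a unitary \<open>v \<in> N\<close> write
  \<open>x v = \<Sum>\<^sub>j a\<^sub>j X\<^sub>j\<close>; then \<open>\<zeta> v = \<Sum>\<^sub>j a\<^sub>j \<zeta>\<^sub>j\<close> and
  \<open>\<parallel>\<zeta>\<parallel>\<^sup>2 = \<langle>\<zeta> v, \<zeta> v\<rangle> = \<Sum>\<^sub>j \<langle>a\<^sub>j \<zeta>\<^sub>j, \<zeta> v\<rangle>\<close>.  On elementary tensors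
  \<open>\<langle>a (\<xi>' \<otimes> \<eta>'), (\<xi> \<otimes> \<eta>) v\<rangle> = \<langle>a \<xi>', \<xi>\<rangle> \<langle>\<eta>', \<eta> v\<rangle>\<close>: the first factor is at most
  \<open>\<parallel>a\<parallel> \<parallel>\<xi>'\<parallel> \<parallel>\<xi>\<parallel>\<close>, and the second tends to \<open>0\<close> as \<open>v\<close> tends weakly to \<open>0\<close>.  Hence \<open>\<zeta> = 0\<close>, provided
  that \<open>N\<close> has unitaries \<open>v\<close> that are weakly close to \<open>0\<close> and that the \<open>a\<^sub>j\<close> stay bounded.  This is
  \<open>coarse_vanish\<close>.  The relation passes from \<open>x\<close> to \<open>\<zeta>\<close> in \<open>singular_criterion\<close>, which is stated
  for maps out of the coarse bimodule, with \<open>\<zeta>\<close> the image of \<open>x\<close> under the adjoint; taking adjoints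
  (\<open>disjoint_bimodulesI\<close>) covers the maps into it.

  The unitaries come from diffuseness (\<open>weakly_small_unitary\<close>).  Every nonzero projection has a
  nonzero subprojection of at most half its trace; a greedy exhaustion and normality of the trace
  make \<open>1\<close> a finite sum of projections \<open>p\<^sub>i\<close> of small trace, and for suitable signs the symmetry
  \<open>v = \<Sum>\<^sub>i \<plusminus>p\<^sub>i\<close> has small \<open>\<tau>(v z)\<close> for finitely many given \<open>z\<close>.

  The bound on the \<open>a\<^sub>j\<close> comes from the Baire category theorem (\<open>bounded_coefficients\<close>).  For
  \<open>u\<close> in the wq-normalizer it is immediate: for \<open>v \<in> Q = u\<^sup>* N u \<inter> N\<close> one has \<open>u v = (u v u\<^sup>*) u\<close> with
  \<open>u v u\<^sup>* \<in> N\<close>, and \<open>Q\<close> is a diffuse von Neumann algebra from which the unitaries \<open>v\<close> may be taken.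

  The analytic background consists of the Riesz representation theorem, for adjoints, for extensions
  of densely defined operators and for the vectors \<open>\<zeta>\<close>, and of the square root of \<open>1 - y\<close> for
  \<open>\<parallel>y\<parallel> < 1\<close>, which gives all the norm estimates.\<close>

section \<open>Complex inner products\<close>

instance chilbert_space \<subseteq> banach ..

lemma scaleC_one [simp]: "1 *\<^sub>C (x::'a::complex_inner) = x"
  using scaleR_scaleC[of 1 x] by simp

lemma scaleC_scaleR: "c *\<^sub>C (r *\<^sub>R (x::'a::complex_inner)) = r *\<^sub>R (c *\<^sub>C x)"
  by (simp add: scaleR_scaleC scaleC_scaleC mult.commute)

lemma cinner_add_right: "cinner (x::'a::complex_inner) (y + z) = cinner x y + cinner x z"
  by (metis cinner_add_left cinner_commute complex_cnj_add)

lemma cinner_scaleC_right: "cinner (x::'a::complex_inner) (c *\<^sub>C y) = cnj c * cinner x y"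
  by (metis cinner_commute cinner_scaleC_left complex_cnj_mult)

lemma cinner_self: "cinner (x::'a::complex_inner) x = of_real ((norm x)\<^sup>2)"
proof -
  have "Im (cinner x x) = 0"
    using arg_cong[OF cinner_commute[of x x], of Im] by simp
  then show ?thesis
    by (simp add: complex_eq_iff inner_eq_Re_cinner[symmetric] power2_norm_eq_inner)
qed

lemma norm_scaleC: "norm (c *\<^sub>C (x::'a::complex_inner)) = cmod c * norm x"
proof -
  have "complex_of_real ((norm (c *\<^sub>C x))\<^sup>2) = c * cnj c * of_real ((norm x)\<^sup>2)"
    by (simp only: cinner_self[symmetric] cinner_scaleC_left cinner_scaleC_right mult_ac)
  also have "\<dots> = complex_of_real ((cmod c * norm x)\<^sup>2)"
    by (simp add: complex_norm_square[symmetric] power_mult_distrib)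
  finally have "(norm (c *\<^sub>C x))\<^sup>2 = (cmod c * norm x)\<^sup>2"
    using of_real_eq_iff by blast
  then show ?thesis by simp
qed

lemma complex_Cauchy_Schwarz: "cmod (cinner (x::'a::complex_inner) y) \<le> norm x * norm y"
proof (cases "cinner x y = 0")
  case False
  define c where "c = cnj (cinner x y) / cmod (cinner x y)"
  have c: "cmod c = 1" using False by (simp add: c_def norm_divide)
  have "c * cinner x y = cmod (cinner x y)"
    using False by (simp add: c_def complex_norm_square[symmetric] mult.commute[of "cnj _"])
      (simp add: power2_eq_square)
  then have "cmod (cinner x y) = inner (c *\<^sub>C x) y"
    by (simp add: inner_eq_Re_cinner cinner_scaleC_left)
  also have "\<dots> \<le> norm (c *\<^sub>C x) * norm y" by (rule norm_cauchy_schwarz)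
  finally show ?thesis by (simp add: norm_scaleC c)
qed simp

interpretation cinner: bounded_bilinear "cinner :: 'a::complex_inner \<Rightarrow> 'a \<Rightarrow> complex"
proof
  show "cinner (r *\<^sub>R x) y = r *\<^sub>R cinner x y" for r and x y :: 'a
    by (simp add: scaleR_scaleC cinner_scaleC_left scaleR_conv_of_real)
  show "cinner x (r *\<^sub>R y) = r *\<^sub>R cinner x y" for r and x y :: 'a
    by (simp add: scaleR_scaleC cinner_scaleC_right scaleR_conv_of_real)
  show "\<exists>K. \<forall>(x::'a) y. norm (cinner x y) \<le> norm x * norm y * K"
    by (rule exI[of _ 1]) (simp add: complex_Cauchy_Schwarz)
qed (simp_all add: cinner_add_left cinner_add_right)

interpretation scaleC: bounded_bilinear "scaleC :: complex \<Rightarrow> 'a::complex_inner \<Rightarrow> 'a"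
proof
  show "(r *\<^sub>R c) *\<^sub>C x = r *\<^sub>R (c *\<^sub>C x)" for r c and x :: 'a
    by (simp add: scaleR_scaleC scaleC_scaleC scaleR_conv_of_real)
  show "\<exists>K. \<forall>c (x::'a). norm (c *\<^sub>C x) \<le> norm c * norm x * K"
    by (rule exI[of _ 1]) (simp add: norm_scaleC)
qed (simp_all add: scaleC_add_left scaleC_add_right scaleC_scaleR)

lemmas [simp] = cinner.zero_left cinner.zero_right scaleC.zero_left scaleC.zero_right

lemma Re_cinner_eqI:
  assumes "\<And>c. Re (c * a) = Re (c * b)" shows "a = b"
  using assms[of 1] assms[of \<i>] by (simp add: complex_eq_iff)

definition complex_subspace :: "'a::complex_inner set \<Rightarrow> bool" where
  "complex_subspace S \<longleftrightarrow> 0 \<in> S \<and> (\<forall>x\<in>S. \<forall>y\<in>S. x + y \<in> S) \<and> (\<forall>c. \<forall>x\<in>S. c *\<^sub>C x \<in> S)"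

lemma complex_subspaceD:
  assumes "complex_subspace S"
  shows "0 \<in> S" "x \<in> S \<Longrightarrow> y \<in> S \<Longrightarrow> x + y \<in> S" "x \<in> S \<Longrightarrow> c *\<^sub>C x \<in> S"
    "x \<in> S \<Longrightarrow> y \<in> S \<Longrightarrow> x - y \<in> S"
proof -
  show "0 \<in> S" "x \<in> S \<Longrightarrow> y \<in> S \<Longrightarrow> x + y \<in> S" "x \<in> S \<Longrightarrow> c *\<^sub>C x \<in> S"
    using assms by (auto simp: complex_subspace_def)
  have "x - y = x + (-1) *\<^sub>C y"
    unfolding scaleC.minus_left[of 1 y] by simp
  then show "x \<in> S \<Longrightarrow> y \<in> S \<Longrightarrow> x - y \<in> S"
    using assms unfolding complex_subspace_def by metis
qed

lemma complex_subspace_sum: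
  "complex_subspace S \<Longrightarrow> (\<And>i. i \<in> I \<Longrightarrow> f i \<in> S) \<Longrightarrow> sum f I \<in> S"
  by (induction I rule: infinite_finite_induct) (auto intro: complex_subspaceD)

text \<open>Statements about a closed span are proved for the spanning elements; this is the rule for
  passing to limits.\<close>

lemma closure_induct:
  assumes "x \<in> closure S" "closed {x. P x}" "\<And>s. s \<in> S \<Longrightarrow> P s"
  shows "P x"
  using closure_minimal[of S "{x. P x}"] assms by auto

lemma closure_near:
  fixes x :: "'a::real_normed_vector"
  assumes x: "x \<in> closure S" and d: "0 < d" and c: "0 \<le> c"
  shows "\<exists>s\<in>S. norm (x - s) * c \<le> d"
proof -
  have p: "0 < c + 1" using c by simp
  then obtain s where s: "s \<in> S" "dist s x < d / (c + 1)"
    using x d unfolding closure_approachable by (meson divide_pos_pos)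
  have "norm (x - s) * c \<le> (d / (c + 1)) * c"
    using s c by (intro mult_right_mono) (auto simp: dist_norm norm_minus_commute)
  also have "\<dots> \<le> d" using d c by (simp add: field_simps)
  finally show ?thesis using s by blast
qed

lemma complex_subspace_closure:
  assumes S: "complex_subspace S" shows "complex_subspace (closure S)"
  unfolding complex_subspace_def
proof (intro conjI ballI allI)
  show "0 \<in> closure S" using complex_subspaceD(1)[OF S] closure_subset by blast
next
  fix x y assume "x \<in> closure S" "y \<in> closure S"
  then obtain f g where "\<And>n. f n \<in> S" "f \<longlonglongrightarrow> x" "\<And>n. g n \<in> S" "g \<longlonglongrightarrow> y"
    unfolding closure_sequential by blast
  then show "x + y \<in> closure S"
    unfolding closure_sequential
    by (intro exI[of _ "\<lambda>n. f n + g n"]) (auto intro: tendsto_add complex_subspaceD[OF S])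
next
  fix c x assume "x \<in> closure S"
  then obtain f where "\<And>n. f n \<in> S" "f \<longlonglongrightarrow> x"
    unfolding closure_sequential by blast
  then show "c *\<^sub>C x \<in> closure S"
    unfolding closure_sequential
    by (intro exI[of _ "\<lambda>n. c *\<^sub>C f n"])
      (auto intro: scaleC.tendsto complex_subspaceD[OF S])
qed

lemma cinner_closure_eqI:
  assumes S: "complex_subspace S" and x: "x \<in> closure S" and y: "y \<in> closure S"
    and eq: "\<And>s. s \<in> S \<Longrightarrow> cinner s x = cinner s y"
  shows "x = y"
proof -
  have "cinner s (x - y) = 0" if "s \<in> closure S" for s
    using that
  proof (rule closure_induct)
    show "closed {s. cinner s (x - y) = 0}"
      by (intro closed_Collect_eq continuous_intros cinner.continuous_on)
    show "\<And>s. s \<in> S \<Longrightarrow> cinner s (x - y) = 0" by (simp add: cinner.diff_right eq)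
  qed
  from this[OF complex_subspaceD(4)[OF complex_subspace_closure[OF S] x y]]
  show ?thesis by (simp add: cinner_self)
qed


section \<open>Riesz representation and adjoints\<close>

text \<open>The functional is given by its graph \<open>F\<close>, so that its domain may be any subspace; the
  representing vector, in the closure of the domain, is the limit of a minimizing sequence of
  \<open>\<parallel>s\<parallel>\<^sup>2 - 2 f(s)\<close>.\<close>

lemma Riesz_graph:
  fixes F :: "('a::{real_inner,complete_space} \<times> real) set"
  assumes sub: "subspace F" and bd: "\<And>s r. (s, r) \<in> F \<Longrightarrow> \<bar>r\<bar> \<le> C * norm s"
  shows "\<exists>z\<in>closure (fst ` F). \<forall>(s, r)\<in>F. r = inner s z"
proof -
  define J where "J p = (norm (fst p))\<^sup>2 - 2 * snd p" for p :: "'a \<times> real"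
  define m where "m = (INF p\<in>F. J p)"
  have zero: "(0, 0) \<in> F" using subspace_0[OF sub] by (simp add: zero_prod_def)
  have "- C\<^sup>2 \<le> J p" if "p \<in> F" for p
  proof -
    have "snd p \<le> C * norm (fst p)" using bd[of "fst p" "snd p"] that by auto
    then show ?thesis
      using zero_le_power2[of "norm (fst p) - C"]
      by (simp add: J_def power2_diff mult.commute[of C])
  qed
  then have bdd: "bdd_below (J ` F)" by (meson bdd_belowI2)
  have m: "m \<le> J p" if "p \<in> F" for p
    unfolding m_def using bdd that by (rule cINF_lower)
  have "\<exists>p\<in>F. J p < m + 1 / Suc n" for n
    using cINF_less_iff[of F J "m + 1 / Suc n"] bdd zero by (auto simp: m_def)
  then obtain p where p: "\<And>n. p n \<in> F" "\<And>n. J (p n) < m + 1 / Suc n" by metis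
  define x where "x n = fst (p n)" for n
  have dist: "(norm (x i - x j))\<^sup>2 \<le> 2 / Suc i + 2 / Suc j" for i j
  proof -
    have "(1/2) *\<^sub>R (p i + p j) \<in> F"
      using p sub by (simp add: subspace_add subspace_scale)
    from m[OF this] have "m \<le> (norm (x i + x j))\<^sup>2 / 4 - (2 * snd (p i) + 2 * snd (p j)) / 2"
      by (simp add: J_def x_def power_divide)
    then have "4 * m \<le> (norm (x i + x j))\<^sup>2 - 4 * (snd (p i) + snd (p j))" by (simp add: field_simps)
    moreover have "(norm (x i - x j))\<^sup>2 + (norm (x i + x j))\<^sup>2
        = 2 * (norm (x i))\<^sup>2 + 2 * (norm (x j))\<^sup>2"
      by (simp add: power2_norm_eq_inner inner_diff_left inner_diff_right inner_add_left
          inner_add_right inner_commute)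
    ultimately show ?thesis
      using p(2)[of i] p(2)[of j] by (simp add: J_def x_def)
  qed
  have "Cauchy x"
  proof (rule metric_CauchyI)
    fix e :: real assume "0 < e"
    then obtain k :: nat where k: "4 / e\<^sup>2 < k" using reals_Archimedean2 by blast
    show "\<exists>M. \<forall>i\<ge>M. \<forall>j\<ge>M. dist (x i) (x j) < e"
    proof (intro exI allI impI)
      fix i j assume ij: "k \<le> i" "k \<le> j"
      have k0: "0 < real (Suc k)" by simp
      have "2 / Suc i \<le> 2 / real (Suc k)" "2 / Suc j \<le> 2 / real (Suc k)"
        using ij by (auto intro!: divide_left_mono)
      then have "(norm (x i - x j))\<^sup>2 \<le> 4 / Suc k" using dist[of i j] by simp
      also have "\<dots> < e\<^sup>2"
        using k \<open>0 < e\<close> by (simp add: field_simps add_pos_nonneg) (smt (verit) zero_less_power)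
      finally show "dist (x i) (x j) < e"
        using \<open>0 < e\<close> by (simp add: dist_norm power2_less_imp_less)
    qed
  qed
  then obtain z where z: "x \<longlonglongrightarrow> z" using Cauchy_convergent_iff convergent_def by blast
  have Jlim: "(\<lambda>n. J (p n)) \<longlonglongrightarrow> m"
  proof (rule tendsto_sandwich[of "\<lambda>_. m" _ _ "\<lambda>n. m + 1 / Suc n"])
    show "(\<lambda>n. m + 1 / Suc n) \<longlonglongrightarrow> m"
      using tendsto_add[OF tendsto_const LIMSEQ_inverse_real_of_nat, of m]
      by (simp add: inverse_eq_divide)
  qed (use m p in \<open>auto intro!: always_eventually less_imp_le\<close>)
  have "r = inner s z" if "(s, r) \<in> F" for s r
  proof -
    define b where "b = inner z s - r"
    have "0 \<le> 2 * l * b + l\<^sup>2 * (norm s)\<^sup>2" for l :: real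
    proof -
      have "m \<le> J (p n) + (2 * l * (inner (x n) s - r) + l\<^sup>2 * (norm s)\<^sup>2)" for n
      proof -
        have "p n + l *\<^sub>R (s, r) \<in> F" using p that sub by (simp only: subspace_add subspace_scale)
        from m[OF this] have "m \<le> (norm (x n + l *\<^sub>R s))\<^sup>2 - 2 * (snd (p n) + l * r)"
          by (simp add: J_def x_def)
        also have "(norm (x n + l *\<^sub>R s))\<^sup>2 = (norm (x n))\<^sup>2 + 2 * l * inner (x n) s + l\<^sup>2 * (norm s)\<^sup>2"
          by (simp add: power2_norm_eq_inner inner_add_left inner_add_right inner_commute
              power2_eq_square[of l])
        finally show ?thesis by (simp add: J_def x_def algebra_simps)
      qed
      moreover have "(\<lambda>n. J (p n) + (2 * l * (inner (x n) s - r) + l\<^sup>2 * (norm s)\<^sup>2))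
          \<longlonglongrightarrow> m + (2 * l * (inner z s - r) + l\<^sup>2 * (norm s)\<^sup>2)"
        by (intro tendsto_intros Jlim z)
      ultimately have "m \<le> m + (2 * l * (inner z s - r) + l\<^sup>2 * (norm s)\<^sup>2)"
        by (intro LIMSEQ_le_const) auto
      then show ?thesis by (simp add: b_def)
    qed
    \<comment> \<open>Nearly the minimizing \<open>l = - b / \<parallel>s\<parallel>\<^sup>2\<close>, but meaningful also for \<open>s = 0\<close>.\<close>
    from this[of "- b / (1 + (norm s)\<^sup>2)"]
    have "0 \<le> 2 * (- b / (1 + (norm s)\<^sup>2)) * b + (- b / (1 + (norm s)\<^sup>2))\<^sup>2 * (norm s)\<^sup>2" .
    also have "\<dots> \<le> 2 * (- b / (1 + (norm s)\<^sup>2)) * b + (- b / (1 + (norm s)\<^sup>2))\<^sup>2 * (1 + (norm s)\<^sup>2)"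
      by (intro add_left_mono mult_left_mono) auto
    also have "\<dots> = - (b\<^sup>2 / (1 + (norm s)\<^sup>2))"
    proof -
      have "1 + (norm s)\<^sup>2 \<noteq> 0" by (metis add_pos_nonneg less_irrefl zero_le_power2 zero_less_one)
      then have "(- b / (1 + (norm s)\<^sup>2))\<^sup>2 * (1 + (norm s)\<^sup>2) = b\<^sup>2 / (1 + (norm s)\<^sup>2)"
        by (simp add: power_divide power2_eq_square[of "1 + _"])
      then show ?thesis by (simp add: power2_eq_square)
    qed
    finally have "b\<^sup>2 / (1 + (norm s)\<^sup>2) \<le> 0" by simp
    then have "b = 0"
      by (metis add_pos_nonneg divide_le_0_iff less_le_not_le power2_less_eq_zero_iff
          zero_le_power2 zero_less_one)
    then show ?thesis by (simp add: b_def inner_commute)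
  qed
  moreover have "z \<in> closure (fst ` F)"
    unfolding closure_sequential using z p(1) by (intro exI[of _ x]) (auto simp: x_def)
  ultimately show ?thesis by blast
qed

text \<open>The graph of a bounded complex-linear map.  A graph may be written down before it is known
  that its right-hand sides are determined by the left-hand sides, which is then a consequence of
  the bound.\<close>

definition bounded_graph :: "real \<Rightarrow> ('a::complex_inner \<times> 'b::complex_inner) set \<Rightarrow> bool" where
  "bounded_graph C G \<longleftrightarrow> (0, 0) \<in> G \<and>
     (\<forall>s g s' g'. (s, g) \<in> G \<longrightarrow> (s', g') \<in> G \<longrightarrow> (s + s', g + g') \<in> G) \<and>
     (\<forall>c s g. (s, g) \<in> G \<longrightarrow> (c *\<^sub>C s, c *\<^sub>C g) \<in> G) \<and>
     (\<forall>s g. (s, g) \<in> G \<longrightarrow> norm g \<le> C * norm s)"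

lemma bounded_graph_domain:
  assumes "bounded_graph C G" shows "complex_subspace (fst ` G)"
  using assms unfolding bounded_graph_def complex_subspace_def
  by (auto simp: image_iff Bex_def) blast+

text \<open>The real functional \<open>s \<mapsto> Re \<langle>g, \<eta>\<rangle>\<close> is represented by a vector; replacing \<open>s\<close> by its complex
  multiples recovers the complex functional.\<close>

lemma adjoint_vector:
  fixes G :: "('a::chilbert_space \<times> 'b::complex_inner) set"
  assumes G: "bounded_graph C G"
  shows "\<exists>z\<in>closure (fst ` G). \<forall>(s, g)\<in>G. cinner g \<eta> = cinner s z"
proof -
  define F where "F = (\<lambda>(s, g). (s, inner g \<eta>)) ` G"
  have G0: "(0, 0) \<in> G"
    and Ga: "\<And>s g s' g'. (s, g) \<in> G \<Longrightarrow> (s', g') \<in> G \<Longrightarrow> (s + s', g + g') \<in> G"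
    and Gs: "\<And>c s g. (s, g) \<in> G \<Longrightarrow> (c *\<^sub>C s, c *\<^sub>C g) \<in> G"
    and Gb: "\<And>s g. (s, g) \<in> G \<Longrightarrow> norm g \<le> C * norm s"
    using G unfolding bounded_graph_def by blast+
  have "\<exists>z\<in>closure (fst ` F). \<forall>(s, r)\<in>F. r = inner s z"
  proof (rule Riesz_graph)
    show "subspace F"
      unfolding subspace_def
    proof (intro conjI ballI allI)
      show "0 \<in> F" unfolding F_def zero_prod_def using G0 by force
    next
      fix p q assume "p \<in> F" "q \<in> F"
      then obtain s g s' g' where "(s, g) \<in> G" "p = (s, inner g \<eta>)" "(s', g') \<in> G" "q = (s', inner g' \<eta>)"
        unfolding F_def by auto
      with Ga[of s g s' g'] show "p + q \<in> F"
        unfolding F_def by (auto simp: inner_add_left[symmetric] intro!: image_eqI)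
    next
      fix r p assume "p \<in> F"
      then obtain s g where "(s, g) \<in> G" "p = (s, inner g \<eta>)" unfolding F_def by auto
      with Gs[of s g "of_real r"] show "r *\<^sub>R p \<in> F"
        unfolding F_def by (force simp: scaleR_scaleC[symmetric])
    qed
    show "\<bar>r\<bar> \<le> (C * norm \<eta>) * norm s" if sr: "(s, r) \<in> F" for s r
    proof -
      obtain g where g: "(s, g) \<in> G" "r = inner g \<eta>" using sr by (auto simp: F_def)
      have "\<bar>r\<bar> \<le> norm g * norm \<eta>" using g Cauchy_Schwarz_ineq2 by blast
      also have "\<dots> \<le> (C * norm s) * norm \<eta>" by (intro mult_right_mono Gb g) simp
      finally show ?thesis by (simp add: mult_ac)
    qed
  qed
  then obtain z where z: "z \<in> closure (fst ` F)" "\<And>s g. (s, g) \<in> G \<Longrightarrow> inner g \<eta> = inner s z"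
    unfolding F_def by fastforce
  have "cinner g \<eta> = cinner s z" if "(s, g) \<in> G" for s g
  proof (rule Re_cinner_eqI)
    show "Re (c * cinner g \<eta>) = Re (c * cinner s z)" for c
      using z(2)[OF Gs[OF that, of c]] by (simp add: inner_eq_Re_cinner cinner_scaleC_left)
  qed
  moreover have "fst ` F = fst ` G" by (force simp: F_def)
  ultimately show ?thesis using z(1) by auto
qed

lemma adjoint_graph:
  fixes G :: "('a::chilbert_space \<times> 'b::complex_inner) set"
  assumes G: "bounded_graph C G"
  shows "\<exists>S. bounded_linear S \<and> (\<forall>c \<eta>. S (c *\<^sub>C \<eta>) = c *\<^sub>C S \<eta>) \<and> (\<forall>\<eta>. S \<eta> \<in> closure (fst ` G)) \<and>
    (\<forall>(s, g)\<in>G. \<forall>\<eta>. cinner g \<eta> = cinner s (S \<eta>))"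
proof -
  have sub: "complex_subspace (fst ` G)" by (rule bounded_graph_domain[OF G])
  note subcl = complex_subspaceD[OF complex_subspace_closure[OF sub]]
  obtain S where S: "\<And>\<eta>. S \<eta> \<in> closure (fst ` G)"
      "\<And>s g \<eta>. (s, g) \<in> G \<Longrightarrow> cinner g \<eta> = cinner s (S \<eta>)"
  proof -
    have "\<forall>\<eta>. \<exists>z. z \<in> closure (fst ` G) \<and> (\<forall>s g. (s, g) \<in> G \<longrightarrow> cinner g \<eta> = cinner s z)"
      using adjoint_vector[OF G] by blast
    then show ?thesis using that unfolding choice_iff by blast
  qed
  have eqI: "S \<eta> = y" if "y \<in> closure (fst ` G)"
      "\<And>s g. (s, g) \<in> G \<Longrightarrow> cinner g \<eta> = cinner s y" for \<eta> y
  proof (rule cinner_closure_eqI[OF sub S(1) that(1)])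
    fix s assume "s \<in> fst ` G"
    then obtain g where "(s, g) \<in> G" by auto
    then show "cinner s (S \<eta>) = cinner s y" using S(2) that(2) by metis
  qed
  have add: "S (\<eta> + \<eta>') = S \<eta> + S \<eta>'" for \<eta> \<eta>'
    by (rule eqI) (simp_all add: S subcl cinner_add_right)
  have scale: "S (c *\<^sub>C \<eta>) = c *\<^sub>C S \<eta>" for c \<eta>
    by (rule eqI) (simp_all add: S subcl cinner_scaleC_right)
  have bound: "norm (S \<eta>) \<le> norm \<eta> * \<bar>C\<bar>" for \<eta>
  proof -
    have "cmod (cinner s (S \<eta>)) \<le> \<bar>C\<bar> * norm s * norm \<eta>" if "s \<in> closure (fst ` G)" for s
      using that
    proof (rule closure_induct)
      show "closed {s. cmod (cinner s (S \<eta>)) \<le> \<bar>C\<bar> * norm s * norm \<eta>}"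
        by (intro closed_Collect_le continuous_intros cinner.continuous_on)
    next
      fix s assume "s \<in> fst ` G"
      then obtain g where g: "(s, g) \<in> G" by auto
      have "cmod (cinner s (S \<eta>)) \<le> norm g * norm \<eta>"
        using complex_Cauchy_Schwarz S(2)[OF g] by metis
      also have "norm g \<le> C * norm s" using G g unfolding bounded_graph_def by blast
      also have "\<dots> \<le> \<bar>C\<bar> * norm s" by (simp add: mult_right_mono)
      finally show "cmod (cinner s (S \<eta>)) \<le> \<bar>C\<bar> * norm s * norm \<eta>"
        by (simp add: mult_right_mono)
    qed
    from this[OF S(1), of \<eta>] have "norm (S \<eta>) * norm (S \<eta>) \<le> (norm \<eta> * \<bar>C\<bar>) * norm (S \<eta>)"
      by (simp add: cinner_self power2_eq_square norm_mult mult_ac)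
    then show ?thesis
      by (cases "S \<eta> = 0") (auto dest: mult_right_le_imp_le)
  qed
  have "bounded_linear S"
    by (rule bounded_linear_intro[OF add _ bound]) (simp add: scaleR_scaleC scale)
  then show ?thesis using S scale by blast
qed

subsection \<open>Bounded operators\<close>

lemma bounded_opsD: "x \<in> bounded_ops \<Longrightarrow> x (c *\<^sub>C \<xi>) = c *\<^sub>C x \<xi>"
  by (simp add: bounded_ops_def)

lemma op_adj_exists:
  assumes "x \<in> bounded_ops"
  shows "\<exists>!y. y \<in> bounded_ops \<and>
     (\<forall>\<xi> \<eta>. cinner (x \<xi>) \<eta> = cinner \<xi> (y \<eta>))"
proof -
  define G where "G = range (\<lambda>\<xi>. (\<xi>, x \<xi>))"
  have "bounded_graph (norm x) G"
    unfolding bounded_graph_def G_def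
    using assms by (auto simp: blinfun.add_right bounded_opsD norm_blinfun image_iff)
  from adjoint_graph[OF this] obtain S where S: "bounded_linear S" "\<forall>c \<eta>. S (c *\<^sub>C \<eta>) = c *\<^sub>C S \<eta>"
      "\<And>\<xi> \<eta>. cinner (x \<xi>) \<eta> = cinner \<xi> (S \<eta>)"
    unfolding G_def by auto
  show ?thesis
  proof (rule ex1I)
    show "Blinfun S \<in> bounded_ops \<and>
        (\<forall>\<xi> \<eta>. cinner (x \<xi>) \<eta> = cinner \<xi> ((Blinfun S) \<eta>))"
      using S by (simp add: bounded_ops_def bounded_linear_Blinfun_apply)
  next
    fix y assume y: "y \<in> bounded_ops \<and>
        (\<forall>\<xi> \<eta>. cinner (x \<xi>) \<eta> = cinner \<xi> (y \<eta>))"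
    have "y \<eta> = S \<eta>" for \<eta>
      by (rule cinner_closure_eqI[of UNIV])
        (use y S in \<open>auto simp: complex_subspace_def\<close>)
    then show "y = Blinfun S"
      using S by (auto intro!: blinfun_eqI simp: bounded_linear_Blinfun_apply)
  qed
qed

lemma op_adj_in [simp]: "x \<in> bounded_ops \<Longrightarrow> op_adj x \<in> bounded_ops"
  and cinner_op_adj: "x \<in> bounded_ops \<Longrightarrow>
    cinner (x \<xi>) \<eta> = cinner \<xi> ((op_adj x) \<eta>)"
  using theI'[OF op_adj_exists] unfolding op_adj_def[symmetric] by blast+

lemma cinner_op_adj': "x \<in> bounded_ops \<Longrightarrow>
    cinner \<xi> (x \<eta>) = cinner ((op_adj x) \<xi>) \<eta>"
  using cinner_op_adj[of x \<eta> \<xi>] by (simp add: cinner_commute[of \<xi>] cinner_commute[of _ \<eta>])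

lemma op_adj_eqI:
  assumes "x \<in> bounded_ops" "y \<in> bounded_ops"
    and "\<And>\<xi> \<eta>. cinner (x \<xi>) \<eta> = cinner \<xi> (y \<eta>)"
  shows "op_adj x = y"
  using the1_equality[OF op_adj_exists[OF assms(1)]] assms unfolding op_adj_def by blast

lemma op_scale_apply [simp]: "(op_scale c x) \<xi> = c *\<^sub>C x \<xi>"
  unfolding op_scale_def
  by (simp add: bounded_linear_Blinfun_apply
      bounded_linear_compose[OF scaleC.bounded_linear_right blinfun.bounded_linear_right])

lemma bounded_ops_closed [simp]:
  "id_blinfun \<in> bounded_ops" "0 \<in> bounded_ops"
  "x \<in> bounded_ops \<Longrightarrow> y \<in> bounded_ops \<Longrightarrow> x + y \<in> bounded_ops"
  "x \<in> bounded_ops \<Longrightarrow> y \<in> bounded_ops \<Longrightarrow> x - y \<in> bounded_ops"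
  "x \<in> bounded_ops \<Longrightarrow> y \<in> bounded_ops \<Longrightarrow> x o\<^sub>L y \<in> bounded_ops"
  "x \<in> bounded_ops \<Longrightarrow> op_scale c x \<in> bounded_ops"
  "x \<in> bounded_ops \<Longrightarrow> r *\<^sub>R x \<in> bounded_ops"
  by (simp_all add: bounded_ops_def blinfun.add_left blinfun.diff_left scaleC_add_right
      scaleC.diff_right scaleC_scaleC mult.commute blinfun.scaleR_left scaleC_scaleR)

lemma op_scale_of_real: "op_scale (of_real r) x = r *\<^sub>R x"
  by (rule blinfun_eqI) (simp add: scaleR_scaleC blinfun.scaleR_left)

lemma op_adj_simps [simp]:
  "x \<in> bounded_ops \<Longrightarrow> op_adj (op_adj x) = x"
  "x \<in> bounded_ops \<Longrightarrow> y \<in> bounded_ops \<Longrightarrow> op_adj (x o\<^sub>L y) = op_adj y o\<^sub>L op_adj x"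
  "x \<in> bounded_ops \<Longrightarrow> y \<in> bounded_ops \<Longrightarrow> op_adj (x + y) = op_adj x + op_adj y"
  "x \<in> bounded_ops \<Longrightarrow> y \<in> bounded_ops \<Longrightarrow> op_adj (x - y) = op_adj x - op_adj y"
  "x \<in> bounded_ops \<Longrightarrow> op_adj (r *\<^sub>R x) = r *\<^sub>R op_adj x"
  "op_adj id_blinfun = id_blinfun" "op_adj 0 = 0"
        apply (rule op_adj_eqI; simp add: cinner_op_adj'[symmetric])
       apply (rule op_adj_eqI; simp add: cinner_op_adj)
  by (rule op_adj_eqI; simp add: cinner_op_adj cinner.add_left cinner.add_right
        blinfun.add_left blinfun.diff_left blinfun.scaleR_left cinner.diff_left cinner.diff_right
        cinner.scaleR_left cinner.scaleR_right)+

lemma norm_op_adj_le: "x \<in> bounded_ops \<Longrightarrow> norm (op_adj x) \<le> norm x"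
proof (rule norm_blinfun_bound)
  fix \<xi> assume x: "x \<in> bounded_ops"
  let ?a = "norm ((op_adj x) \<xi>)"
  have "?a\<^sup>2 = cmod (cinner (x ((op_adj x) \<xi>)) \<xi>)"
    using x by (subst cinner_op_adj) (simp_all add: cinner_self norm_mult power2_eq_square)
  also have "\<dots> \<le> norm (x ((op_adj x) \<xi>)) * norm \<xi>"
    by (rule complex_Cauchy_Schwarz)
  also have "\<dots> \<le> (norm x * ?a) * norm \<xi>" by (intro mult_right_mono norm_blinfun) simp
  finally have "?a * ?a \<le> (norm x * norm \<xi>) * ?a" by (simp add: power2_eq_square mult_ac)
  then show "?a \<le> norm x * norm \<xi>"
    by (cases "?a = 0") (auto dest: mult_right_le_imp_le)
qed simp

text \<open>Being the adjoint of an adjoint, a bounded operator can be prescribed on any subspace.\<close>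

lemma extend_bounded_graph:
  fixes G :: "('a::chilbert_space \<times> 'a) set"
  assumes "bounded_graph C G"
  shows "\<exists>T\<in>bounded_ops. \<forall>(s, g)\<in>G. blinfun_apply T s = g"
proof -
  obtain S where S: "bounded_linear S" "\<forall>c \<eta>. S (c *\<^sub>C \<eta>) = c *\<^sub>C S \<eta>"
      "\<And>s g \<eta>. (s, g) \<in> G \<Longrightarrow> cinner g \<eta> = cinner s (S \<eta>)"
    using adjoint_graph[OF assms] by fast
  define y where "y = Blinfun S"
  have y: "y \<in> bounded_ops" "\<And>\<eta>. y \<eta> = S \<eta>"
    using S by (simp_all add: bounded_ops_def y_def bounded_linear_Blinfun_apply)
  have "blinfun_apply (op_adj y) s = g" if "(s, g) \<in> G" for s g
  proof (rule cinner_closure_eqI[of UNIV])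
    fix \<eta>
    have "cinner (blinfun_apply (op_adj y) s) \<eta> = cinner g \<eta>"
      using S(3)[OF that, of \<eta>] y by (simp add: cinner_op_adj'[symmetric])
    then show "cinner \<eta> (blinfun_apply (op_adj y) s) = cinner \<eta> g"
      by (simp add: cinner_commute[of \<eta>])
  qed (auto simp: complex_subspace_def)
  then show ?thesis using y by (intro bexI[of _ "op_adj y"]) auto
qed

section \<open>Von Neumann algebras\<close>

interpretation opc: bounded_bilinear "(o\<^sub>L)"
  by (rule bounded_bilinear_blinfun_compose)

lemma opc_assoc: "(x o\<^sub>L y) o\<^sub>L z = x o\<^sub>L (y o\<^sub>L z)"
  by (rule blinfun_eqI) simp

lemma opc_id [simp]: "id_blinfun o\<^sub>L x = x" "x o\<^sub>L id_blinfun = x"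
  by (rule blinfun_eqI, simp)+

lemma op_scale_opc:
  "op_scale c x o\<^sub>L y = op_scale c (x o\<^sub>L y)"
  "x \<in> bounded_ops \<Longrightarrow> x o\<^sub>L op_scale c y = op_scale c (x o\<^sub>L y)"
  by (rule blinfun_eqI, simp add: bounded_opsD)+

lemma bounded_ops_pointwise_limit:
  assumes "\<And>n::nat. X n \<in> bounded_ops" "\<And>\<xi>. (\<lambda>n. blinfun_apply (X n) \<xi>) \<longlonglongrightarrow> blinfun_apply Y \<xi>"
  shows "Y \<in> bounded_ops"
proof -
  have "Y (c *\<^sub>C \<xi>) = c *\<^sub>C Y \<xi>" for c \<xi>
  proof (rule LIMSEQ_unique[OF assms(2)])
    show "(\<lambda>n. (X n) (c *\<^sub>C \<xi>)) \<longlonglongrightarrow> c *\<^sub>C Y \<xi>"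
      using assms by (simp add: bounded_opsD scaleC.tendsto)
  qed
  then show ?thesis by (simp add: bounded_ops_def)
qed

lemma commutant_subset: "commutant S \<subseteq> bounded_ops"
  by (auto simp: commutant_def)

lemma commutant_pointwise_limit:
  assumes X: "\<And>n::nat. X n \<in> commutant S"
    and lim: "\<And>\<xi>. (\<lambda>n. blinfun_apply (X n) \<xi>) \<longlonglongrightarrow> blinfun_apply Y \<xi>"
  shows "Y \<in> commutant S"
proof -
  have "Y \<in> bounded_ops"
    by (rule bounded_ops_pointwise_limit[OF _ lim]) (use X commutant_subset[of S] in blast)
  moreover have "Y o\<^sub>L y = y o\<^sub>L Y" if "y \<in> S" for y
  proof (rule blinfun_eqI)
    fix \<xi>
    have "(\<lambda>n. (X n) (y \<xi>)) \<longlonglongrightarrow> y (Y \<xi>)"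
    proof -
      have "(X n) (y \<xi>) = y (X n \<xi>)" for n
      proof -
        have "X n o\<^sub>L y = y o\<^sub>L X n" using X[of n] that by (simp add: commutant_def)
        then show ?thesis by (simp flip: blinfun_apply_blinfun_compose)
      qed
      then show ?thesis using lim by (simp add: blinfun.tendsto)
    qed
    then show "(Y o\<^sub>L y) \<xi> = (y o\<^sub>L Y) \<xi>"
      using LIMSEQ_unique[OF lim] by simp
  qed
  ultimately show ?thesis by (simp add: commutant_def)
qed

lemma commutant_closed:
  "id_blinfun \<in> commutant S" "0 \<in> commutant S"
  "x \<in> commutant S \<Longrightarrow> y \<in> commutant S \<Longrightarrow> x + y \<in> commutant S"
  "x \<in> commutant S \<Longrightarrow> y \<in> commutant S \<Longrightarrow> x - y \<in> commutant S"
  "x \<in> commutant S \<Longrightarrow> y \<in> commutant S \<Longrightarrow> x o\<^sub>L y \<in> commutant S"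
  "x \<in> commutant S \<Longrightarrow> r *\<^sub>R x \<in> commutant S"
      apply (simp_all add: commutant_def opc.add_left opc.add_right opc.diff_left opc.diff_right
      opc.scaleR_left opc.scaleR_right)
  by (metis opc_assoc)

lemma commutant_op_scale:
  "S \<subseteq> bounded_ops \<Longrightarrow> x \<in> commutant S \<Longrightarrow> op_scale c x \<in> commutant S"
  unfolding commutant_def by (auto simp: op_scale_opc)

lemma commutant_antimono: "S \<subseteq> T \<Longrightarrow> commutant T \<subseteq> commutant S"
  by (auto simp: commutant_def)

lemma subset_bicommutant: "S \<subseteq> bounded_ops \<Longrightarrow> S \<subseteq> commutant (commutant S)"
  by (auto simp: commutant_def)

lemma commutant_bicommutant:
  "S \<subseteq> bounded_ops \<Longrightarrow> commutant (commutant (commutant S)) = commutant S"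
  by (meson commutant_antimono commutant_subset subset_antisym subset_bicommutant)

context
  fixes N :: "('h::chilbert_space \<Rightarrow>\<^sub>L 'h) set"
  assumes N: "von_neumann_algebra N"
begin

lemma vN_bicommutant: "commutant (commutant N) = N"
  using N by (simp add: von_neumann_algebra_def)

lemma vN_bounded: "x \<in> N \<Longrightarrow> x \<in> bounded_ops"
  using N by (auto simp: von_neumann_algebra_def)

lemma vN_closed:
  "id_blinfun \<in> N" "0 \<in> N" "x \<in> N \<Longrightarrow> op_adj x \<in> N"
  "x \<in> N \<Longrightarrow> y \<in> N \<Longrightarrow> x + y \<in> N" "x \<in> N \<Longrightarrow> y \<in> N \<Longrightarrow> x - y \<in> N"
  "x \<in> N \<Longrightarrow> y \<in> N \<Longrightarrow> x o\<^sub>L y \<in> N" "x \<in> N \<Longrightarrow> r *\<^sub>R x \<in> N" "x \<in> N \<Longrightarrow> op_scale c x \<in> N"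
  using commutant_closed[where S="commutant N"] commutant_op_scale[where S="commutant N"] commutant_subset[of N] N
  unfolding vN_bicommutant by (simp_all add: von_neumann_algebra_def)

lemma vN_sum: "(\<And>i. i \<in> I \<Longrightarrow> f i \<in> N) \<Longrightarrow> sum f I \<in> N"
  by (induction I rule: infinite_finite_induct) (simp_all add: vN_closed)

lemma vN_pointwise_limit:
  assumes "\<And>n::nat. X n \<in> N"
    and "\<And>\<xi>. (\<lambda>n. blinfun_apply (X n) \<xi>) \<longlonglongrightarrow> blinfun_apply Y \<xi>"
  shows "Y \<in> N"
  using commutant_pointwise_limit[of X "commutant N" Y] assms unfolding vN_bicommutant by blast

lemma vN_norm_closed: "closed N"
  unfolding closed_sequential_limits
proof (intro allI impI, elim conjE)
  fix X l assume "\<forall>n. X n \<in> N" "X \<longlonglongrightarrow> l"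
  then show "l \<in> N" by (intro vN_pointwise_limit[of X l] blinfun.tendsto tendsto_const) auto
qed

text \<open>The root is \<open>1 - z\<close>, where \<open>z\<close> is the fixed point of \<open>z \<mapsto> (y + z\<^sup>2) / 2\<close>, a contraction of the
  self-adjoint ball of radius \<open>\<parallel>y\<parallel>\<close>.\<close>

lemma vN_sqrt:
  assumes y: "y \<in> N" "op_adj y = y" and ny: "norm y < 1"
  shows "\<exists>s\<in>N. op_adj s = s \<and> s o\<^sub>L s = id_blinfun - y"
proof -
  define S where "S = {z \<in> N. op_adj z = z \<and> norm z \<le> norm y}"
  define f where "f z = (1/2) *\<^sub>R (y + (z o\<^sub>L z))" for z
  have Sc: "z \<in> bounded_ops" if "z \<in> S" for z using that vN_bounded by (auto simp: S_def)
  have "\<exists>!z\<in>S. f z = z"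
  proof (rule Banach_fix)
    show "complete S"
      unfolding complete_eq_closed closed_sequential_limits
    proof (intro allI impI, elim conjE)
      fix X l assume X: "\<forall>n::nat. X n \<in> S" and lim: "X \<longlonglongrightarrow> l"
      have l: "l \<in> N" using X lim vN_norm_closed
        unfolding closed_sequential_limits S_def by blast
      have "norm l \<le> norm y"
        using X by (intro LIMSEQ_le_const2[OF tendsto_norm[OF lim]]) (auto simp: S_def)
      moreover have "op_adj l = l"
      proof (rule op_adj_eqI)
        show "cinner (l \<xi>) \<eta> = cinner \<xi> (l \<eta>)" for \<xi> \<eta>
        proof (rule LIMSEQ_unique)
          show "(\<lambda>n. cinner (X n \<xi>) \<eta>) \<longlonglongrightarrow> cinner (l \<xi>) \<eta>"
            by (intro cinner.tendsto blinfun.tendsto lim tendsto_const)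
          have "cinner (X n \<xi>) \<eta> = cinner \<xi> (X n \<eta>)" for n
            using X Sc[of "X n"] by (simp add: cinner_op_adj) (simp add: S_def)
          then show "(\<lambda>n. cinner (X n \<xi>) \<eta>) \<longlonglongrightarrow> cinner \<xi> (l \<eta>)"
            by (simp only:) (intro cinner.tendsto blinfun.tendsto lim tendsto_const)
        qed
      qed (use l vN_bounded in auto)
      ultimately show "l \<in> S" using l by (simp add: S_def)
    qed
    show "S \<noteq> {}" using y by (auto simp: S_def)
    show "0 \<le> norm y" "norm y < 1" using ny by auto
    show "f ` S \<subseteq> S"
    proof safe
      fix z assume z: "z \<in> S"
      have "norm (z o\<^sub>L z) \<le> norm z * norm z" by (rule norm_blinfun_compose)
      also have "\<dots> \<le> norm y * 1" using z ny by (intro mult_mono) (auto simp: S_def)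
      finally have "norm (f z) \<le> norm y"
        using norm_triangle_ineq[of y "z o\<^sub>L z"] by (simp add: f_def)
      then show "f z \<in> S"
        using z y vN_bounded by (simp add: S_def f_def vN_closed)
    qed
    show "dist (f z) (f w) \<le> norm y * dist z w" if zw: "z \<in> S" "w \<in> S" for z w
    proof -
      have "f z - f w = (1/2) *\<^sub>R ((z o\<^sub>L (z - w)) + ((z - w) o\<^sub>L w))"
        by (simp add: f_def opc.diff_left opc.diff_right scaleR_diff_right scaleR_add_right)
      then have "dist (f z) (f w) = norm ((z o\<^sub>L (z - w)) + ((z - w) o\<^sub>L w)) / 2"
        by (simp add: dist_norm)
      also have "\<dots> \<le> (norm (z o\<^sub>L (z - w)) + norm ((z - w) o\<^sub>L w)) / 2"
        by (rule divide_right_mono[OF norm_triangle_ineq]) simp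
      also have "\<dots> \<le> (norm y * norm (z - w) + norm (z - w) * norm y) / 2"
      proof -
        have "norm z \<le> norm y" "norm w \<le> norm y" using zw by (simp_all add: S_def)
        then have "norm (z o\<^sub>L (z - w)) \<le> norm y * norm (z - w)"
            "norm ((z - w) o\<^sub>L w) \<le> norm (z - w) * norm y"
          by (meson mult_right_mono mult_left_mono norm_blinfun_compose norm_ge_zero order_trans)+
        then show ?thesis by (intro divide_right_mono add_mono) simp_all
      qed
      finally show ?thesis by (simp add: dist_norm mult.commute)
    qed
  qed
  then obtain z where z: "z \<in> S" "f z = z" by blast
  have "y + (z o\<^sub>L z) = z + z"
  proof -
    have "z + z = f z + f z" using z by simp
    also have "\<dots> = y + (z o\<^sub>L z)" by (simp add: f_def flip: scaleR_left_distrib)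
    finally show ?thesis by simp
  qed
  then have "(id_blinfun - z) o\<^sub>L (id_blinfun - z) = id_blinfun - y"
    by (simp add: opc.diff_left opc.diff_right algebra_simps)
  then show ?thesis
    using z Sc by (intro bexI[of _ "id_blinfun - z"]) (auto simp: S_def vN_closed)
qed

lemma vN_contraction_sqrt:
  assumes a: "a \<in> N" and c: "norm a < c"
  shows "\<exists>s\<in>N. op_adj s = s \<and> (s o\<^sub>L s) = id_blinfun - (1 / c\<^sup>2) *\<^sub>R (op_adj a o\<^sub>L a)"
proof (rule vN_sqrt)
  have ab: "a \<in> bounded_ops" using a vN_bounded by blast
  have c0: "0 < c" using c norm_ge_zero[of a] by linarith
  show "(1 / c\<^sup>2) *\<^sub>R (op_adj a o\<^sub>L a) \<in> N" using a by (simp add: vN_closed)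
  show "op_adj ((1 / c\<^sup>2) *\<^sub>R (op_adj a o\<^sub>L a)) = (1 / c\<^sup>2) *\<^sub>R (op_adj a o\<^sub>L a)"
    using ab by simp
  have "norm (op_adj a o\<^sub>L a) \<le> norm (op_adj a) * norm a" by (rule norm_blinfun_compose)
  also have "\<dots> \<le> norm a * norm a" using norm_op_adj_le[OF ab] by (simp add: mult_right_mono)
  also have "\<dots> < c\<^sup>2" using c by (simp add: power2_eq_square mult_strict_mono')
  finally show "norm ((1 / c\<^sup>2) *\<^sub>R (op_adj a o\<^sub>L a)) < 1"
    using c0 by (simp add: field_simps)
qed

end

subsection \<open>Projections\<close>

lemma is_projectionD:
  assumes "is_projection p"
  shows "p \<in> bounded_ops" "p o\<^sub>L p = p" "op_adj p = p"
  using assms by (auto simp: is_projection_def)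

lemma projection_cinner:
  assumes "is_projection p"
  shows "cinner (p \<xi>) \<xi> = of_real ((norm (p \<xi>))\<^sup>2)"
proof -
  have "p (p \<xi>) = p \<xi>"
    using is_projectionD(2)[OF assms] by (simp flip: blinfun_apply_blinfun_compose)
  then show ?thesis
    using cinner_op_adj[of p "p \<xi>" \<xi>] is_projectionD[OF assms]
    by (simp add: cinner_self)
qed

lemma projection_absorb_commute:
  assumes "is_projection p" "is_projection q" "q o\<^sub>L p = q"
  shows "p o\<^sub>L q = q"
  using arg_cong[OF assms(3), of op_adj] is_projectionD[OF assms(1)] is_projectionD[OF assms(2)]
  by simp

text \<open>For \<open>\<eta> = \<xi> - p \<xi>\<close> one has \<open>\<parallel>q \<eta>\<parallel>\<^sup>2 = \<langle>q \<eta>, \<eta>\<rangle> \<le> \<langle>p \<eta>, \<eta>\<rangle> = 0\<close>.\<close>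

lemma projection_le_absorb:
  assumes p: "is_projection p" and q: "is_projection q" and le: "op_le q p"
  shows "q o\<^sub>L p = q"
proof (rule blinfun_eqI)
  fix \<xi>
  let ?\<eta> = "\<xi> - p \<xi>"
  have "p (p \<xi>) = p \<xi>"
    using arg_cong[OF is_projectionD(2)[OF p], of "\<lambda>x. x \<xi>"] by simp
  then have "p ?\<eta> = 0" by (simp add: blinfun.diff_right)
  moreover have "0 \<le> Re (cinner ((p - q) ?\<eta>) ?\<eta>)"
    using le by (simp add: op_le_def op_pos_def)
  ultimately have "(norm (q ?\<eta>))\<^sup>2 \<le> 0"
    by (simp add: blinfun.diff_left cinner.diff_left cinner.minus_left projection_cinner[OF q])
  then show "(q o\<^sub>L p) \<xi> = q \<xi>"
    by (simp add: blinfun.diff_right)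
qed

lemma projection_diff:
  assumes "is_projection p" "is_projection q" "q o\<^sub>L p = q"
  shows "is_projection (p - q)"
  using projection_absorb_commute[OF assms] assms unfolding is_projection_def
  by (simp add: opc.diff_left opc.diff_right)

lemma projection_id: "is_projection id_blinfun" by (simp add: is_projection_def)

lemma projection_zero: "is_projection 0" by (simp add: is_projection_def)

text \<open>A decreasing sequence of projections converges strongly, by monotone convergence of
  \<open>\<parallel>q\<^sub>n \<xi>\<parallel>\<^sup>2\<close>.\<close>

lemma decreasing_projections_limit:
  assumes q: "\<And>n::nat. is_projection (q n)" and dec: "\<And>n. q (Suc n) o\<^sub>L q n = q (Suc n)"
  obtains Q where "is_projection Q" "\<And>n. Q o\<^sub>L q n = Q"
    "\<And>\<xi>. (\<lambda>n. q n \<xi>) \<longlonglongrightarrow> Q \<xi>"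
proof -
  note qD = is_projectionD[OF q]
  have absorb: "q m o\<^sub>L q n = q m" if "n \<le> m" for m n
    using that
  proof (induction m rule: dec_induct)
    case base then show ?case by (rule qD)
  next
    case (step m)
    have "q (Suc m) o\<^sub>L q n = (q (Suc m) o\<^sub>L q m) o\<^sub>L q n" by (simp add: dec)
    also have "\<dots> = q (Suc m)" by (simp only: opc_assoc step.IH) (rule dec)
    finally show ?case .
  qed
  have diff: "(norm (q n \<xi> - q m \<xi>))\<^sup>2
      = (norm (q n \<xi>))\<^sup>2 - (norm (q m \<xi>))\<^sup>2" if "n \<le> m" for m n \<xi>
  proof -
    have "complex_of_real ((norm ((q n - q m) \<xi>))\<^sup>2)
        = cinner ((q n - q m) \<xi>) \<xi>"
      by (rule projection_cinner[symmetric], rule projection_diff[OF q q absorb[OF that]])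
    also have "\<dots> = complex_of_real
        ((norm (q n \<xi>))\<^sup>2 - (norm (q m \<xi>))\<^sup>2)"
      by (simp add: blinfun.diff_left cinner.diff_left projection_cinner[OF q])
    finally show ?thesis unfolding of_real_eq_iff by (simp add: blinfun.diff_left)
  qed
  have le: "(norm (q m \<xi>))\<^sup>2 \<le> (norm (q n \<xi>))\<^sup>2" if "n \<le> m" for m n \<xi>
    using diff[OF that, of \<xi>]
      zero_le_power2[of "norm (q n \<xi> - q m \<xi>)"] by linarith
  have "\<exists>l. (\<lambda>n. q n \<xi>) \<longlonglongrightarrow> l" for \<xi>
  proof -
    define r where "r n = (norm (q n \<xi>))\<^sup>2" for n
    have "decseq r" unfolding decseq_def r_def using le by blast
    moreover have "\<forall>n. 0 \<le> r n" by (simp add: r_def)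
    ultimately obtain L where "r \<longlonglongrightarrow> L" by (rule decseq_convergent)
    then have C: "Cauchy r" by (rule LIMSEQ_imp_Cauchy)
    have "Cauchy (\<lambda>n. q n \<xi>)"
    proof (rule metric_CauchyI)
      fix e :: real assume "0 < e"
      then obtain k where k: "\<And>m n. k \<le> m \<Longrightarrow> k \<le> n \<Longrightarrow>
          dist (r m) (r n) < e\<^sup>2"
        using metric_CauchyD[OF C, of "e\<^sup>2"] by auto
      have *: "dist (q n \<xi>) (q m \<xi>) < e" if "k \<le> n" "n \<le> m" for m n
      proof -
        have "(dist (q n \<xi>) (q m \<xi>))\<^sup>2 < e\<^sup>2"
          using k[of n m] that diff[of n m \<xi>] by (simp add: dist_norm r_def)
        then show ?thesis using \<open>0 < e\<close> by (simp add: power2_less_imp_less)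
      qed
      show "\<exists>k. \<forall>m\<ge>k. \<forall>n\<ge>k. dist (q m \<xi>) (q n \<xi>) < e"
      proof (intro exI allI impI)
        fix m n assume "k \<le> m" "k \<le> n"
        then show "dist (q m \<xi>) (q n \<xi>) < e"
          using *[of m n] *[of n m] by (cases "m \<le> n") (auto simp: dist_commute)
      qed
    qed
    then show ?thesis by (simp add: Cauchy_convergent_iff convergent_def)
  qed
  then obtain L where L: "\<And>\<xi>. (\<lambda>n. q n \<xi>) \<longlonglongrightarrow> L \<xi>"
    using choice[of "\<lambda>\<xi> l. (\<lambda>n. q n \<xi>) \<longlonglongrightarrow> l"] by auto
  have bl: "bounded_linear L"
  proof (rule bounded_linear_intro)
    show "L (\<xi> + \<eta>) = L \<xi> + L \<eta>" for \<xi> \<eta>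
      by (rule LIMSEQ_unique[OF L]) (simp add: blinfun.add_right tendsto_add L)
    show "L (r *\<^sub>R \<xi>) = r *\<^sub>R L \<xi>" for r \<xi>
      by (rule LIMSEQ_unique[OF L]) (simp add: blinfun.scaleR_right tendsto_scaleR L)
    have "norm (q n \<xi>) \<le> norm \<xi> * norm (q 0)" for n \<xi>
      using power2_le_imp_le[OF le[of 0 n \<xi>]] norm_blinfun[of "q 0" \<xi>] by (simp add: mult.commute)
    then show "norm (L \<xi>) \<le> norm \<xi> * norm (q 0)" for \<xi>
      using Lim_bounded[OF tendsto_norm[OF L[of \<xi>]], of 0 "norm \<xi> * norm (q 0)"] by blast
  qed
  define Q where "Q = Blinfun L"
  have Q: "(\<lambda>n. q n \<xi>) \<longlonglongrightarrow> Q \<xi>" for \<xi>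
    using L bl by (simp add: Q_def bounded_linear_Blinfun_apply)
  have Qb: "Q \<in> bounded_ops" using bounded_ops_pointwise_limit[OF qD(1) Q] .
  have Qabs: "Q o\<^sub>L q n = Q" for n
  proof (rule blinfun_eqI)
    fix \<xi>
    have "(\<lambda>m. (q m) (q n \<xi>)) \<longlonglongrightarrow> Q \<xi>"
    proof (rule Lim_transform_eventually[OF Q])
      show "\<forall>\<^sub>F m in sequentially. q m \<xi> = (q m) (q n \<xi>)"
        using eventually_ge_at_top[of n]
        by eventually_elim (simp flip: blinfun_apply_blinfun_compose add: absorb)
    qed
    then show "(Q o\<^sub>L q n) \<xi> = Q \<xi>"
      using LIMSEQ_unique[OF Q] by simp
  qed
  have "Q o\<^sub>L Q = Q"
  proof (rule blinfun_eqI)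
    fix \<xi>
    have "(\<lambda>n. Q (q n \<xi>)) \<longlonglongrightarrow> Q (Q \<xi>)"
      by (rule blinfun.tendsto[OF tendsto_const Q])
    moreover have "Q (q n \<xi>) = Q \<xi>" for n
      by (simp flip: blinfun_apply_blinfun_compose add: Qabs)
    ultimately show "(Q o\<^sub>L Q) \<xi> = Q \<xi>"
      by (simp add: LIMSEQ_const_iff)
  qed
  moreover have "op_adj Q = Q"
  proof (rule op_adj_eqI[OF Qb Qb])
    show "cinner (Q \<xi>) \<eta> = cinner \<xi> (Q \<eta>)" for \<xi> \<eta>
    proof (rule LIMSEQ_unique)
      show "(\<lambda>n. cinner (q n \<xi>) \<eta>) \<longlonglongrightarrow> cinner (Q \<xi>) \<eta>"
        by (intro cinner.tendsto Q tendsto_const)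
      show "(\<lambda>n. cinner (q n \<xi>) \<eta>) \<longlonglongrightarrow> cinner \<xi> (Q \<eta>)"
        by (simp only: cinner_op_adj[OF qD(1)] qD(3)) (intro cinner.tendsto Q tendsto_const)
    qed
  qed
  ultimately have "is_projection Q" using Qb by (simp add: is_projection_def)
  then show ?thesis using that Qabs Q by blast
qed

section \<open>The trace and the \<open>L\<^sup>2\<close>-embedding\<close>

locale L2_setting =
  fixes M :: "('h::chilbert_space \<Rightarrow>\<^sub>L 'h) set" and \<tau> :: "('h \<Rightarrow>\<^sub>L 'h) \<Rightarrow> complex"
    and \<Lambda> :: "('h \<Rightarrow>\<^sub>L 'h) \<Rightarrow> 'l::chilbert_space"
  assumes tracial: "tracial_von_neumann_algebra M \<tau>"
    and embedding: "L2_embedding M \<tau> \<Lambda>"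
begin

lemma vN: "von_neumann_algebra M"
  using tracial by (simp add: tracial_von_neumann_algebra_def)

lemmas M_bounded = vN_bounded[OF vN] and M_closed [simp] = vN_closed[OF vN]

lemma tau_add: "x \<in> M \<Longrightarrow> y \<in> M \<Longrightarrow> \<tau> (x + y) = \<tau> x + \<tau> y"
  and tau_scale: "x \<in> M \<Longrightarrow> \<tau> (op_scale c x) = c * \<tau> x"
  and tau_id: "\<tau> id_blinfun = 1"
  using tracial
  by (auto simp: tracial_von_neumann_algebra_def state_on_def complex_linear_on_def)

lemma tau_scaleR: "x \<in> M \<Longrightarrow> \<tau> (r *\<^sub>R x) = of_real r * \<tau> x"
  using tau_scale[of x "of_real r"] by (simp add: op_scale_of_real)

lemma tau_diff: "x \<in> M \<Longrightarrow> y \<in> M \<Longrightarrow> \<tau> (x - y) = \<tau> x - \<tau> y"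
  using tau_add[of "x - y" y] by simp

lemma tau_zero [simp]: "\<tau> 0 = 0"
  using tau_scaleR[of 0 0] by simp

lemma tau_commute: "x \<in> M \<Longrightarrow> y \<in> M \<Longrightarrow> \<tau> (x o\<^sub>L y) = \<tau> (y o\<^sub>L x)"
  using tracial by (auto simp: tracial_von_neumann_algebra_def)

lemma Lambda_add: "x \<in> M \<Longrightarrow> y \<in> M \<Longrightarrow> \<Lambda> (x + y) = \<Lambda> x + \<Lambda> y"
  and Lambda_scale: "x \<in> M \<Longrightarrow> \<Lambda> (op_scale c x) = c *\<^sub>C \<Lambda> x"
  and Lambda_cinner: "x \<in> M \<Longrightarrow> y \<in> M \<Longrightarrow> cinner (\<Lambda> x) (\<Lambda> y) = \<tau> (op_adj y o\<^sub>L x)"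
  using embedding by (auto simp: L2_embedding_def)

lemma Lambda_scaleR: "x \<in> M \<Longrightarrow> \<Lambda> (r *\<^sub>R x) = r *\<^sub>R \<Lambda> x"
  using Lambda_scale[of x "of_real r"] by (simp add: op_scale_of_real scaleR_scaleC)

lemma Lambda_diff: "x \<in> M \<Longrightarrow> y \<in> M \<Longrightarrow> \<Lambda> (x - y) = \<Lambda> x - \<Lambda> y"
  using Lambda_add[of "x - y" y] by (simp add: eq_diff_eq)

lemma Lambda_zero [simp]: "\<Lambda> 0 = 0"
  using Lambda_scaleR[of 0 0] by simp

lemma Lambda_sum: "(\<And>i. i \<in> I \<Longrightarrow> f i \<in> M) \<Longrightarrow> \<Lambda> (sum f I) = (\<Sum>i\<in>I. \<Lambda> (f i))"
  by (induction I rule: infinite_finite_induct) (simp_all add: Lambda_add vN_sum[OF vN])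

lemma Lambda_norm: "x \<in> M \<Longrightarrow> \<tau> (op_adj x o\<^sub>L x) = of_real ((norm (\<Lambda> x))\<^sup>2)"
  by (simp flip: Lambda_cinner add: cinner_self)

lemma Lambda_eq_0: "x \<in> M \<Longrightarrow> \<Lambda> x = 0 \<Longrightarrow> x = 0"
  using tracial Lambda_norm[of x] by (auto simp: tracial_von_neumann_algebra_def)

lemma Lambda_norm_adj: "x \<in> M \<Longrightarrow> norm (\<Lambda> (op_adj x)) = norm (\<Lambda> x)"
proof -
  assume x: "x \<in> M"
  have "complex_of_real ((norm (\<Lambda> (op_adj x)))\<^sup>2) = of_real ((norm (\<Lambda> x))\<^sup>2)"
    using x M_bounded[OF x] by (simp only: Lambda_norm[symmetric] M_closed(3))
      (simp add: tau_commute)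
  then show ?thesis unfolding of_real_eq_iff by simp
qed

text \<open>The defect \<open>c\<^sup>2 \<parallel>x\<parallel>\<^sub>2\<^sup>2 - \<parallel>a x\<parallel>\<^sub>2\<^sup>2\<close> is \<open>c\<^sup>2 \<parallel>s x\<parallel>\<^sub>2\<^sup>2\<close> for the root \<open>s\<close> of
  \<open>1 - a\<^sup>* a / c\<^sup>2\<close>.\<close>

lemma Lambda_mult_le:
  assumes a: "a \<in> M" and x: "x \<in> M"
  shows "norm (\<Lambda> (a o\<^sub>L x)) \<le> norm a * norm (\<Lambda> x)"
proof (rule field_le_epsilon)
  fix e :: real assume "0 < e"
  \<comment> \<open>A root needs \<open>\<parallel>a\<parallel> < c\<close> strictly; the slack is chosen to contribute at most \<open>e\<close>.\<close>
  define c where "c = norm a + e / (norm (\<Lambda> x) + 1)"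
  have pos: "0 < norm (\<Lambda> x) + 1" by (simp add: add_nonneg_pos)
  then have c: "norm a < c" using \<open>0 < e\<close> by (simp add: c_def)
  then have c0: "0 < c" using norm_ge_zero[of a] by linarith
  have ab: "a \<in> bounded_ops" "x \<in> bounded_ops" using a x M_bounded by blast+
  obtain s where s: "s \<in> M" "op_adj s = s"
      "(s o\<^sub>L s) = id_blinfun - (1 / c\<^sup>2) *\<^sub>R (op_adj a o\<^sub>L a)"
    using vN_contraction_sqrt[OF vN a c] by blast
  have sb: "s \<in> bounded_ops" using s M_bounded by blast
  have "op_adj (s o\<^sub>L x) o\<^sub>L (s o\<^sub>L x) = op_adj x o\<^sub>L ((s o\<^sub>L s) o\<^sub>L x)"
    using ab sb s(2) by (simp add: opc_assoc)
  also have "\<dots> = (op_adj x o\<^sub>L x) - (1 / c\<^sup>2) *\<^sub>R (op_adj (a o\<^sub>L x) o\<^sub>L (a o\<^sub>L x))"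
    unfolding s(3) using ab
    by (simp add: opc_assoc opc.diff_left opc.diff_right opc.scaleR_left opc.scaleR_right)
  finally have eq: "op_adj (s o\<^sub>L x) o\<^sub>L (s o\<^sub>L x)
      = (op_adj x o\<^sub>L x) - (1 / c\<^sup>2) *\<^sub>R (op_adj (a o\<^sub>L x) o\<^sub>L (a o\<^sub>L x))" .
  have "complex_of_real ((norm (\<Lambda> (s o\<^sub>L x)))\<^sup>2)
      = of_real ((norm (\<Lambda> x))\<^sup>2) - of_real (1 / c\<^sup>2) * of_real ((norm (\<Lambda> (a o\<^sub>L x)))\<^sup>2)"
    using arg_cong[OF eq, of \<tau>] a x s(1)
    by (simp add: tau_diff tau_scaleR Lambda_norm del: op_adj_simps of_real_power of_real_divide)
  then have "complex_of_real ((norm (\<Lambda> (s o\<^sub>L x)))\<^sup>2)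
      = of_real ((norm (\<Lambda> x))\<^sup>2 - (norm (\<Lambda> (a o\<^sub>L x)))\<^sup>2 / c\<^sup>2)" by simp
  then have "(norm (\<Lambda> (s o\<^sub>L x)))\<^sup>2 = (norm (\<Lambda> x))\<^sup>2 - (norm (\<Lambda> (a o\<^sub>L x)))\<^sup>2 / c\<^sup>2"
    by (simp only: of_real_eq_iff)
  then have "0 \<le> (norm (\<Lambda> x))\<^sup>2 - (norm (\<Lambda> (a o\<^sub>L x)))\<^sup>2 / c\<^sup>2"
    using zero_le_power2[of "norm (\<Lambda> (s o\<^sub>L x))"] by (simp only:)
  then have "(norm (\<Lambda> (a o\<^sub>L x)))\<^sup>2 \<le> (c * norm (\<Lambda> x))\<^sup>2"
    using c0 by (simp add: field_simps power_mult_distrib)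
  then have "norm (\<Lambda> (a o\<^sub>L x)) \<le> c * norm (\<Lambda> x)"
    by (rule power2_le_imp_le) (use c0 in simp)
  also have "\<dots> = norm a * norm (\<Lambda> x) + e * (norm (\<Lambda> x) / (norm (\<Lambda> x) + 1))"
    by (simp add: c_def algebra_simps)
  also have "\<dots> \<le> norm a * norm (\<Lambda> x) + e * 1"
    using pos \<open>0 < e\<close> by (intro add_left_mono mult_left_mono) auto
  finally show "norm (\<Lambda> (a o\<^sub>L x)) \<le> norm a * norm (\<Lambda> x) + e" by simp
qed

lemma Lambda_mult_right_le:
  assumes a: "a \<in> M" and x: "x \<in> M"
  shows "norm (\<Lambda> (x o\<^sub>L a)) \<le> norm a * norm (\<Lambda> x)"
proof -
  have b: "a \<in> bounded_ops" "x \<in> bounded_ops" using a x M_bounded by blast+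
  have "norm (\<Lambda> (x o\<^sub>L a)) = norm (\<Lambda> (op_adj a o\<^sub>L op_adj x))"
    using Lambda_norm_adj[of "x o\<^sub>L a"] a x b by simp
  also have "\<dots> \<le> norm (op_adj a) * norm (\<Lambda> (op_adj x))"
    using a x by (intro Lambda_mult_le) auto
  also have "\<dots> \<le> norm a * norm (\<Lambda> x)"
    using x norm_op_adj_le[OF b(1)] by (simp add: Lambda_norm_adj mult_right_mono)
  finally show ?thesis .
qed


section \<open>Weakly small unitaries in diffuse subalgebras\<close>

lemma tau_projection:
  assumes "p \<in> M" "is_projection p"
  shows "\<tau> p = of_real ((norm (\<Lambda> p))\<^sup>2)"
  using Lambda_norm[OF assms(1)] is_projectionD[OF assms(2)] by simp

lemma tau_projection_nonneg:
  assumes "p \<in> M" "is_projection p" shows "0 \<le> Re (\<tau> p)"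
  using tau_projection[OF assms] by simp

lemma tau_projection_pos:
  assumes "p \<in> M" "is_projection p" "p \<noteq> 0" shows "0 < Re (\<tau> p)"
  using tau_projection[OF assms(1,2)] Lambda_eq_0[OF assms(1)] assms(3) by auto

text \<open>Cauchy--Schwarz for \<open>\<tau>(p z) = \<langle>p z, p\<rangle>\<close>.  The bound is linear in \<open>\<tau>(p)\<close>, so its square is summable
  over a partition of unity, with a sum that is small if all \<open>\<tau>(p)\<close> are.\<close>

lemma tau_projection_mult:
  assumes p: "p \<in> M" "is_projection p" and z: "z \<in> M"
  shows "cmod (\<tau> (p o\<^sub>L z)) \<le> norm z * Re (\<tau> p)"
proof -
  note pD = is_projectionD[OF p(2)]
  have "\<tau> (p o\<^sub>L z) = cinner (\<Lambda> (p o\<^sub>L z)) (\<Lambda> p)"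
    using p z pD by (simp add: Lambda_cinner opc_assoc[symmetric])
  then have "cmod (\<tau> (p o\<^sub>L z)) \<le> norm (\<Lambda> (p o\<^sub>L z)) * norm (\<Lambda> p)"
    by (simp add: complex_Cauchy_Schwarz)
  also have "\<dots> \<le> (norm z * norm (\<Lambda> p)) * norm (\<Lambda> p)"
    by (intro mult_right_mono Lambda_mult_right_le z p) simp
  finally show ?thesis using tau_projection[OF p] by (simp add: power2_eq_square mult.assoc)
qed

lemma tau_decreasing_projections:
  assumes qM: "\<And>n::nat. q n \<in> M" and q: "\<And>n. is_projection (q n)"
    and dec: "\<And>n. q (Suc n) o\<^sub>L q n = q (Suc n)"
    and lim: "\<And>\<xi>. (\<lambda>n. q n \<xi>) \<longlonglongrightarrow> 0" and e: "0 < e"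
  shows "\<exists>n. Re (\<tau> (q n)) < e"
proof -
  \<comment> \<open>The increasing net is that of the complements, with supremum \<open>1\<close>.\<close>
  define D where "D = range (\<lambda>n. id_blinfun - q n)"
  have pos: "op_pos p" if "is_projection p" for p :: "'h \<Rightarrow>\<^sub>L 'h"
    using that by (simp add: op_pos_def projection_cinner is_projectionD)
  have step: "op_le (q (Suc n)) (q n)" for n
    unfolding op_le_def by (intro pos projection_diff q dec)
  have le: "op_le (q m) (q n)" if "n \<le> m" for m n
    using that
  proof (induction m rule: dec_induct)
    case base then show ?case by (simp add: op_le_def pos projection_zero)
  next
    case (step m)
    have "q n - q (Suc m) = (q n - q m) + (q m - q (Suc m))" by simp
    moreover have "op_pos (x + y)" if "op_pos x" "op_pos y" for x y :: "'h \<Rightarrow>\<^sub>L 'h"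
      using that by (simp add: op_pos_def blinfun.add_left cinner.add_left)
    ultimately show ?case
      using step.IH \<open>\<And>n. op_le (q (Suc n)) (q n)\<close> by (metis op_le_def)
  qed
  have "Re (\<tau> id_blinfun) = (SUP d\<in>D. Re (\<tau> d))"
  proof -
    have "\<forall>d\<in>D. \<forall>d'\<in>D. \<exists>f\<in>D. op_le d f \<and> op_le d' f"
    proof -
      have "op_le (id_blinfun - q m) (id_blinfun - q (max m n))"
          "op_le (id_blinfun - q n) (id_blinfun - q (max m n))" for m n
        using le[of m "max m n"] le[of n "max m n"] by (simp_all add: op_le_def)
      then show ?thesis unfolding D_def by blast
    qed
    moreover have "is_op_supremum M D id_blinfun"
      unfolding is_op_supremum_def
    proof (intro conjI ballI impI)
      fix d assume "d \<in> D"
      then show "op_le d id_blinfun" using pos[OF q] by (auto simp: D_def op_le_def)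
    next
      fix s assume s: "s \<in> M" "\<forall>d\<in>D. op_le d s"
      show "op_le id_blinfun s"
        unfolding op_le_def op_pos_def
      proof (intro conjI allI)
        show "s - id_blinfun \<in> bounded_ops" using s M_bounded by simp
        fix \<xi>
        define r where "r n = cinner (blinfun_apply (s - (id_blinfun - q n)) \<xi>) \<xi>" for n
        have r: "r n \<in> \<real>" "0 \<le> Re (r n)" for n
          using s(2) by (auto simp: D_def op_le_def op_pos_def r_def)
        have "r \<longlonglongrightarrow> cinner ((s - id_blinfun) \<xi> + 0) \<xi>"
        proof -
          have "s - (id_blinfun - q n) = (s - id_blinfun) + q n" for n by simp
          then have "r = (\<lambda>n. cinner ((s - id_blinfun) \<xi> + q n \<xi>) \<xi>)"
            by (simp only: r_def[abs_def] blinfun.add_left)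
          then show ?thesis by (simp only:) (intro cinner.tendsto tendsto_add tendsto_const lim)
        qed
        then have rl: "r \<longlonglongrightarrow> cinner ((s - id_blinfun) \<xi>) \<xi>" by simp
        have "closed {z. z \<in> \<real> \<and> 0 \<le> Re z}"
          using closed_complex_Reals closed_halfspace_Re_ge[of 0]
          by (simp add: closed_Int Collect_conj_eq)
        from closed_sequentially[OF this _ rl] r
        show "cinner ((s - id_blinfun) \<xi>) \<xi> \<in> \<real>"
          "0 \<le> Re (cinner ((s - id_blinfun) \<xi>) \<xi>)" by auto
      qed
    qed simp
    moreover have "D \<subseteq> M" "D \<noteq> {}" using qM by (auto simp: D_def)
    moreover have "\<forall>d\<in>D. op_pos d"
      using pos[OF projection_diff[OF projection_id q]] by (auto simp: D_def)
    moreover have "normal_on M \<tau>"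
      using tracial by (simp add: tracial_von_neumann_algebra_def)
    ultimately show ?thesis
      by (intro \<open>normal_on M \<tau>\<close>[unfolded normal_on_def, THEN spec[of _ D], THEN spec[of _ id_blinfun],
            THEN mp] conjI)
  qed
  then have "1 - e < (SUP d\<in>D. Re (\<tau> d))" using e by (simp add: tau_id)
  moreover have "bdd_above ((\<lambda>d. Re (\<tau> d)) ` D)"
    by (rule bdd_aboveI[of _ 1])
      (use qM q tau_projection_nonneg in \<open>auto simp: D_def tau_diff tau_id\<close>)
  ultimately obtain d where "d \<in> D" "1 - e < Re (\<tau> d)"
    using less_cSUP_iff[of D "\<lambda>d. Re (\<tau> d)"] by (auto simp: D_def)
  then show ?thesis using qM by (auto simp: D_def tau_diff tau_id)
qed

context
  fixes A
  assumes A: "von_neumann_algebra A" and AM: "A \<subseteq> M" and dA: "diffuse A"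
begin

lemmas A_closed = vN_closed[OF A]

text \<open>Of \<open>q\<close> and \<open>p - q\<close>, for a proper subprojection \<open>q\<close> of \<open>p\<close>, one has at most half the trace.\<close>

lemma halve_projection:
  assumes p: "p \<in> A" "is_projection p" "p \<noteq> 0"
  shows "\<exists>q\<in>A. is_projection q \<and> q \<noteq> 0 \<and> q o\<^sub>L p = q \<and> Re (\<tau> q) \<le> Re (\<tau> p) / 2"
proof -
  have "\<not> minimal_projection A p" using dA by (auto simp: diffuse_def)
  then obtain q where q: "q \<in> A" "is_projection q" "op_le q p" "q \<noteq> 0" "q \<noteq> p"
    using p by (auto simp: minimal_projection_def)
  note abs = projection_le_absorb[OF p(2) q(2,3)]
  have "\<tau> (p - q) = \<tau> p - \<tau> q" using p q AM by (intro tau_diff) auto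
  then have *: "Re (\<tau> (p - q)) = Re (\<tau> p) - Re (\<tau> q)" by simp
  show ?thesis
  proof (cases "Re (\<tau> q) \<le> Re (\<tau> p) / 2")
    case True then show ?thesis using q abs by blast
  next
    case False
    have "(p - q) o\<^sub>L p = p - q" using abs is_projectionD[OF p(2)] by (simp add: opc.diff_left)
    then show ?thesis
      using False * p q projection_diff[OF p(2) q(2) abs]
      by (intro bexI[of _ "p - q"]) (auto simp: A_closed)
  qed
qed

lemma small_subprojection:
  assumes p: "p \<in> A" "is_projection p" "p \<noteq> 0" and e: "0 < e"
  shows "\<exists>q\<in>A. is_projection q \<and> q \<noteq> 0 \<and> q o\<^sub>L p = q \<and> Re (\<tau> q) \<le> e"
proof -
  have "\<exists>q\<in>A. is_projection q \<and> q \<noteq> 0 \<and> q o\<^sub>L p = q \<and> Re (\<tau> q) \<le> Re (\<tau> p) / 2 ^ n" for n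
  proof (induction n)
    case 0 show ?case using p is_projectionD[OF p(2)] by (intro bexI[of _ p]) auto
  next
    case (Suc n)
    then obtain q where q: "q \<in> A" "is_projection q" "q \<noteq> 0" "q o\<^sub>L p = q" "Re (\<tau> q) \<le> Re (\<tau> p) / 2 ^ n"
      by blast
    from halve_projection[OF q(1-3)] obtain r where
      r: "r \<in> A" "is_projection r" "r \<noteq> 0" "r o\<^sub>L q = r" "Re (\<tau> r) \<le> Re (\<tau> q) / 2" by blast
    have "r o\<^sub>L p = (r o\<^sub>L q) o\<^sub>L p" by (simp add: r)
    also have "\<dots> = r" by (simp only: opc_assoc q(4)) (rule r(4))
    finally show ?case using r q by (intro bexI[of _ r]) auto
  qed
  moreover obtain n where "Re (\<tau> p) / 2 ^ n < e"
  proof -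
    have "(\<lambda>n. Re (\<tau> p) / 2 ^ n) \<longlonglongrightarrow> 0"
      using LIMSEQ_divide_realpow_zero[of 2 "Re (\<tau> p)"] by simp
    from order_tendstoD(2)[OF this e] show ?thesis
      using that eventually_sequentially by auto
  qed
  ultimately show ?thesis by (meson less_imp_le order_trans)
qed

text \<open>Greedy exhaustion: each new piece has at least half of the largest admissible trace, so
  nothing can be left over in the limit.\<close>

lemma small_projections_exhaust:
  assumes e: "0 < e"
  obtains q f :: "nat \<Rightarrow> ('h \<Rightarrow>\<^sub>L 'h)" and k :: nat
  where "q 0 = id_blinfun" "\<And>n. q (Suc n) = q n - f n"
    "\<And>n. q n \<in> A \<and> is_projection (q n)" "\<And>n. f n \<in> A \<and> is_projection (f n)"
    "\<And>n. f n o\<^sub>L q n = f n" "\<And>n. Re (\<tau> (f n)) \<le> e" "Re (\<tau> (q k)) \<le> e"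
proof -
  define adm where "adm q = {p\<in>A. is_projection p \<and> p o\<^sub>L q = p \<and> Re (\<tau> p) \<le> e}" for q
  have ex: "\<exists>p\<in>adm q. \<forall>p'\<in>adm q. Re (\<tau> p') \<le> 2 * Re (\<tau> p)" for q
  proof -
    define s where "s = (SUP p\<in>adm q. Re (\<tau> p))"
    have ne: "0 \<in> adm q" using e by (simp add: adm_def A_closed projection_zero)
    have bd: "bdd_above ((\<lambda>p. Re (\<tau> p)) ` adm q)" by (rule bdd_aboveI[of _ e]) (auto simp: adm_def)
    have up: "Re (\<tau> p) \<le> s" if "p \<in> adm q" for p
      unfolding s_def using bd that by (intro cSUP_upper)
    show ?thesis
    proof (cases "s > 0")
      case True
      then have "s / 2 < (SUP p\<in>adm q. Re (\<tau> p))" by (simp add: s_def[symmetric])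
      moreover have "adm q \<noteq> {}" using ne by blast
      ultimately obtain p where "p \<in> adm q" "s / 2 < Re (\<tau> p)"
        using less_cSUP_iff[OF _ bd] by blast
      then show ?thesis by (intro bexI[of _ p]) (use up in \<open>fastforce\<close>)+
    next
      case False
      have "Re (\<tau> p) \<le> 0" if "p \<in> adm q" for p using up[OF that] False by linarith
      then show ?thesis using ne by (intro bexI[of _ 0]) auto
    qed
  qed
  then obtain g where g: "\<And>q. g q \<in> adm q" "\<And>q p'. p' \<in> adm q \<Longrightarrow> Re (\<tau> p') \<le> 2 * Re (\<tau> (g q))"
    by metis
  define q where "q n = ((\<lambda>x. x - g x) ^^ n) id_blinfun" for n
  define f where "f n = g (q n)" for n
  have q0: "q 0 = id_blinfun" and qS: "q (Suc n) = q n - f n" for n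
    by (simp_all add: q_def f_def)
  have f: "f n \<in> A" "is_projection (f n)" "f n o\<^sub>L q n = f n" "Re (\<tau> (f n)) \<le> e" for n
    using g(1)[of "q n"] by (auto simp: f_def adm_def)
  have q: "q n \<in> A \<and> is_projection (q n)" for n
  proof (induction n)
    case 0 show ?case by (simp add: q0 A_closed projection_id)
  next
    case (Suc n)
    then show ?case using f[of n] by (simp add: qS A_closed projection_diff)
  qed
  have dec: "q (Suc n) o\<^sub>L q n = q (Suc n)" for n
    using f(3)[of n] q[of n] is_projectionD(2)[of "q n"] by (simp add: qS opc.diff_left)
  obtain Q where Q: "is_projection Q" "\<And>n. Q o\<^sub>L q n = Q"
      "\<And>\<xi>. (\<lambda>n. q n \<xi>) \<longlonglongrightarrow> Q \<xi>"
    using decreasing_projections_limit[of q] q dec by blast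
  have QA: "Q \<in> A" using vN_pointwise_limit[OF A _ Q(3)] q by blast
  have tq: "Re (\<tau> (q n)) = 1 - (\<Sum>i<n. Re (\<tau> (f i)))" for n
    by (induction n) (use q f AM in \<open>auto simp: q0 qS tau_id tau_diff subset_iff\<close>)
  have "summable (\<lambda>n. Re (\<tau> (f n)))"
  proof (rule summableI_nonneg_bounded)
    show "0 \<le> Re (\<tau> (f n))" for n using f AM by (intro tau_projection_nonneg) auto
    show "(\<Sum>i<n. Re (\<tau> (f i))) \<le> 1" for n
      using tq[of n] tau_projection_nonneg[of "q n"] q[of n] AM by auto
  qed
  then have f0: "(\<lambda>n. Re (\<tau> (f n))) \<longlonglongrightarrow> 0" by (rule summable_LIMSEQ_zero)
  have "Q = 0"
  proof (rule ccontr)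
    assume "Q \<noteq> 0"
    from small_subprojection[OF QA Q(1) this e] obtain r
      where r: "r \<in> A" "is_projection r" "r \<noteq> 0" "r o\<^sub>L Q = r" "Re (\<tau> r) \<le> e" by blast
    have "Re (\<tau> r) \<le> 2 * Re (\<tau> (f n))" for n
    proof -
      have "r o\<^sub>L q n = (r o\<^sub>L Q) o\<^sub>L q n" by (simp add: r)
      also have "\<dots> = r" by (simp only: opc_assoc Q(2)) (rule r(4))
      finally show ?thesis using r unfolding f_def by (intro g(2)) (simp add: adm_def)
    qed
    then have "Re (\<tau> r) \<le> 0"
      using LIMSEQ_le_const[OF tendsto_mult_right_zero[OF f0, of 2]] by blast
    then show False using tau_projection_pos[of r] r AM by auto
  qed
  then have "\<exists>k. Re (\<tau> (q k)) < e"
    using q AM Q(3) by (intro tau_decreasing_projections[where q = q, OF _ _ dec _ e]) auto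
  then obtain k where "Re (\<tau> (q k)) < e" by blast
  then show ?thesis using that[of q f k] q0 qS q f by auto
qed

text \<open>Signs are chosen one projection at a time.  By the parallelogram law one of the two signs
  does not increase the sum of squares by more than the contribution of the new projection.\<close>

lemma weakly_small_unitary:
  assumes Z: "finite Z" "Z \<subseteq> M" and d: "0 < d"
  shows "\<exists>v\<in>A. op_adj v = v \<and> v o\<^sub>L v = id_blinfun \<and> (\<forall>z\<in>Z. cmod (\<tau> (v o\<^sub>L z)) < d)"
proof -
  define K where "K v = (\<Sum>z\<in>Z. (cmod (\<tau> (v o\<^sub>L z)))\<^sup>2)" for v
  define W where "W = (\<Sum>z\<in>Z. (norm z)\<^sup>2)"
  \<comment> \<open>Pieces of trace at most \<open>e\<close> contribute \<open>W e < d\<^sup>2\<close> in total.\<close>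
  define e where "e = d\<^sup>2 / (W + 1)"
  have W0: "0 \<le> W" by (simp add: W_def sum_nonneg)
  have e: "0 < e" using d W0 by (simp add: e_def add_nonneg_pos)
  obtain q f k where q0: "q 0 = id_blinfun" and qS: "\<And>n. q (Suc n) = q n - f n"
    and q: "\<And>n. q n \<in> A \<and> is_projection (q n)" and f: "\<And>n. f n \<in> A \<and> is_projection (f n)"
    and fq: "\<And>n. f n o\<^sub>L q n = f n" and fe: "\<And>n. Re (\<tau> (f n)) \<le> e" and qk: "Re (\<tau> (q k)) \<le> e"
    using small_projections_exhaust[OF e] by metis
  have KP: "K p \<le> W * e * Re (\<tau> p)" if p: "p \<in> A" "is_projection p" "Re (\<tau> p) \<le> e" for p
  proof -
    have pM: "p \<in> M" using p AM by auto
    have t0: "0 \<le> Re (\<tau> p)" by (rule tau_projection_nonneg[OF pM p(2)])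
    have "(cmod (\<tau> (p o\<^sub>L z)))\<^sup>2 \<le> (norm z)\<^sup>2 * (e * Re (\<tau> p))" if "z \<in> Z" for z
    proof -
      have "(cmod (\<tau> (p o\<^sub>L z)))\<^sup>2 \<le> (norm z * Re (\<tau> p))\<^sup>2"
        using tau_projection_mult[OF pM p(2)] that Z by (intro power_mono) auto
      also have "\<dots> = (norm z)\<^sup>2 * (Re (\<tau> p) * Re (\<tau> p))"
        by (simp add: power_mult_distrib power2_eq_square)
      also have "\<dots> \<le> (norm z)\<^sup>2 * (e * Re (\<tau> p))"
        using p t0 by (intro mult_left_mono mult_right_mono) auto
      finally show ?thesis .
    qed
    then show ?thesis
      unfolding K_def W_def mult.assoc sum_distrib_right by (rule sum_mono)
  qed
  have par: "K (v + p) + K (v - p) = 2 * K v + 2 * K p" if "v \<in> A" "p \<in> A" for v p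
  proof -
    have 1: "\<tau> ((v + p) o\<^sub>L z) = \<tau> (v o\<^sub>L z) + \<tau> (p o\<^sub>L z)"
      "\<tau> ((v - p) o\<^sub>L z) = \<tau> (v o\<^sub>L z) - \<tau> (p o\<^sub>L z)" if "z \<in> Z" for z
      using \<open>v \<in> A\<close> \<open>p \<in> A\<close> that Z AM
      by (auto simp: opc.add_left opc.diff_left subset_iff intro!: tau_add tau_diff)
    have 2: "(cmod (a + b))\<^sup>2 + (cmod (a - b))\<^sup>2 = 2 * (cmod a)\<^sup>2 + 2 * (cmod b)\<^sup>2" for a b
      by (simp only: cmod_power2) (simp add: power2_eq_square algebra_simps)
    show ?thesis
      by (simp add: K_def 1 2 sum.distrib[symmetric] sum_distrib_left cong: sum.cong)
  qed
  have ext: "\<exists>v'\<in>A. op_adj v' = v' \<and> v' o\<^sub>L v' = (v o\<^sub>L v) + p \<and> K v' \<le> K v + K p \<and> (v' = v + p \<or> v' = v - p)"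
    if v: "v \<in> A" "op_adj v = v" and p: "p \<in> A" "is_projection p" and vp: "v o\<^sub>L p = 0" for v p
  proof -
    note pD = is_projectionD[OF p(2)]
    have vb: "v \<in> bounded_ops" using v vN_bounded[OF A] by blast
    have pv: "p o\<^sub>L v = 0" using arg_cong[OF vp, of op_adj] vb v pD by simp
    have "K (v + p) \<le> K v + K p \<or> K (v - p) \<le> K v + K p" using par[OF v(1) p(1)] by linarith
    then show ?thesis
    proof
      assume "K (v + p) \<le> K v + K p"
      then show ?thesis
        using v p vb pD vp pv by (intro bexI[of _ "v + p"])
          (simp_all add: A_closed opc.add_left opc.add_right)
    next
      assume "K (v - p) \<le> K v + K p"
      then show ?thesis
        using v p vb pD vp pv by (intro bexI[of _ "v - p"])
          (simp_all add: A_closed opc.diff_left opc.diff_right)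
    qed
  qed
  \<comment> \<open>After \<open>n\<close> steps \<open>v = \<Sum>\<^sub>i\<^sub><\<^sub>n \<plusminus>f\<^sub>i\<close>, a symmetry of the corner under \<open>1 - q\<^sub>n\<close>.\<close>
  have "\<exists>v\<in>A. op_adj v = v \<and> v o\<^sub>L v = id_blinfun - q n \<and> v o\<^sub>L q n = 0 \<and>
      K v \<le> W * e * (1 - Re (\<tau> (q n)))" for n
  proof (induction n)
    case 0
    show ?case by (intro bexI[of _ 0]) (simp_all add: q0 A_closed tau_id K_def)
  next
    case (Suc n)
    then obtain v where v: "v \<in> A" "op_adj v = v" "v o\<^sub>L v = id_blinfun - q n" "v o\<^sub>L q n = 0"
      "K v \<le> W * e * (1 - Re (\<tau> (q n)))" by blast
    note fD = is_projectionD[OF conjunct2[OF f]] and qD = is_projectionD[OF conjunct2[OF q]]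
    have qf: "q n o\<^sub>L f n = f n" using projection_absorb_commute f q fq by blast
    have vf: "v o\<^sub>L f n = 0"
      using opc_assoc[of v "q n" "f n"] by (simp add: qf v)
    from ext[OF v(1,2) _ _ vf] f obtain v' where v': "v' \<in> A" "op_adj v' = v'"
      "v' o\<^sub>L v' = (v o\<^sub>L v) + f n" "K v' \<le> K v + K (f n)" "v' = v + f n \<or> v' = v - f n" by blast
    have "v' o\<^sub>L q (Suc n) = 0"
      using v'(5) v(4) vf fq[of n] fD[of n]
      by (auto simp: qS opc.add_left opc.diff_left opc.diff_right)
    moreover have "v' o\<^sub>L v' = id_blinfun - q (Suc n)" by (simp add: v'(3) v(3) qS)
    moreover have "K v' \<le> W * e * (1 - Re (\<tau> (q (Suc n))))"
    proof -
      have t: "Re (\<tau> (q (Suc n))) = Re (\<tau> (q n)) - Re (\<tau> (f n))"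
        using f[of n] q[of n] AM by (auto simp: qS tau_diff subset_iff)
      have "K (f n) \<le> W * e * Re (\<tau> (f n))" using KP f fe by blast
      then have "K v' \<le> W * e * (1 - Re (\<tau> (q n))) + W * e * Re (\<tau> (f n))"
        using v'(4) v(5) by linarith
      also have "\<dots> = W * e * (1 - Re (\<tau> (q (Suc n))))" unfolding t by (simp add: algebra_simps)
      finally show ?thesis .
    qed
    ultimately show ?case using v'(1,2) by blast
  qed
  from this[of k] obtain v where v: "v \<in> A" "op_adj v = v" "v o\<^sub>L v = id_blinfun - q k" "v o\<^sub>L q k = 0"
    "K v \<le> W * e * (1 - Re (\<tau> (q k)))" by blast
  from ext[OF v(1,2) _ _ v(4)] q obtain v' where v': "v' \<in> A" "op_adj v' = v'"
    "v' o\<^sub>L v' = (v o\<^sub>L v) + q k" "K v' \<le> K v + K (q k)" by blast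
  have "K v' \<le> W * e * (1 - Re (\<tau> (q k))) + W * e * Re (\<tau> (q k))"
    using v'(4) v(5) KP[of "q k"] q qk by force
  also have "\<dots> = W * e" by (simp add: algebra_simps)
  also have "\<dots> < d\<^sup>2" using d W0 by (simp add: e_def field_simps add_nonneg_pos)
  finally have Kd: "K v' < d\<^sup>2" .
  have "cmod (\<tau> (v' o\<^sub>L z)) < d" if "z \<in> Z" for z
  proof -
    have "(cmod (\<tau> (v' o\<^sub>L z)))\<^sup>2 \<le> K v'"
      unfolding K_def using that Z by (intro member_le_sum) auto
    then have "(cmod (\<tau> (v' o\<^sub>L z)))\<^sup>2 < d\<^sup>2" using Kd by (rule order_le_less_trans)
    then show ?thesis by (rule power2_less_imp_less) (use d in simp)
  qed
  then show ?thesis using v' v(3) by (intro bexI[of _ v']) auto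
qed

end

end

section \<open>Bimodules with adjoints\<close>

text \<open>The actions of a bimodule are plain functions; this says that such a function is a bounded
  complex-linear operator.\<close>

definition is_op :: "('a::chilbert_space \<Rightarrow> 'a) \<Rightarrow> bool" where
  "is_op f \<longleftrightarrow> (\<exists>T\<in>bounded_ops. f = blinfun_apply T)"

lemma is_op_add: "is_op f \<Longrightarrow> f (x + y) = f x + f y"
  and is_op_diff: "is_op f \<Longrightarrow> f (x - y) = f x - f y"
  and is_op_scale: "is_op f \<Longrightarrow> f (c *\<^sub>C x) = c *\<^sub>C f x"
  and is_op_zero: "is_op f \<Longrightarrow> f 0 = 0"
  and is_op_sum: "is_op f \<Longrightarrow> f (sum g I) = (\<Sum>i\<in>I. f (g i))"
  by (auto simp: is_op_def blinfun.add_right blinfun.diff_right bounded_opsD blinfun.sum_right)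

lemma is_op_continuous: "is_op f \<Longrightarrow> continuous_on S g \<Longrightarrow> continuous_on S (\<lambda>x. f (g x))"
  by (auto simp: is_op_def intro!: blinfun.continuous_on continuous_on_const)

lemma closure_adjoint:
  assumes f: "is_op f" and g: "is_op g"
    and S: "\<And>x y. x \<in> S \<Longrightarrow> y \<in> S' \<Longrightarrow> cinner (f x) y = cinner x (g y)"
    and x: "x \<in> closure S" and y: "y \<in> closure S'"
  shows "cinner (f x) y = cinner x (g y)"
proof -
  have *: "cinner (f x) y = cinner x (g y)" if "y \<in> S'" for y
    using x
    by (rule closure_induct)
      (intro closed_Collect_eq cinner.continuous_on is_op_continuous[OF f] continuous_intros, simp add: S that)
  show ?thesis
    using y
    by (rule closure_induct)
      (intro closed_Collect_eq cinner.continuous_on is_op_continuous[OF g] continuous_intros, rule *)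
qed

lemma closure_agree:
  assumes f: "is_op f" and g: "is_op g" and S: "\<And>x. x \<in> S \<Longrightarrow> f x = g x" and x: "x \<in> closure S"
  shows "f x = g x"
  using x
  by (rule closure_induct)
    (intro closed_Collect_eq is_op_continuous[OF f] is_op_continuous[OF g] continuous_intros, simp add: S)

lemma closure_image:
  assumes f: "is_op f" and S: "\<And>x. x \<in> S \<Longrightarrow> f x \<in> closure S'" and x: "x \<in> closure S"
  shows "f x \<in> closure S'"
  using x
proof (rule closure_induct)
  have "closed (f -` closure S')"
    using is_op_continuous[OF f continuous_on_id, of UNIV]
    by (intro continuous_closed_vimage closed_closure) (simp add: continuous_on_eq_continuous_at)
  then show "closed {x. f x \<in> closure S'}" by (simp add: vimage_def)
qed (rule S)

lemma closure_norm_le: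
  assumes f: "is_op f" and S: "\<And>x. x \<in> S \<Longrightarrow> norm (f x) \<le> c * norm x" and x: "x \<in> closure S"
  shows "norm (f x) \<le> c * norm x"
  using x
  by (rule closure_induct)
    (intro closed_Collect_le is_op_continuous[OF f] continuous_intros, simp add: S)

text \<open>The part of the axioms of a bimodule that is needed to take adjoints of bimodular maps.\<close>

definition star_bimodule ::
  "('h::chilbert_space \<Rightarrow>\<^sub>L 'h) set \<Rightarrow> ('h \<Rightarrow>\<^sub>L 'h, 'k::chilbert_space) bimodule \<Rightarrow> bool" where
  "star_bimodule N B \<longleftrightarrow> closed (bspace B) \<and> complex_subspace (bspace B) \<and>
     (\<forall>a\<in>N. \<forall>\<xi>\<in>bspace B. lact B a \<xi> \<in> bspace B \<and> ract B a \<xi> \<in> bspace B) \<and>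
     (\<forall>a\<in>N. \<forall>\<xi>\<in>bspace B. \<forall>\<eta>\<in>bspace B.
        cinner (lact B a \<xi>) \<eta> = cinner \<xi> (lact B (op_adj a) \<eta>) \<and>
        cinner (ract B a \<xi>) \<eta> = cinner \<xi> (ract B (op_adj a) \<eta>))"

lemma closed_subspace_eqI:
  assumes "closed S" "complex_subspace S" "x \<in> S" "y \<in> S"
    and "\<And>s. s \<in> S \<Longrightarrow> cinner s x = cinner s y"
  shows "x = y"
  using cinner_closure_eqI[of S x y] assms by (simp add: closure_closed)

text \<open>Taking adjoints reverses a bimodular map, so that disjointness has to be checked in one direction
  only.  The adjoint commutes with \<open>a\<close> because the map itself commutes with \<open>a\<^sup>*\<close>.\<close>

lemma adjoint_bimodular_map:
  fixes H :: "('h::chilbert_space \<Rightarrow>\<^sub>L 'h, 'k::chilbert_space) bimodule"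
    and K :: "('h \<Rightarrow>\<^sub>L 'h, 'l::chilbert_space) bimodule"
  assumes H: "star_bimodule N H" and K: "star_bimodule N K" and adj: "\<And>a. a \<in> N \<Longrightarrow> op_adj a \<in> N"
    and T: "bounded_bimodular_map N H K T"
  shows "\<exists>S. bounded_bimodular_map N K H S \<and>
    (\<forall>\<xi>\<in>bspace H. \<forall>\<eta>\<in>bspace K. cinner (T \<xi>) \<eta> = cinner \<xi> (S \<eta>))"
proof -
  have Hc: "closed (bspace H)" and Hs: "complex_subspace (bspace H)"
    and Hi: "\<And>a \<xi>. a \<in> N \<Longrightarrow> \<xi> \<in> bspace H \<Longrightarrow> lact H a \<xi> \<in> bspace H"
      "\<And>a \<xi>. a \<in> N \<Longrightarrow> \<xi> \<in> bspace H \<Longrightarrow> ract H a \<xi> \<in> bspace H"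
    and Ha: "\<And>a \<xi> \<eta>. a \<in> N \<Longrightarrow> \<xi> \<in> bspace H \<Longrightarrow> \<eta> \<in> bspace H \<Longrightarrow>
        cinner (lact H a \<xi>) \<eta> = cinner \<xi> (lact H (op_adj a) \<eta>)"
      "\<And>a \<xi> \<eta>. a \<in> N \<Longrightarrow> \<xi> \<in> bspace H \<Longrightarrow> \<eta> \<in> bspace H \<Longrightarrow>
        cinner (ract H a \<xi>) \<eta> = cinner \<xi> (ract H (op_adj a) \<eta>)"
    using H by (auto simp: star_bimodule_def)
  have Ki: "\<And>a \<xi>. a \<in> N \<Longrightarrow> \<xi> \<in> bspace K \<Longrightarrow> lact K a \<xi> \<in> bspace K"
      "\<And>a \<xi>. a \<in> N \<Longrightarrow> \<xi> \<in> bspace K \<Longrightarrow> ract K a \<xi> \<in> bspace K"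
    and Ka: "\<And>a \<xi> \<eta>. a \<in> N \<Longrightarrow> \<xi> \<in> bspace K \<Longrightarrow> \<eta> \<in> bspace K \<Longrightarrow>
        cinner (lact K a \<xi>) \<eta> = cinner \<xi> (lact K (op_adj a) \<eta>)"
      "\<And>a \<xi> \<eta>. a \<in> N \<Longrightarrow> \<xi> \<in> bspace K \<Longrightarrow> \<eta> \<in> bspace K \<Longrightarrow>
        cinner (ract K a \<xi>) \<eta> = cinner \<xi> (ract K (op_adj a) \<eta>)"
    using K by (auto simp: star_bimodule_def)
  have T1: "\<And>\<xi>. \<xi> \<in> bspace H \<Longrightarrow> T \<xi> \<in> bspace K"
    and T2: "\<And>\<xi> \<eta>. \<xi> \<in> bspace H \<Longrightarrow> \<eta> \<in> bspace H \<Longrightarrow> T (\<xi> + \<eta>) = T \<xi> + T \<eta>"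
    and T3: "\<And>c \<xi>. \<xi> \<in> bspace H \<Longrightarrow> T (c *\<^sub>C \<xi>) = c *\<^sub>C T \<xi>"
    and T5: "\<And>a \<xi>. a \<in> N \<Longrightarrow> \<xi> \<in> bspace H \<Longrightarrow> T (lact H a \<xi>) = lact K a (T \<xi>)"
      "\<And>a \<xi>. a \<in> N \<Longrightarrow> \<xi> \<in> bspace H \<Longrightarrow> T (ract H a \<xi>) = ract K a (T \<xi>)"
    using T by (auto simp: bounded_bimodular_map_def)
  have "\<exists>C. \<forall>\<xi>\<in>bspace H. norm (T \<xi>) \<le> C * norm \<xi>"
    using T by (simp add: bounded_bimodular_map_def)
  then obtain C where T4: "\<And>\<xi>. \<xi> \<in> bspace H \<Longrightarrow> norm (T \<xi>) \<le> C * norm \<xi>" by blast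
  define G where "G = (\<lambda>\<xi>. (\<xi>, T \<xi>)) ` bspace H"
  have T0: "T 0 = 0" using T3[of 0 0] complex_subspaceD(1)[OF Hs] by simp
  have "bounded_graph C G"
    unfolding bounded_graph_def G_def
    using complex_subspaceD[OF Hs] by (auto simp: image_iff T0 T2 T3 T4)
  from adjoint_graph[OF this] obtain S where S: "bounded_linear S" "\<And>c \<eta>. S (c *\<^sub>C \<eta>) = c *\<^sub>C S \<eta>"
    "\<And>\<eta>. S \<eta> \<in> closure (fst ` G)" "\<And>s g \<eta>. (s, g) \<in> G \<Longrightarrow> cinner g \<eta> = cinner s (S \<eta>)"
    by fast
  have "fst ` G = bspace H" by (force simp: G_def)
  then have SH: "S \<eta> \<in> bspace H" for \<eta> using S(3)[of \<eta>] Hc by (simp add: closure_closed)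
  have TS: "cinner (T \<xi>) \<eta> = cinner \<xi> (S \<eta>)" if "\<xi> \<in> bspace H" for \<xi> \<eta>
    using S(4)[of \<xi> "T \<xi>" \<eta>] that by (auto simp: G_def)
  have transport: "S (k \<eta>) = h (S \<eta>)"
    if inv: "\<And>\<xi>. \<xi> \<in> bspace H \<Longrightarrow> h \<xi> \<in> bspace H" "\<And>\<xi>. \<xi> \<in> bspace H \<Longrightarrow> h' \<xi> \<in> bspace H"
      and k: "\<And>\<xi> \<eta>. \<xi> \<in> bspace K \<Longrightarrow> \<eta> \<in> bspace K \<Longrightarrow> cinner (k \<xi>) \<eta> = cinner \<xi> (k' \<eta>)"
      and h: "\<And>\<xi> \<eta>. \<xi> \<in> bspace H \<Longrightarrow> \<eta> \<in> bspace H \<Longrightarrow> cinner (h \<xi>) \<eta> = cinner \<xi> (h' \<eta>)"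
      and Th: "\<And>\<xi>. \<xi> \<in> bspace H \<Longrightarrow> T (h' \<xi>) = k' (T \<xi>)"
      and y: "\<eta> \<in> bspace K" for h h' k k' \<eta>
  proof (rule closed_subspace_eqI[OF Hc Hs SH inv(1)[OF SH]])
    fix \<xi> assume x: "\<xi> \<in> bspace H"
    have "cinner \<xi> (S (k \<eta>)) = cnj (cinner (k \<eta>) (T \<xi>))"
      using TS[OF x] by (simp flip: cinner_commute)
    also have "\<dots> = cnj (cinner \<eta> (T (h' \<xi>)))" by (simp only: k[OF y T1[OF x]] Th[OF x])
    also have "\<dots> = cinner (h' \<xi>) (S \<eta>)"
      using TS[OF inv(2)[OF x]] by (simp flip: cinner_commute)
    also have "\<dots> = cnj (cinner (h (S \<eta>)) \<xi>)"
      using h[OF SH x] by (simp flip: cinner_commute)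
    finally show "cinner \<xi> (S (k \<eta>)) = cinner \<xi> (h (S \<eta>))"
      by (simp flip: cinner_commute)
  qed
  have "S (lact K a \<eta>) = lact H a (S \<eta>)" if "a \<in> N" "\<eta> \<in> bspace K" for a \<eta>
    by (rule transport[where k' = "lact K (op_adj a)" and h' = "lact H (op_adj a)"])
      (use that adj Hi Ha Ka T5 in auto)
  moreover have "S (ract K a \<eta>) = ract H a (S \<eta>)" if "a \<in> N" "\<eta> \<in> bspace K" for a \<eta>
    by (rule transport[where k' = "ract K (op_adj a)" and h' = "ract H (op_adj a)"])
      (use that adj Hi Ha Ka T5 in auto)
  moreover obtain D where "\<And>\<eta>. norm (S \<eta>) \<le> norm \<eta> * D"
    using bounded_linear.bounded[OF S(1)] by blast
  then have "\<exists>D. \<forall>\<eta>\<in>bspace K. norm (S \<eta>) \<le> D * norm \<eta>" by (metis mult.commute)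
  ultimately have "bounded_bimodular_map N K H S"
    unfolding bounded_bimodular_map_def
    using SH S(2) by (simp add: linear_add[OF bounded_linear.linear[OF S(1)]])
  then show ?thesis using TS by blast
qed

lemma disjoint_bimodulesI:
  assumes H: "star_bimodule N H" and K: "star_bimodule N K" and adj: "\<And>a. a \<in> N \<Longrightarrow> op_adj a \<in> N"
    and zero: "\<And>T \<eta>. bounded_bimodular_map N K H T \<Longrightarrow> \<eta> \<in> bspace K \<Longrightarrow> T \<eta> = 0"
  shows "disjoint_bimodules N H K"
proof -
  have "T \<xi> = 0" if T: "bounded_bimodular_map N H K T" and x: "\<xi> \<in> bspace H" for T \<xi>
  proof -
    obtain S where S: "bounded_bimodular_map N K H S"
      "\<forall>\<xi>\<in>bspace H. \<forall>\<eta>\<in>bspace K. cinner (T \<xi>) \<eta> = cinner \<xi> (S \<eta>)"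
      using adjoint_bimodular_map[OF H K adj T] by blast
    have "T \<xi> \<in> bspace K" using T x by (simp add: bounded_bimodular_map_def)
    then have "cinner (T \<xi>) (T \<xi>) = 0" using S x zero[OF S(1)] by simp
    then show ?thesis by (simp add: cinner_self)
  qed
  then show ?thesis using zero by (auto simp: disjoint_bimodules_def)
qed

subsection \<open>Finite sums\<close>

text \<open>Cyclic bimodules and tensor products are closures of sets of this form.\<close>

definition fsums :: "('i \<Rightarrow> 'a::comm_monoid_add) \<Rightarrow> 'i set \<Rightarrow> 'a set" where
  "fsums f I = {\<Sum>j<n. f (g j) | (n::nat) g. \<forall>j<n. g j \<in> I}"

lemma fsums_zero: "0 \<in> fsums f I"
  unfolding fsums_def by (rule CollectI, rule exI[of _ 0]) auto

lemma fsums_step: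
  assumes "s \<in> fsums f I" "i \<in> I" shows "s + f i \<in> fsums f I"
proof -
  obtain n :: nat and g where g: "s = (\<Sum>j<n. f (g j))" "\<forall>j<n. g j \<in> I"
    using assms by (auto simp: fsums_def)
  have "s + f i = (\<Sum>j<Suc n. f ((g(n := i)) j))" by (simp add: g)
  moreover have "\<forall>j<Suc n. (g(n := i)) j \<in> I" using g assms by (simp add: less_Suc_eq)
  ultimately show ?thesis unfolding fsums_def by blast
qed

lemma fsums_single: "i \<in> I \<Longrightarrow> f i \<in> fsums f I"
  using fsums_step[OF fsums_zero] by force

lemma fsums_induct [consumes 1, case_names zero step]:
  assumes s: "s \<in> fsums f I" and 0: "P 0"
    and step: "\<And>s i. s \<in> fsums f I \<Longrightarrow> P s \<Longrightarrow> i \<in> I \<Longrightarrow> P (s + f i)"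
  shows "P s"
proof -
  have "P (\<Sum>j<n. f (g j)) \<and> (\<Sum>j<n. f (g j)) \<in> fsums f I" if "\<forall>j<n. g j \<in> I" for n :: nat and g
    using that by (induction n) (auto simp: 0 fsums_zero intro: step fsums_step)
  then show ?thesis using s by (auto simp: fsums_def)
qed

lemma fsums_add: "s \<in> fsums f I \<Longrightarrow> s' \<in> fsums f I \<Longrightarrow> s + s' \<in> fsums f I"
  by (rotate_tac, induction s' rule: fsums_induct) (auto simp: add.assoc[symmetric] intro: fsums_step)

lemma complex_subspace_fsums:
  assumes "\<And>c i. i \<in> I \<Longrightarrow> c *\<^sub>C f i \<in> fsums f I"
  shows "complex_subspace (fsums f I)"
  unfolding complex_subspace_def
proof (intro conjI ballI allI)
  fix c s assume "s \<in> fsums f I"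
  then show "c *\<^sub>C s \<in> fsums f I"
    by (induction rule: fsums_induct) (auto simp: fsums_zero scaleC.add_right intro: fsums_add assms)
qed (auto intro: fsums_zero fsums_add)

lemma fsums_adjoint:
  assumes f: "is_op F" and g: "is_op G"
    and S: "\<And>i j. i \<in> I \<Longrightarrow> j \<in> I \<Longrightarrow> cinner (F (f i)) (f j) = cinner (f i) (G (f j))"
    and x: "x \<in> fsums f I" and y: "y \<in> fsums f I"
  shows "cinner (F x) y = cinner x (G y)"
proof -
  have *: "cinner (F x) (f j) = cinner x (G (f j))" if "j \<in> I" for j
    using x by (induction rule: fsums_induct)
      (simp_all add: is_op_zero[OF f] is_op_add[OF f] cinner.add_left S that)
  show ?thesis using y by (induction rule: fsums_induct)
      (simp_all add: is_op_zero[OF g] is_op_add[OF g] cinner.add_right *)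
qed


section \<open>The actions on \<open>L\<^sup>2(M)\<close>\<close>

context L2_setting
begin

text \<open>Every left or right multiplication that is bounded on \<open>M\<close> is the restriction of a bounded operator
  of the whole Hilbert space.\<close>

lemma Lambda_extend:
  assumes f: "\<And>x. x \<in> M \<Longrightarrow> f x \<in> M" "\<And>x y. f (x + y) = f x + f y"
      "\<And>c x. x \<in> M \<Longrightarrow> f (op_scale c x) = op_scale c (f x)"
    and bd: "\<And>x. x \<in> M \<Longrightarrow> norm (\<Lambda> (f x)) \<le> C * norm (\<Lambda> x)"
  shows "\<exists>T. T \<in> bounded_ops \<and> (\<forall>x\<in>M. blinfun_apply T (\<Lambda> x) = \<Lambda> (f x))"
proof -
  define G where "G = (\<lambda>x. (\<Lambda> x, \<Lambda> (f x))) ` M"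
  have "bounded_graph C G"
    unfolding bounded_graph_def
  proof (intro conjI allI impI)
    have "f 0 = 0" using f(2)[of 0 0] by simp
    then show "(0, 0) \<in> G" unfolding G_def by (intro image_eqI[of _ _ 0]) simp_all
    show "(s + s', g + g') \<in> G" if "(s, g) \<in> G" "(s', g') \<in> G" for s g s' g'
    proof -
      from that obtain x y where "x \<in> M" "y \<in> M" "s = \<Lambda> x" "g = \<Lambda> (f x)" "s' = \<Lambda> y" "g' = \<Lambda> (f y)"
        by (auto simp: G_def)
      then show ?thesis unfolding G_def
        by (intro image_eqI[of _ _ "x + y"]) (simp_all add: Lambda_add f)
    qed
    show "(c *\<^sub>C s, c *\<^sub>C g) \<in> G" if "(s, g) \<in> G" for c s g
    proof -
      from that obtain x where "x \<in> M" "s = \<Lambda> x" "g = \<Lambda> (f x)" by (auto simp: G_def)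
      then show ?thesis unfolding G_def
        by (intro image_eqI[of _ _ "op_scale c x"]) (simp_all add: Lambda_scale f)
    qed
    show "norm g \<le> C * norm s" if "(s, g) \<in> G" for s g
      using that by (auto simp: G_def bd)
  qed
  from extend_bounded_graph[OF this] show ?thesis unfolding G_def by auto
qed

text \<open>The set \<open>S\<close> will be \<open>M\<close> for cyclic bimodules and \<open>N\<close> for the coarse bimodule, whose action is
  given by its values on \<open>N\<close> alone.  An extension of the multiplication on \<open>M\<close> serves both.\<close>

lemma L2_left_spec:
  assumes a: "a \<in> M" and S: "S \<subseteq> M"
  shows "is_op (L2_left \<Lambda> S a) \<and> (\<forall>x\<in>S. L2_left \<Lambda> S a (\<Lambda> x) = \<Lambda> (a o\<^sub>L x))"
proof -
  have "\<exists>T. T \<in> bounded_ops \<and> (\<forall>x\<in>M. blinfun_apply T (\<Lambda> x) = \<Lambda> (a o\<^sub>L x))"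
    by (rule Lambda_extend[of _ "norm a"])
      (use a M_bounded in \<open>auto simp: opc.add_right op_scale_opc Lambda_mult_le\<close>)
  then have "\<exists>T. T \<in> bounded_ops \<and> (\<forall>x\<in>S. blinfun_apply T (\<Lambda> x) = \<Lambda> (a o\<^sub>L x))"
    using S by blast
  from someI_ex[OF this] show ?thesis unfolding L2_left_def is_op_def by auto
qed

lemma L2_right_spec:
  assumes a: "a \<in> M" and S: "S \<subseteq> M"
  shows "is_op (L2_right \<Lambda> S a) \<and> (\<forall>x\<in>S. L2_right \<Lambda> S a (\<Lambda> x) = \<Lambda> (x o\<^sub>L a))"
proof -
  have "\<exists>T. T \<in> bounded_ops \<and> (\<forall>x\<in>M. blinfun_apply T (\<Lambda> x) = \<Lambda> (x o\<^sub>L a))"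
    by (rule Lambda_extend[of _ "norm a"])
      (use a in \<open>auto simp: opc.add_left op_scale_opc Lambda_mult_right_le\<close>)
  then have "\<exists>T. T \<in> bounded_ops \<and> (\<forall>x\<in>S. blinfun_apply T (\<Lambda> x) = \<Lambda> (x o\<^sub>L a))"
    using S by blast
  from someI_ex[OF this] show ?thesis unfolding L2_right_def is_op_def by auto
qed

lemma L2_left_op: "a \<in> M \<Longrightarrow> S \<subseteq> M \<Longrightarrow> is_op (L2_left \<Lambda> S a)"
  and L2_left_Lambda: "a \<in> M \<Longrightarrow> S \<subseteq> M \<Longrightarrow> x \<in> S \<Longrightarrow> L2_left \<Lambda> S a (\<Lambda> x) = \<Lambda> (a o\<^sub>L x)"
  and L2_right_op: "a \<in> M \<Longrightarrow> S \<subseteq> M \<Longrightarrow> is_op (L2_right \<Lambda> S a)"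
  and L2_right_Lambda: "a \<in> M \<Longrightarrow> S \<subseteq> M \<Longrightarrow> x \<in> S \<Longrightarrow> L2_right \<Lambda> S a (\<Lambda> x) = \<Lambda> (x o\<^sub>L a)"
  using L2_left_spec L2_right_spec by blast+

lemma L2_left_adjoint:
  assumes a: "a \<in> M" and S: "S \<subseteq> M" and "\<xi> \<in> L2 \<Lambda> S" "\<eta> \<in> L2 \<Lambda> S"
  shows "cinner (L2_left \<Lambda> S a \<xi>) \<eta> = cinner \<xi> (L2_left \<Lambda> S (op_adj a) \<eta>)"
  using assms(3,4) unfolding L2_def
proof (rule closure_adjoint[rotated 3])
  fix \<xi> \<eta> assume "\<xi> \<in> \<Lambda> ` S" "\<eta> \<in> \<Lambda> ` S"
  then obtain x y where "x \<in> S" "\<xi> = \<Lambda> x" "y \<in> S" "\<eta> = \<Lambda> y" by blast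
  then show "cinner (L2_left \<Lambda> S a \<xi>) \<eta> = cinner \<xi> (L2_left \<Lambda> S (op_adj a) \<eta>)"
    using a S M_bounded by (simp add: L2_left_Lambda Lambda_cinner opc_assoc subset_iff)
qed (use a S in \<open>auto simp: L2_left_op\<close>)

lemma L2_right_adjoint:
  assumes a: "a \<in> M" and S: "S \<subseteq> M" and "\<xi> \<in> L2 \<Lambda> S" "\<eta> \<in> L2 \<Lambda> S"
  shows "cinner (L2_right \<Lambda> S a \<xi>) \<eta> = cinner \<xi> (L2_right \<Lambda> S (op_adj a) \<eta>)"
  using assms(3,4) unfolding L2_def
proof (rule closure_adjoint[rotated 3])
  fix \<xi> \<eta> assume "\<xi> \<in> \<Lambda> ` S" "\<eta> \<in> \<Lambda> ` S"
  then obtain x y where x: "x \<in> S" "\<xi> = \<Lambda> x" and y: "y \<in> S" "\<eta> = \<Lambda> y" by blast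
  then have M: "x \<in> M" "y \<in> M" using S by blast+
  have "\<tau> (op_adj y o\<^sub>L (x o\<^sub>L a)) = \<tau> (a o\<^sub>L (op_adj y o\<^sub>L x))"
    using a M by (simp add: tau_commute[of a] opc_assoc)
  then show "cinner (L2_right \<Lambda> S a \<xi>) \<eta> = cinner \<xi> (L2_right \<Lambda> S (op_adj a) \<eta>)"
    using a S x y M M_bounded by (simp add: L2_right_Lambda Lambda_cinner opc_assoc)
qed (use a S in \<open>auto simp: L2_right_op\<close>)

lemma L2_subspace:
  assumes N: "von_neumann_algebra N" "N \<subseteq> M"
  shows "complex_subspace (L2 \<Lambda> N)"
  unfolding L2_def
proof (rule complex_subspace_closure, unfold complex_subspace_def, intro conjI ballI allI)
  show "0 \<in> \<Lambda> ` N" by (rule image_eqI[of _ _ 0]) (simp_all add: vN_closed[OF N(1)])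
next
  fix \<xi> \<eta> assume "\<xi> \<in> \<Lambda> ` N" "\<eta> \<in> \<Lambda> ` N"
  then obtain x y where "x \<in> N" "y \<in> N" "\<xi> = \<Lambda> x" "\<eta> = \<Lambda> y" by blast
  then show "\<xi> + \<eta> \<in> \<Lambda> ` N"
    by (intro image_eqI[of _ _ "x + y"]) (use N in \<open>auto simp: vN_closed[OF N(1)] subset_iff Lambda_add\<close>)
next
  fix c \<xi> assume "\<xi> \<in> \<Lambda> ` N"
  then obtain x where "x \<in> N" "\<xi> = \<Lambda> x" by blast
  then show "c *\<^sub>C \<xi> \<in> \<Lambda> ` N"
    by (intro image_eqI[of _ _ "op_scale c x"])
      (use N in \<open>auto simp: vN_closed[OF N(1)] subset_iff Lambda_scale\<close>)
qed

lemma L2_left_in: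
  assumes N: "von_neumann_algebra N" "N \<subseteq> M" and a: "a \<in> N" and x: "\<xi> \<in> L2 \<Lambda> N"
  shows "L2_left \<Lambda> N a \<xi> \<in> L2 \<Lambda> N"
  unfolding L2_def
proof (rule closure_image[where S = "\<Lambda> ` N" and f = "L2_left \<Lambda> N a"])
  show "is_op (L2_left \<Lambda> N a)" using a N L2_left_op by blast
  fix \<eta> assume "\<eta> \<in> \<Lambda> ` N"
  then obtain x where x: "x \<in> N" "\<eta> = \<Lambda> x" by blast
  have "L2_left \<Lambda> N a \<eta> = \<Lambda> (a o\<^sub>L x)" using a x N by (simp add: L2_left_Lambda subset_iff)
  then have "L2_left \<Lambda> N a \<eta> \<in> \<Lambda> ` N" using vN_closed(6)[OF N(1)] a x by simp
  then show "L2_left \<Lambda> N a \<eta> \<in> closure (\<Lambda> ` N)" by (rule subsetD[OF closure_subset])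
qed (use x in \<open>simp add: L2_def\<close>)

lemma L2_right_in:
  assumes N: "von_neumann_algebra N" "N \<subseteq> M" and a: "a \<in> N" and x: "\<xi> \<in> L2 \<Lambda> N"
  shows "L2_right \<Lambda> N a \<xi> \<in> L2 \<Lambda> N"
  unfolding L2_def
proof (rule closure_image[where S = "\<Lambda> ` N" and f = "L2_right \<Lambda> N a"])
  show "is_op (L2_right \<Lambda> N a)" using a N L2_right_op by blast
  fix \<eta> assume "\<eta> \<in> \<Lambda> ` N"
  then obtain x where x: "x \<in> N" "\<eta> = \<Lambda> x" by blast
  have "L2_right \<Lambda> N a \<eta> = \<Lambda> (x o\<^sub>L a)" using a x N by (simp add: L2_right_Lambda subset_iff)
  then have "L2_right \<Lambda> N a \<eta> \<in> \<Lambda> ` N" using vN_closed(6)[OF N(1)] a x by simp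
  then show "L2_right \<Lambda> N a \<eta> \<in> closure (\<Lambda> ` N)" by (rule subsetD[OF closure_subset])
qed (use x in \<open>simp add: L2_def\<close>)

lemma L2_left_norm:
  assumes "a \<in> M" "S \<subseteq> M" "\<xi> \<in> L2 \<Lambda> S"
  shows "norm (L2_left \<Lambda> S a \<xi>) \<le> norm a * norm \<xi>"
  using assms(3) unfolding L2_def
  by (rule closure_norm_le[rotated 2])
    (use assms in \<open>auto simp: L2_left_op L2_left_Lambda Lambda_mult_le subset_iff\<close>)

lemma cyclic_bimodule_Lambda:
  assumes N: "von_neumann_subalgebra N M" and x: "x \<in> M"
  shows "bspace (cyclic_bimodule \<Lambda> M N (\<Lambda> x))
    = closure (fsums (\<lambda>(a, b). \<Lambda> (a o\<^sub>L (x o\<^sub>L b))) (N \<times> N))"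
proof -
  have NM: "N \<subseteq> M" using N by (simp add: von_neumann_subalgebra_def)
  have eq: "L2_left \<Lambda> M a (L2_right \<Lambda> M b (\<Lambda> x)) = \<Lambda> (a o\<^sub>L (x o\<^sub>L b))" if "a \<in> N" "b \<in> N" for a b
    using that NM x by (simp add: L2_right_Lambda L2_left_Lambda subset_iff)
  have "{\<Sum>j<k. L2_left \<Lambda> M (a j) (L2_right \<Lambda> M (b j) (\<Lambda> x)) | (k::nat) a b. \<forall>j<k. a j \<in> N \<and> b j \<in> N}
      = fsums (\<lambda>(a, b). \<Lambda> (a o\<^sub>L (x o\<^sub>L b))) (N \<times> N)" (is "?A = ?B")
  proof
    show "?A \<subseteq> ?B"
    proof
      fix s assume "s \<in> ?A"
      then obtain k :: nat and a b where ab: "\<forall>j<k. a j \<in> N \<and> b j \<in> N"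
        and s: "s = (\<Sum>j<k. L2_left \<Lambda> M (a j) (L2_right \<Lambda> M (b j) (\<Lambda> x)))" by blast
      have "s = (\<Sum>j<k. (\<lambda>(a, b). \<Lambda> (a o\<^sub>L (x o\<^sub>L b))) (a j, b j))"
        unfolding s using ab by (intro sum.cong) (simp_all add: eq)
      then show "s \<in> ?B" unfolding fsums_def using ab
        by (intro CollectI exI[of _ k] exI[of _ "\<lambda>j. (a j, b j)"]) simp
    qed
    show "?B \<subseteq> ?A"
    proof
      fix s assume "s \<in> ?B"
      then obtain k :: nat and g where g: "\<forall>j<k. g j \<in> N \<times> N"
        and s: "s = (\<Sum>j<k. (\<lambda>(a, b). \<Lambda> (a o\<^sub>L (x o\<^sub>L b))) (g j))" by (auto simp: fsums_def)
      define a b where "a j = fst (g j)" and "b j = snd (g j)" for j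
      have ab: "\<forall>j<k. a j \<in> N \<and> b j \<in> N" using g by (auto simp: a_def b_def mem_Times_iff)
      have "s = (\<Sum>j<k. L2_left \<Lambda> M (a j) (L2_right \<Lambda> M (b j) (\<Lambda> x)))"
        unfolding s using ab by (intro sum.cong) (simp_all add: eq case_prod_beta a_def b_def)
      then show "s \<in> ?A" using ab by blast
    qed
  qed
  then show ?thesis by (simp add: cyclic_bimodule_def)
qed

lemma cyclic_star_bimodule:
  assumes N: "von_neumann_subalgebra N M" and x: "x \<in> M"
  shows "star_bimodule N (cyclic_bimodule \<Lambda> M N (\<Lambda> x))"
    and "bspace (cyclic_bimodule \<Lambda> M N (\<Lambda> x)) \<subseteq> L2 \<Lambda> M"
proof -
  let ?B = "cyclic_bimodule \<Lambda> M N (\<Lambda> x)"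
  let ?f = "\<lambda>(a, b). \<Lambda> (a o\<^sub>L (x o\<^sub>L b))"
  have vNN: "von_neumann_algebra N" and NM: "N \<subseteq> M"
    using N by (simp_all add: von_neumann_subalgebra_def)
  note Nc = vN_closed[OF vNN] and B = cyclic_bimodule_Lambda[OF N x]
  have act: "lact ?B = L2_left \<Lambda> M" "ract ?B = L2_right \<Lambda> M" by (simp_all add: cyclic_bimodule_def)
  have NM': "a \<in> N \<Longrightarrow> a \<in> M" for a using NM by blast
  have sums: "fsums ?f (N \<times> N) \<subseteq> \<Lambda> ` M"
  proof
    fix s assume "s \<in> fsums ?f (N \<times> N)"
    then show "s \<in> \<Lambda> ` M"
    proof (induction rule: fsums_induct)
      case zero show ?case by (rule image_eqI[of _ _ 0]) simp_all
    next
      case (step s i)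
      then obtain y a b where "s = \<Lambda> y" "y \<in> M" "i = (a, b)" "a \<in> N" "b \<in> N" by auto
      then show ?case using x NM'
        by (intro image_eqI[of _ _ "y + (a o\<^sub>L (x o\<^sub>L b))"]) (simp_all add: Lambda_add)
    qed
  qed
  then show sub: "bspace ?B \<subseteq> L2 \<Lambda> M" unfolding B L2_def by (rule closure_mono)
  have "complex_subspace (bspace ?B)"
    unfolding B
  proof (intro complex_subspace_closure complex_subspace_fsums)
    fix c i assume "i \<in> N \<times> N"
    then obtain a b where i: "i = (a, b)" "a \<in> N" "b \<in> N" by auto
    have "c *\<^sub>C ?f i = ?f (op_scale c a, b)"
      using i x NM' by (simp add: op_scale_opc Lambda_scale)
    then show "c *\<^sub>C ?f i \<in> fsums ?f (N \<times> N)" using i Nc by (simp only: ) (intro fsums_single, simp)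
  qed
  moreover have "L2_left \<Lambda> M a \<xi> \<in> bspace ?B" if a: "a \<in> N" and "\<xi> \<in> bspace ?B" for a \<xi>
    using that(2) unfolding B
  proof (rule closure_image[rotated 2])
    have op: "is_op (L2_left \<Lambda> M a)" using a NM' L2_left_op by blast
    then show "is_op (L2_left \<Lambda> M a)" .
    fix s assume "s \<in> fsums ?f (N \<times> N)"
    then have "L2_left \<Lambda> M a s \<in> fsums ?f (N \<times> N)"
    proof (induction rule: fsums_induct)
      case zero show ?case by (simp add: is_op_zero[OF op] fsums_zero)
    next
      case (step s i)
      then obtain b c where i: "i = (b, c)" "b \<in> N" "c \<in> N" by auto
      have "L2_left \<Lambda> M a (?f i) = ?f (a o\<^sub>L b, c)"
        using a i x NM' by (simp add: L2_left_Lambda opc_assoc)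
      moreover have "(a o\<^sub>L b, c) \<in> N \<times> N" using a i Nc by simp
      ultimately show ?case using step by (simp only: is_op_add[OF op] fsums_step)
    qed
    then show "L2_left \<Lambda> M a s \<in> closure (fsums ?f (N \<times> N))"
      by (rule subsetD[OF closure_subset])
  qed
  moreover have "L2_right \<Lambda> M a \<xi> \<in> bspace ?B" if a: "a \<in> N" and "\<xi> \<in> bspace ?B" for a \<xi>
    using that(2) unfolding B
  proof (rule closure_image[rotated 2])
    have op: "is_op (L2_right \<Lambda> M a)" using a NM' L2_right_op by blast
    then show "is_op (L2_right \<Lambda> M a)" .
    fix s assume "s \<in> fsums ?f (N \<times> N)"
    then have "L2_right \<Lambda> M a s \<in> fsums ?f (N \<times> N)"
    proof (induction rule: fsums_induct)
      case zero show ?case by (simp add: is_op_zero[OF op] fsums_zero)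
    next
      case (step s i)
      then obtain b c where i: "i = (b, c)" "b \<in> N" "c \<in> N" by auto
      have "L2_right \<Lambda> M a (?f i) = ?f (b, c o\<^sub>L a)"
        using a i x NM' by (simp add: L2_right_Lambda opc_assoc)
      moreover have "(b, c o\<^sub>L a) \<in> N \<times> N" using a i Nc by simp
      ultimately show ?case using step by (simp only: is_op_add[OF op] fsums_step)
    qed
    then show "L2_right \<Lambda> M a s \<in> closure (fsums ?f (N \<times> N))"
      by (rule subsetD[OF closure_subset])
  qed
  moreover have "closed (bspace ?B)" by (simp add: B)
  ultimately show "star_bimodule N ?B"
    unfolding star_bimodule_def act
    using sub NM' by (auto simp: L2_left_adjoint L2_right_adjoint subset_iff)
qed

end

section \<open>Tensor products and the coarse bimodule\<close>

lemma is_op_compose: "is_op f \<Longrightarrow> is_op g \<Longrightarrow> is_op (\<lambda>x. f (g x))"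
  unfolding is_op_def
  by (elim bexE, rule_tac x="T o\<^sub>L Ta" in bexI) (auto simp: fun_eq_iff)

lemma is_op_minus: "is_op f \<Longrightarrow> is_op g \<Longrightarrow> is_op (\<lambda>x. f x - g x)"
  unfolding is_op_def
  by (elim bexE, rule_tac x="T - Ta" in bexI) (auto simp: fun_eq_iff blinfun.diff_left)

lemma is_op_ident: "is_op (\<lambda>x. x)"
  unfolding is_op_def by (rule bexI[of _ id_blinfun]) auto

lemma closure_fsums_agree:
  assumes f: "is_op F" and g: "is_op G" and I: "\<And>i. i \<in> I \<Longrightarrow> F (f i) = G (f i)"
    and x: "x \<in> closure (fsums f I)"
  shows "F x = G x"
proof (rule closure_agree[OF f g _ x])
  fix s assume "s \<in> fsums f I"
  then show "F s = G s"
    by (induction rule: fsums_induct)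
      (simp_all add: is_op_zero[OF f] is_op_zero[OF g] is_op_add[OF f] is_op_add[OF g] I)
qed

text \<open>The identity \<open>c\<^sup>2 - P\<^sup>* P = c\<^sup>2 Q\<^sup>* Q\<close> on \<open>H\<close>.  Unlike a bare bound \<open>\<parallel>P\<parallel> \<le> c\<close>, it
  passes from \<open>P\<close> to \<open>P \<otimes> 1\<close> by bilinearity.\<close>

definition contraction_defect ::
  "'k::chilbert_space set \<Rightarrow> real \<Rightarrow> ('k \<Rightarrow> 'k) \<Rightarrow> ('k \<Rightarrow> 'k) \<Rightarrow> bool" where
  "contraction_defect H c P Q \<longleftrightarrow> (\<forall>\<xi>\<in>H. \<forall>\<eta>\<in>H. of_real (c\<^sup>2) * cinner \<xi> \<eta> - cinner (P \<xi>) (P \<eta>)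
     = of_real (c\<^sup>2) * cinner (Q \<xi>) (Q \<eta>))"

lemma contraction_defect_closure:
  assumes P: "is_op P" and Q: "is_op Q" and S: "contraction_defect S c P Q"
  shows "contraction_defect (closure S) c P Q"
  unfolding contraction_defect_def
proof (intro ballI)
  fix x y assume x: "x \<in> closure S" and y: "y \<in> closure S"
  let ?k = "of_real (c\<^sup>2) :: complex"
  have *: "?k * cinner x y - cinner (P x) (P y) = ?k * cinner (Q x) (Q y)" if "y \<in> S" for y
    using x
    by (rule closure_induct)
      (intro closed_Collect_eq cinner.continuous_on is_op_continuous[OF P] is_op_continuous[OF Q]
        continuous_intros, use S that in \<open>auto simp: contraction_defect_def\<close>)
  show "?k * cinner x y - cinner (P x) (P y) = ?k * cinner (Q x) (Q y)"
    using y
    by (rule closure_induct)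
      (intro closed_Collect_eq cinner.continuous_on is_op_continuous[OF P] is_op_continuous[OF Q]
        continuous_intros, rule *)
qed

context
  fixes H :: "'k::chilbert_space set" and K :: "'l::chilbert_space set"
    and t :: "'k \<Rightarrow> 'l \<Rightarrow> 't::chilbert_space"
  assumes t: "tensor_map H K t"
begin

lemma tensor_add_right: "\<xi> \<in> H \<Longrightarrow> \<eta> \<in> K \<Longrightarrow> \<eta>' \<in> K \<Longrightarrow> t \<xi> (\<eta> + \<eta>') = t \<xi> \<eta> + t \<xi> \<eta>'"
  and tensor_scale_left: "\<xi> \<in> H \<Longrightarrow> \<eta> \<in> K \<Longrightarrow> t (c *\<^sub>C \<xi>) \<eta> = c *\<^sub>C t \<xi> \<eta>"
  and tensor_cinner: "\<xi> \<in> H \<Longrightarrow> \<xi>' \<in> H \<Longrightarrow> \<eta> \<in> K \<Longrightarrow> \<eta>' \<in> K \<Longrightarrow>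
    cinner (t \<xi> \<eta>) (t \<xi>' \<eta>') = cinner \<xi> \<xi>' * cinner \<eta> \<eta>'"
  using t unfolding tensor_map_def by blast+

lemma tensor_norm: "\<xi> \<in> H \<Longrightarrow> \<eta> \<in> K \<Longrightarrow> norm (t \<xi> \<eta>) = norm \<xi> * norm \<eta>"
proof -
  assume "\<xi> \<in> H" "\<eta> \<in> K"
  then have "complex_of_real ((norm (t \<xi> \<eta>))\<^sup>2) = of_real ((norm \<xi> * norm \<eta>)\<^sup>2)"
    by (simp only: cinner_self[symmetric] tensor_cinner) (simp add: cinner_self power_mult_distrib)
  then have "(norm (t \<xi> \<eta>))\<^sup>2 = (norm \<xi> * norm \<eta>)\<^sup>2" by (simp only: of_real_eq_iff)
  then show ?thesis by simp
qed

lemma tensor_diff_right: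
  assumes "complex_subspace K" "\<xi> \<in> H" "\<eta> \<in> K" "\<eta>' \<in> K"
  shows "t \<xi> (\<eta> - \<eta>') = t \<xi> \<eta> - t \<xi> \<eta>'"
  using tensor_add_right[of \<xi> "\<eta> - \<eta>'" \<eta>'] assms complex_subspaceD(4)[OF assms(1)] by simp

lemma tensor_space_eq: "tensor_space H K t = closure (fsums (\<lambda>(\<xi>, \<eta>). t \<xi> \<eta>) (H \<times> K))"
proof -
  have "{\<Sum>j<n. t (\<xi> j) (\<eta> j) | (n::nat) \<xi> \<eta>. \<forall>j<n. \<xi> j \<in> H \<and> \<eta> j \<in> K}
      = fsums (\<lambda>(\<xi>, \<eta>). t \<xi> \<eta>) (H \<times> K)" (is "?A = ?B")
  proof
    show "?A \<subseteq> ?B"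
    proof
      fix s assume "s \<in> ?A"
      then obtain n :: nat and \<xi> \<eta> where *: "\<forall>j<n. \<xi> j \<in> H \<and> \<eta> j \<in> K" "s = (\<Sum>j<n. t (\<xi> j) (\<eta> j))"
        by blast
      then show "s \<in> ?B" unfolding fsums_def
        by (intro CollectI exI[of _ n] exI[of _ "\<lambda>j. (\<xi> j, \<eta> j)"]) simp
    qed
    show "?B \<subseteq> ?A"
    proof
      fix s assume "s \<in> ?B"
      then obtain n :: nat and g where g: "\<forall>j<n. g j \<in> H \<times> K"
        and s: "s = (\<Sum>j<n. (\<lambda>(\<xi>, \<eta>). t \<xi> \<eta>) (g j))" by (auto simp: fsums_def)
      define \<xi> \<eta> where "\<xi> j = fst (g j)" and "\<eta> j = snd (g j)" for j
      have "\<forall>j<n. \<xi> j \<in> H \<and> \<eta> j \<in> K" using g by (auto simp: \<xi>_def \<eta>_def mem_Times_iff)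
      moreover have "s = (\<Sum>j<n. t (\<xi> j) (\<eta> j))" unfolding s by (simp add: case_prod_beta \<xi>_def \<eta>_def)
      ultimately show "s \<in> ?A" by blast
    qed
  qed
  then show ?thesis by (simp add: tensor_space_def)
qed

text \<open>The difference of the squares is \<open>c\<^sup>2 \<parallel>\<Sum>\<^sub>j Q \<xi>\<^sub>j \<otimes> \<eta>\<^sub>j\<parallel>\<^sup>2\<close>.\<close>

lemma tensor_sum_norm_le:
  assumes P: "\<And>\<xi>. \<xi> \<in> H \<Longrightarrow> P \<xi> \<in> H" and Q: "\<And>\<xi>. \<xi> \<in> H \<Longrightarrow> Q \<xi> \<in> H" and c: "0 \<le> c"
    and PQ: "contraction_defect H c P Q"
    and g: "\<And>j. j < (n::nat) \<Longrightarrow> \<xi> j \<in> H \<and> \<eta> j \<in> K"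
  shows "norm (\<Sum>j<n. t (P (\<xi> j)) (\<eta> j)) \<le> c * norm (\<Sum>j<n. t (\<xi> j) (\<eta> j))"
proof -
  define k where "k = complex_of_real (c\<^sup>2)"
  let ?S = "\<Sum>j<n. t (\<xi> j) (\<eta> j)" and ?G = "\<Sum>j<n. t (P (\<xi> j)) (\<eta> j)"
    and ?R = "\<Sum>j<n. t (Q (\<xi> j)) (\<eta> j)"
  have "k * (cinner (\<xi> i) (\<xi> j) * cinner (\<eta> i) (\<eta> j)) - cinner (P (\<xi> i)) (P (\<xi> j)) * cinner (\<eta> i) (\<eta> j)
      = k * (cinner (Q (\<xi> i)) (Q (\<xi> j)) * cinner (\<eta> i) (\<eta> j))" if "i < n" "j < n" for i j
  proof -
    have "k * (cinner (\<xi> i) (\<xi> j) * cinner (\<eta> i) (\<eta> j)) - cinner (P (\<xi> i)) (P (\<xi> j)) * cinner (\<eta> i) (\<eta> j)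
      = (k * cinner (\<xi> i) (\<xi> j) - cinner (P (\<xi> i)) (P (\<xi> j))) * cinner (\<eta> i) (\<eta> j)"
      by (simp add: algebra_simps)
    also have "\<dots> = k * (cinner (Q (\<xi> i)) (Q (\<xi> j)) * cinner (\<eta> i) (\<eta> j))"
      using PQ g that by (simp add: k_def mult.assoc contraction_defect_def)
    finally show ?thesis .
  qed
  then have "k * cinner ?S ?S - cinner ?G ?G = k * cinner ?R ?R"
    using g P Q
    by (simp add: cinner.sum_left cinner.sum_right tensor_cinner sum_distrib_left
        sum_subtractf[symmetric])
  then have "complex_of_real (c\<^sup>2 * (norm ?S)\<^sup>2 - (norm ?G)\<^sup>2) = of_real (c\<^sup>2 * (norm ?R)\<^sup>2)"
    by (simp add: cinner_self k_def)
  then have "c\<^sup>2 * (norm ?S)\<^sup>2 - (norm ?G)\<^sup>2 = c\<^sup>2 * (norm ?R)\<^sup>2" by (simp only: of_real_eq_iff)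
  moreover have "0 \<le> c\<^sup>2 * (norm ?R)\<^sup>2" by simp
  ultimately have "(norm ?G)\<^sup>2 \<le> (c * norm ?S)\<^sup>2" unfolding power_mult_distrib by linarith
  then show ?thesis by (rule power2_le_imp_le) (use c in simp)
qed

lemma tensor_extend:
  assumes Pop: "is_op P" and P: "\<And>\<xi>. \<xi> \<in> H \<Longrightarrow> P \<xi> \<in> H" and Q: "\<And>\<xi>. \<xi> \<in> H \<Longrightarrow> Q \<xi> \<in> H"
    and H: "complex_subspace H" and c: "0 \<le> c"
    and PQ: "contraction_defect H c P Q"
  shows "\<exists>T. T \<in> bounded_ops \<and> (\<forall>\<xi>\<in>H. \<forall>\<eta>\<in>K. blinfun_apply T (t \<xi> \<eta>) = t (P \<xi>) \<eta>)"
    and "is_op S \<Longrightarrow> (\<And>\<xi> \<eta>. \<xi> \<in> H \<Longrightarrow> \<eta> \<in> K \<Longrightarrow> S (t \<xi> \<eta>) = t (P \<xi>) \<eta>) \<Longrightarrow>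
      \<kappa> \<in> tensor_space H K t \<Longrightarrow> norm (S \<kappa>) \<le> c * norm \<kappa>"
proof -
  define f where "f = (\<lambda>(\<xi>, \<eta>). (t \<xi> \<eta>, t (P \<xi>) \<eta>))"
  define G where "G = fsums f (H \<times> K)"
  have "bounded_graph c G"
    unfolding bounded_graph_def
  proof (intro conjI allI impI)
    show "(0, 0) \<in> G" using fsums_zero[of f] by (simp add: G_def zero_prod_def)
    show "(s + s', g + g') \<in> G" if "(s, g) \<in> G" "(s', g') \<in> G" for s g s' g'
      using fsums_add[of "(s, g)" f _ "(s', g')"] that by (simp add: G_def)
    show "(k *\<^sub>C s, k *\<^sub>C g) \<in> G" if "(s, g) \<in> G" for k s g
    proof -
      have "(k *\<^sub>C fst p, k *\<^sub>C snd p) \<in> G" if "p \<in> G" for p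
        using that unfolding G_def
      proof (induction rule: fsums_induct)
        case zero then show ?case using fsums_zero[of f] by (simp add: zero_prod_def)
      next
        case (step p i)
        then obtain \<xi> \<eta> where i: "i = (\<xi>, \<eta>)" "\<xi> \<in> H" "\<eta> \<in> K" by auto
        have "(k *\<^sub>C fst (p + f i), k *\<^sub>C snd (p + f i))
            = (k *\<^sub>C fst p, k *\<^sub>C snd p) + f (k *\<^sub>C \<xi>, \<eta>)"
          using i P by (simp add: f_def scaleC.add_right tensor_scale_left is_op_scale[OF Pop])
        then show ?case using fsums_step[OF step.IH, of "(k *\<^sub>C \<xi>, \<eta>)"] i complex_subspaceD(3)[OF H]
          by simp
      qed
      from this[OF that] show ?thesis by simp
    qed
    show "norm g \<le> c * norm s" if sg: "(s, g) \<in> G" for s g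
    proof -
      obtain n :: nat and p where p: "(s, g) = (\<Sum>j<n. f (p j))" "\<forall>j<n. p j \<in> H \<times> K"
        using sg by (auto simp: G_def fsums_def)
      have "s = (\<Sum>j<n. t (fst (p j)) (snd (p j)))" "g = (\<Sum>j<n. t (P (fst (p j))) (snd (p j)))"
        using arg_cong[OF p(1), of fst] arg_cong[OF p(1), of snd]
        by (simp_all add: fst_sum snd_sum f_def case_prod_beta)
      then show ?thesis
        using tensor_sum_norm_le[OF P Q c PQ, of n "\<lambda>j. fst (p j)" "\<lambda>j. snd (p j)"] p(2)
        by (simp add: mem_Times_iff)
    qed
  qed
  from extend_bounded_graph[OF this] obtain T where T: "T \<in> bounded_ops"
    "\<forall>(s, g)\<in>G. blinfun_apply T s = g" by blast
  have "(t \<xi> \<eta>, t (P \<xi>) \<eta>) \<in> G" if "\<xi> \<in> H" "\<eta> \<in> K" for \<xi> \<eta>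
    using fsums_single[of "(\<xi>, \<eta>)" "H \<times> K" f] that by (simp add: G_def f_def)
  then show "\<exists>T. T \<in> bounded_ops \<and> (\<forall>\<xi>\<in>H. \<forall>\<eta>\<in>K. blinfun_apply T (t \<xi> \<eta>) = t (P \<xi>) \<eta>)"
    using T by (intro exI[of _ T]) fast
  assume S: "is_op S" "\<And>\<xi> \<eta>. \<xi> \<in> H \<Longrightarrow> \<eta> \<in> K \<Longrightarrow> S (t \<xi> \<eta>) = t (P \<xi>) \<eta>"
    and k: "\<kappa> \<in> tensor_space H K t"
  show "norm (S \<kappa>) \<le> c * norm \<kappa>"
  proof (rule closure_norm_le[OF S(1) _ k[unfolded tensor_space_eq]])
    fix s assume "s \<in> fsums (\<lambda>(\<xi>, \<eta>). t \<xi> \<eta>) (H \<times> K)"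
    then obtain n :: nat and p where p: "s = (\<Sum>j<n. t (fst (p j)) (snd (p j)))" "\<forall>j<n. p j \<in> H \<times> K"
      by (auto simp: fsums_def case_prod_beta)
    have "S s = (\<Sum>j<n. t (P (fst (p j))) (snd (p j)))"
      using p by (simp add: is_op_sum[OF S(1)] S(2) mem_Times_iff)
    then show "norm (S s) \<le> c * norm s"
      using tensor_sum_norm_le[OF P Q c PQ, of n "\<lambda>j. fst (p j)" "\<lambda>j. snd (p j)"] p
      by (simp add: mem_Times_iff)
  qed
qed

lemma tensor_action:
  assumes Pop: "is_op P" and P: "\<And>\<xi>. \<xi> \<in> H \<Longrightarrow> P \<xi> \<in> H" and H: "complex_subspace H" and k: "0 \<le> k"
    and defect: "\<And>c. k < c \<Longrightarrow> \<exists>Q. (\<forall>\<xi>\<in>H. Q \<xi> \<in> H) \<and> contraction_defect H c P Q"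
  defines "S \<equiv> blinfun_apply (SOME T. T \<in> bounded_ops \<and>
      (\<forall>\<xi>\<in>H. \<forall>\<eta>\<in>K. blinfun_apply T (t \<xi> \<eta>) = t (P \<xi>) \<eta>))"
  shows "is_op S" and "\<And>\<xi> \<eta>. \<xi> \<in> H \<Longrightarrow> \<eta> \<in> K \<Longrightarrow> S (t \<xi> \<eta>) = t (P \<xi>) \<eta>"
    and "\<And>c \<kappa>. k < c \<Longrightarrow> \<kappa> \<in> tensor_space H K t \<Longrightarrow> norm (S \<kappa>) \<le> c * norm \<kappa>"
proof -
  obtain Q where "\<forall>\<xi>\<in>H. Q \<xi> \<in> H" "contraction_defect H (k + 1) P Q"
    using defect[of "k + 1"] by auto
  then have "\<exists>T. T \<in> bounded_ops \<and> (\<forall>\<xi>\<in>H. \<forall>\<eta>\<in>K. blinfun_apply T (t \<xi> \<eta>) = t (P \<xi>) \<eta>)"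
    using k by (intro tensor_extend(1)[OF Pop P _ H]) auto
  from someI_ex[OF this] show op: "is_op S"
    and el: "\<And>\<xi> \<eta>. \<xi> \<in> H \<Longrightarrow> \<eta> \<in> K \<Longrightarrow> S (t \<xi> \<eta>) = t (P \<xi>) \<eta>"
    by (auto simp: S_def is_op_def)
  fix c \<kappa> assume c: "k < c" and \<kappa>: "\<kappa> \<in> tensor_space H K t"
  obtain Q where Q: "\<forall>\<xi>\<in>H. Q \<xi> \<in> H" "contraction_defect H c P Q" using defect[OF c] by blast
  show "norm (S \<kappa>) \<le> c * norm \<kappa>"
    by (rule tensor_extend(2)[OF Pop P _ H _ Q(2) op el \<kappa>]) (use Q k c in auto)
qed

end

text \<open>Exchanging the factors turns the right action on the coarse bimodule into a left action.\<close>

lemma tensor_map_swap: "tensor_map H K t \<Longrightarrow> tensor_map K H (\<lambda>\<eta> \<xi>. t \<xi> \<eta>)"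
  unfolding tensor_map_def by (simp add: mult.commute)

lemma tensor_space_swap:
  assumes t: "tensor_map H K t"
  shows "tensor_space K H (\<lambda>\<eta> \<xi>. t \<xi> \<eta>) = tensor_space H K t"
proof -
  have "{\<Sum>j<n. t (\<eta> j) (\<xi> j) | (n::nat) \<xi> \<eta>. \<forall>j<n. \<xi> j \<in> K \<and> \<eta> j \<in> H}
      = {\<Sum>j<n. t (\<xi> j) (\<eta> j) | (n::nat) \<xi> \<eta>. \<forall>j<n. \<xi> j \<in> H \<and> \<eta> j \<in> K}" by blast
  then show ?thesis unfolding tensor_space_def by (rule arg_cong[of _ _ closure])
qed

locale coarse_setting = L2_setting M \<tau> \<Lambda>
  for M :: "('h::chilbert_space \<Rightarrow>\<^sub>L 'h) set" and \<tau> and \<Lambda> :: "('h \<Rightarrow>\<^sub>L 'h) \<Rightarrow> 'l::chilbert_space" +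
  fixes N :: "('h \<Rightarrow>\<^sub>L 'h) set" and t :: "'l \<Rightarrow> 'l \<Rightarrow> 't::chilbert_space"
  assumes sub: "von_neumann_subalgebra N M"
    and tensor: "tensor_map (L2 \<Lambda> N) (L2 \<Lambda> N) t"
begin

abbreviation "B \<equiv> coarse_bimodule \<Lambda> t N"

lemma vN_N: "von_neumann_algebra N" and N_M: "N \<subseteq> M"
  using sub by (simp_all add: von_neumann_subalgebra_def)

lemma N_in_M [simp]: "a \<in> N \<Longrightarrow> a \<in> M" using N_M by blast

lemmas N_closed [simp] = vN_closed[OF vN_N] and N_bounded = vN_bounded[OF vN_N]

lemmas L2N_subspace = L2_subspace[OF vN_N N_M]
lemmas L2N_left = L2_left_in[OF vN_N N_M] and L2N_right = L2_right_in[OF vN_N N_M]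

lemma Lambda_L2N: "x \<in> N \<Longrightarrow> \<Lambda> x \<in> L2 \<Lambda> N"
  unfolding L2_def by (rule subsetD[OF closure_subset]) simp

lemma left_defect:
  assumes a: "a \<in> N" and c: "norm a < c"
  shows "\<exists>Q. (\<forall>\<xi>\<in>L2 \<Lambda> N. Q \<xi> \<in> L2 \<Lambda> N) \<and> contraction_defect (L2 \<Lambda> N) c (L2_left \<Lambda> N a) Q"
proof -
  obtain s where s: "s \<in> N" "op_adj s = s"
    "(s o\<^sub>L s) = id_blinfun - (1 / c\<^sup>2) *\<^sub>R (op_adj a o\<^sub>L a)"
    using vN_contraction_sqrt[OF vN_N a c] by blast
  have c0: "c \<noteq> 0" using c norm_ge_zero[of a] by linarith
  have "contraction_defect (L2 \<Lambda> N) c (L2_left \<Lambda> N a) (L2_left \<Lambda> N s)"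
    unfolding L2_def
  proof (rule contraction_defect_closure)
    show "contraction_defect (\<Lambda> ` N) c (L2_left \<Lambda> N a) (L2_left \<Lambda> N s)"
      unfolding contraction_defect_def
    proof (intro ballI)
      fix \<xi> \<eta> assume "\<xi> \<in> \<Lambda> ` N" "\<eta> \<in> \<Lambda> ` N"
      then obtain x y where x: "x \<in> N" "\<xi> = \<Lambda> x" and y: "y \<in> N" "\<eta> = \<Lambda> y" by blast
      have "op_adj (s o\<^sub>L y) o\<^sub>L (s o\<^sub>L x) = op_adj y o\<^sub>L ((s o\<^sub>L s) o\<^sub>L x)"
        using s(1,2) x y N_bounded by (simp add: opc_assoc)
      also have "\<dots> = (op_adj y o\<^sub>L x) - (1 / c\<^sup>2) *\<^sub>R (op_adj (a o\<^sub>L y) o\<^sub>L (a o\<^sub>L x))"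
        unfolding s(3) using a y N_bounded
        by (simp add: opc_assoc opc.diff_left opc.diff_right opc.scaleR_left opc.scaleR_right)
      finally have "cinner (\<Lambda> (s o\<^sub>L x)) (\<Lambda> (s o\<^sub>L y))
          = cinner (\<Lambda> x) (\<Lambda> y) - of_real (1 / c\<^sup>2) * cinner (\<Lambda> (a o\<^sub>L x)) (\<Lambda> (a o\<^sub>L y))"
        using a x y s(1)
        by (simp add: Lambda_cinner tau_diff tau_scaleR del: op_adj_simps of_real_divide)
      then show "of_real (c\<^sup>2) * cinner \<xi> \<eta> - cinner (L2_left \<Lambda> N a \<xi>) (L2_left \<Lambda> N a \<eta>)
          = of_real (c\<^sup>2) * cinner (L2_left \<Lambda> N s \<xi>) (L2_left \<Lambda> N s \<eta>)"
        using a x y s(1) c0 N_M by (simp add: L2_left_Lambda field_simps)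
    qed
  qed (use a s(1) N_M in \<open>auto intro: L2_left_op\<close>)
  then show ?thesis using s(1) L2N_left by blast
qed

lemma right_defect:
  assumes a: "a \<in> N" and c: "norm a < c"
  shows "\<exists>Q. (\<forall>\<xi>\<in>L2 \<Lambda> N. Q \<xi> \<in> L2 \<Lambda> N) \<and> contraction_defect (L2 \<Lambda> N) c (L2_right \<Lambda> N a) Q"
proof -
  have "norm (op_adj a) < c" using c norm_op_adj_le[OF N_bounded[OF a]] by linarith
  from vN_contraction_sqrt[OF vN_N _ this] a N_bounded obtain s where s: "s \<in> N" "op_adj s = s"
    "(s o\<^sub>L s) = id_blinfun - (1 / c\<^sup>2) *\<^sub>R (a o\<^sub>L op_adj a)"
    by auto
  have c0: "c \<noteq> 0" using c norm_ge_zero[of a] by linarith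
  have "contraction_defect (L2 \<Lambda> N) c (L2_right \<Lambda> N a) (L2_right \<Lambda> N s)"
    unfolding L2_def
  proof (rule contraction_defect_closure)
    show "contraction_defect (\<Lambda> ` N) c (L2_right \<Lambda> N a) (L2_right \<Lambda> N s)"
      unfolding contraction_defect_def
    proof (intro ballI)
      fix \<xi> \<eta> assume "\<xi> \<in> \<Lambda> ` N" "\<eta> \<in> \<Lambda> ` N"
      then obtain x y where x: "x \<in> N" "\<xi> = \<Lambda> x" and y: "y \<in> N" "\<eta> = \<Lambda> y" by blast
      have rot: "\<tau> (op_adj (y o\<^sub>L b) o\<^sub>L (x o\<^sub>L b)) = \<tau> ((op_adj y o\<^sub>L x) o\<^sub>L (b o\<^sub>L op_adj b))" if "b \<in> N" for b
        using that x y N_bounded tau_commute[of "op_adj b" "(op_adj y o\<^sub>L x) o\<^sub>L b"]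
        by (simp add: opc_assoc)
      have "(op_adj y o\<^sub>L x) o\<^sub>L (s o\<^sub>L s) = (op_adj y o\<^sub>L x) - (1 / c\<^sup>2) *\<^sub>R ((op_adj y o\<^sub>L x) o\<^sub>L (a o\<^sub>L op_adj a))"
        unfolding s(3) by (simp add: opc.diff_right opc.scaleR_right)
      then have "cinner (\<Lambda> (x o\<^sub>L s)) (\<Lambda> (y o\<^sub>L s))
          = cinner (\<Lambda> x) (\<Lambda> y) - of_real (1 / c\<^sup>2) * cinner (\<Lambda> (x o\<^sub>L a)) (\<Lambda> (y o\<^sub>L a))"
        using a x y s(1,2)
        by (simp add: Lambda_cinner rot tau_diff tau_scaleR del: op_adj_simps of_real_divide)
      then show "of_real (c\<^sup>2) * cinner \<xi> \<eta> - cinner (L2_right \<Lambda> N a \<xi>) (L2_right \<Lambda> N a \<eta>)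
          = of_real (c\<^sup>2) * cinner (L2_right \<Lambda> N s \<xi>) (L2_right \<Lambda> N s \<eta>)"
        using a x y s(1) c0 N_M by (simp add: L2_right_Lambda field_simps)
    qed
  qed (use a s(1) N_M in \<open>auto intro: L2_right_op\<close>)
  then show ?thesis using s(1) L2N_right by blast
qed

lemma
  assumes a: "a \<in> N"
  shows coarse_lact: "is_op (lact B a)"
      "\<xi> \<in> L2 \<Lambda> N \<Longrightarrow> \<eta> \<in> L2 \<Lambda> N \<Longrightarrow> lact B a (t \<xi> \<eta>) = t (L2_left \<Lambda> N a \<xi>) \<eta>"
      "norm a < c \<Longrightarrow> \<kappa> \<in> bspace B \<Longrightarrow> norm (lact B a \<kappa>) \<le> c * norm \<kappa>"
    and coarse_ract: "is_op (ract B a)"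
      "\<xi> \<in> L2 \<Lambda> N \<Longrightarrow> \<eta> \<in> L2 \<Lambda> N \<Longrightarrow> ract B a (t \<xi> \<eta>) = t \<xi> (L2_right \<Lambda> N a \<eta>)"
      "norm a < c \<Longrightarrow> \<kappa> \<in> bspace B \<Longrightarrow> norm (ract B a \<kappa>) \<le> c * norm \<kappa>"
proof -
  have "is_op (L2_left \<Lambda> N a)" using a N_M by (auto intro: L2_left_op)
  note L = tensor_action[OF tensor this L2N_left[OF a] L2N_subspace norm_ge_zero left_defect[OF a]]
  have act: "lact B a = blinfun_apply (SOME T. T \<in> bounded_ops \<and>
      (\<forall>\<xi>\<in>L2 \<Lambda> N. \<forall>\<eta>\<in>L2 \<Lambda> N. blinfun_apply T (t \<xi> \<eta>) = t (L2_left \<Lambda> N a \<xi>) \<eta>))"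
    by (simp add: coarse_bimodule_def)
  have sp: "bspace B = tensor_space (L2 \<Lambda> N) (L2 \<Lambda> N) t" by (simp add: coarse_bimodule_def)
  show "is_op (lact B a)"
    "\<xi> \<in> L2 \<Lambda> N \<Longrightarrow> \<eta> \<in> L2 \<Lambda> N \<Longrightarrow> lact B a (t \<xi> \<eta>) = t (L2_left \<Lambda> N a \<xi>) \<eta>"
    "norm a < c \<Longrightarrow> \<kappa> \<in> bspace B \<Longrightarrow> norm (lact B a \<kappa>) \<le> c * norm \<kappa>"
    unfolding act sp by (rule L; assumption)+
  have "is_op (L2_right \<Lambda> N a)" using a N_M by (auto intro: L2_right_op)
  note R = tensor_action[OF tensor_map_swap[OF tensor] this L2N_right[OF a] L2N_subspace
      norm_ge_zero right_defect[OF a]]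
  have "ract B a = blinfun_apply (SOME T. T \<in> bounded_ops \<and>
      (\<forall>\<xi>\<in>L2 \<Lambda> N. \<forall>\<eta>\<in>L2 \<Lambda> N. blinfun_apply T (t \<xi> \<eta>) = t \<xi> (L2_right \<Lambda> N a \<eta>)))"
    by (simp add: coarse_bimodule_def)
  also have "\<dots> = blinfun_apply (SOME T. T \<in> bounded_ops \<and>
      (\<forall>\<eta>\<in>L2 \<Lambda> N. \<forall>\<xi>\<in>L2 \<Lambda> N. blinfun_apply T (t \<xi> \<eta>) = t \<xi> (L2_right \<Lambda> N a \<eta>)))"
    by (intro arg_cong[of _ _ blinfun_apply] arg_cong[of _ _ Eps]) blast
  finally have act: "ract B a = \<dots>" .
  show "is_op (ract B a)"
    "\<xi> \<in> L2 \<Lambda> N \<Longrightarrow> \<eta> \<in> L2 \<Lambda> N \<Longrightarrow> ract B a (t \<xi> \<eta>) = t \<xi> (L2_right \<Lambda> N a \<eta>)"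
    "norm a < c \<Longrightarrow> \<kappa> \<in> bspace B \<Longrightarrow> norm (ract B a \<kappa>) \<le> c * norm \<kappa>"
    unfolding act sp tensor_space_swap[OF tensor, symmetric] by (rule R; assumption)+
qed

end

context coarse_setting
begin

lemma coarse_space: "bspace B = closure (fsums (\<lambda>(\<xi>, \<eta>). t \<xi> \<eta>) (L2 \<Lambda> N \<times> L2 \<Lambda> N))"
  using tensor_space_eq[OF tensor] by (simp add: coarse_bimodule_def)

lemma coarse_subspace: "complex_subspace (bspace B)"
  unfolding coarse_space
proof (intro complex_subspace_closure complex_subspace_fsums)
  let ?f = "\<lambda>(\<xi>, \<eta>). t \<xi> \<eta>"
  fix c i assume "i \<in> L2 \<Lambda> N \<times> L2 \<Lambda> N"
  then obtain \<xi> \<eta> where i: "i = (\<xi>, \<eta>)" "\<xi> \<in> L2 \<Lambda> N" "\<eta> \<in> L2 \<Lambda> N" by auto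
  have "?f (c *\<^sub>C \<xi>, \<eta>) \<in> fsums ?f (L2 \<Lambda> N \<times> L2 \<Lambda> N)"
    by (rule fsums_single) (use i complex_subspaceD(3)[OF L2N_subspace] in auto)
  then show "c *\<^sub>C ?f i \<in> fsums ?f (L2 \<Lambda> N \<times> L2 \<Lambda> N)"
    using i by (simp add: tensor_scale_left[OF tensor])
qed

lemma coarse_closed: "closed (bspace B)" by (simp add: coarse_space)

lemma coarse_elementary: "\<xi> \<in> L2 \<Lambda> N \<Longrightarrow> \<eta> \<in> L2 \<Lambda> N \<Longrightarrow> t \<xi> \<eta> \<in> bspace B"
  unfolding coarse_space
  by (rule subsetD[OF closure_subset])
    (use fsums_single[of "(\<xi>, \<eta>)" "L2 \<Lambda> N \<times> L2 \<Lambda> N" "\<lambda>(\<xi>, \<eta>). t \<xi> \<eta>"] in auto)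

lemma coarse_agree:
  assumes "is_op f" "is_op g" "\<And>\<xi> \<eta>. \<xi> \<in> L2 \<Lambda> N \<Longrightarrow> \<eta> \<in> L2 \<Lambda> N \<Longrightarrow> f (t \<xi> \<eta>) = g (t \<xi> \<eta>)"
    and "\<kappa> \<in> bspace B"
  shows "f \<kappa> = g \<kappa>"
  using assms(4) unfolding coarse_space
  by (rule closure_fsums_agree[OF assms(1,2), rotated]) (use assms(3) in auto)

text \<open>The elementary tensors with second factor in \<open>N\<close> span a dense subspace, and on these the right
  action is multiplication in \<open>N\<close>.\<close>

lemma coarse_induct:
  assumes k: "\<kappa> \<in> bspace B"
    and el: "\<And>\<xi> y. \<xi> \<in> L2 \<Lambda> N \<Longrightarrow> y \<in> N \<Longrightarrow> P (t \<xi> (\<Lambda> y))"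
    and add: "\<And>\<kappa> \<kappa>'. \<kappa> \<in> bspace B \<Longrightarrow> \<kappa>' \<in> bspace B \<Longrightarrow> P \<kappa> \<Longrightarrow> P \<kappa>' \<Longrightarrow> P (\<kappa> + \<kappa>')"
    and lim: "\<And>S \<kappa>. S \<subseteq> bspace B \<Longrightarrow> (\<And>s. s \<in> S \<Longrightarrow> P s) \<Longrightarrow> \<kappa> \<in> closure S \<Longrightarrow> P \<kappa>"
  shows "P \<kappa>"
proof -
  let ?f = "\<lambda>(\<xi>, \<eta>). t \<xi> \<eta>"
  have tens: "P (t \<xi> \<eta>)" if x: "\<xi> \<in> L2 \<Lambda> N" and y: "\<eta> \<in> L2 \<Lambda> N" for \<xi> \<eta>
  proof (rule lim)
    show "t \<xi> ` \<Lambda> ` N \<subseteq> bspace B" using x by (auto intro: coarse_elementary Lambda_L2N)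
    show "P s" if "s \<in> t \<xi> ` \<Lambda> ` N" for s using that x el by auto
    obtain u where u: "\<And>n. u n \<in> \<Lambda> ` N" "u \<longlonglongrightarrow> \<eta>"
      using y unfolding L2_def closure_sequential by blast
    have uL: "u n \<in> L2 \<Lambda> N" for n using u(1)[of n] Lambda_L2N by auto
    have "dist (t \<xi> (u n)) (t \<xi> \<eta>) = norm \<xi> * dist (u n) \<eta>" for n
      using x y uL[of n] complex_subspaceD(4)[OF L2N_subspace uL[of n] y]
      by (simp add: dist_norm tensor_diff_right[OF tensor L2N_subspace, symmetric] tensor_norm[OF tensor])
    then have "(\<lambda>n. t \<xi> (u n)) \<longlonglongrightarrow> t \<xi> \<eta>"
      using tendsto_mult_right_zero[OF tendsto_dist[OF u(2) tendsto_const[of \<eta>], simplified], of "norm \<xi>"]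
      unfolding tendsto_dist_iff[of _ "t \<xi> \<eta>"] by simp
    then show "t \<xi> \<eta> \<in> closure (t \<xi> ` \<Lambda> ` N)"
      unfolding closure_sequential using u(1) by (intro exI[of _ "\<lambda>n. t \<xi> (u n)"]) simp
  qed
  have zero: "P 0"
  proof -
    have 0: "0 \<in> L2 \<Lambda> N" by (rule complex_subspaceD(1)[OF L2N_subspace])
    have "norm (t 0 0) = 0" using 0 by (simp add: tensor_norm[OF tensor])
    then show ?thesis using tens[OF 0 0] by simp
  qed
  have sums: "P s \<and> s \<in> bspace B" if "s \<in> fsums ?f (L2 \<Lambda> N \<times> L2 \<Lambda> N)" for s
    using that
  proof (induction rule: fsums_induct)
    case zero then show ?case using \<open>P 0\<close> complex_subspaceD(1)[OF coarse_subspace] by simp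
  next
    case (step s i)
    then show ?case using complex_subspaceD(2)[OF coarse_subspace]
      by (auto intro: add tens coarse_elementary)
  qed
  show ?thesis
    by (rule lim[of "fsums ?f (L2 \<Lambda> N \<times> L2 \<Lambda> N)"]) (use sums k in \<open>auto simp: coarse_space[symmetric]\<close>)
qed

lemma coarse_invariant:
  assumes f: "is_op f" and el: "\<And>\<xi> \<eta>. \<xi> \<in> L2 \<Lambda> N \<Longrightarrow> \<eta> \<in> L2 \<Lambda> N \<Longrightarrow> f (t \<xi> \<eta>) \<in> bspace B"
    and k: "\<kappa> \<in> bspace B"
  shows "f \<kappa> \<in> bspace B"
  using k
proof (rule coarse_induct)
  fix S \<kappa> assume "\<And>s. s \<in> S \<Longrightarrow> f s \<in> bspace B" "\<kappa> \<in> closure S"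
  then show "f \<kappa> \<in> bspace B"
    using closure_image[OF f, of S "bspace B" \<kappa>] coarse_closed by (simp add: closure_closed)
qed (simp_all add: el Lambda_L2N is_op_add[OF f] complex_subspaceD[OF coarse_subspace])

lemma coarse_adjoint:
  assumes f: "is_op f" and g: "is_op g"
    and el: "\<And>\<xi> \<eta> \<xi>' \<eta>'. \<xi> \<in> L2 \<Lambda> N \<Longrightarrow> \<eta> \<in> L2 \<Lambda> N \<Longrightarrow> \<xi>' \<in> L2 \<Lambda> N \<Longrightarrow> \<eta>' \<in> L2 \<Lambda> N \<Longrightarrow>
      cinner (f (t \<xi> \<eta>)) (t \<xi>' \<eta>') = cinner (t \<xi> \<eta>) (g (t \<xi>' \<eta>'))"
    and k: "\<kappa> \<in> bspace B" "\<kappa>' \<in> bspace B"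
  shows "cinner (f \<kappa>) \<kappa>' = cinner \<kappa> (g \<kappa>')"
  using k unfolding coarse_space
proof (rule closure_adjoint[OF f g, rotated])
  fix x y assume "x \<in> fsums (\<lambda>(\<xi>, \<eta>). t \<xi> \<eta>) (L2 \<Lambda> N \<times> L2 \<Lambda> N)"
    "y \<in> fsums (\<lambda>(\<xi>, \<eta>). t \<xi> \<eta>) (L2 \<Lambda> N \<times> L2 \<Lambda> N)"
  then show "cinner (f x) y = cinner x (g y)"
    by (rule fsums_adjoint[OF f g, rotated]) (auto simp: el)
qed

lemma coarse_star_bimodule: "star_bimodule N B"
proof -
  note elementary = coarse_lact coarse_ract coarse_elementary tensor_cinner[OF tensor]
    L2N_left L2N_right L2_left_adjoint L2_right_adjoint N_M
  have "lact B a \<kappa> \<in> bspace B" "ract B a \<kappa> \<in> bspace B" if "a \<in> N" "\<kappa> \<in> bspace B" for a \<kappa>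
    by (rule coarse_invariant[OF coarse_lact(1)] coarse_invariant[OF coarse_ract(1)];
        use that in \<open>simp add: elementary\<close>)+
  moreover have "cinner (lact B a \<kappa>) \<kappa>' = cinner \<kappa> (lact B (op_adj a) \<kappa>')"
    "cinner (ract B a \<kappa>) \<kappa>' = cinner \<kappa> (ract B (op_adj a) \<kappa>')"
    if "a \<in> N" "\<kappa> \<in> bspace B" "\<kappa>' \<in> bspace B" for a \<kappa> \<kappa>'
    by (rule coarse_adjoint[OF coarse_lact(1) coarse_lact(1)]
          coarse_adjoint[OF coarse_ract(1) coarse_ract(1)];
        use that in \<open>simp add: elementary\<close>)+
  ultimately show ?thesis
    unfolding star_bimodule_def using coarse_closed coarse_subspace by blast
qed

lemma coarse_closed_under:
  "a \<in> N \<Longrightarrow> \<kappa> \<in> bspace B \<Longrightarrow> lact B a \<kappa> \<in> bspace B"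
  "a \<in> N \<Longrightarrow> \<kappa> \<in> bspace B \<Longrightarrow> ract B a \<kappa> \<in> bspace B"
  "a \<in> N \<Longrightarrow> \<kappa> \<in> bspace B \<Longrightarrow> \<kappa>' \<in> bspace B \<Longrightarrow> cinner (lact B a \<kappa>) \<kappa>' = cinner \<kappa> (lact B (op_adj a) \<kappa>')"
  "a \<in> N \<Longrightarrow> \<kappa> \<in> bspace B \<Longrightarrow> \<kappa>' \<in> bspace B \<Longrightarrow> cinner (ract B a \<kappa>) \<kappa>' = cinner \<kappa> (ract B (op_adj a) \<kappa>')"
  using coarse_star_bimodule unfolding star_bimodule_def by blast+

lemma coarse_ract_diff:
  assumes a: "a \<in> N" and b: "b \<in> N" and k: "\<kappa> \<in> bspace B"
  shows "ract B (a - b) \<kappa> = ract B a \<kappa> - ract B b \<kappa>"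
proof (rule coarse_agree[OF coarse_ract(1) is_op_minus[OF coarse_ract(1) coarse_ract(1)] _ k])
  fix \<xi> \<eta> assume x: "\<xi> \<in> L2 \<Lambda> N" and y: "\<eta> \<in> L2 \<Lambda> N"
  have "L2_right \<Lambda> N (a - b) \<eta> = L2_right \<Lambda> N a \<eta> - L2_right \<Lambda> N b \<eta>"
    using y unfolding L2_def
    by (rule closure_agree[rotated 3])
      (use a b N_M in \<open>auto intro!: is_op_minus L2_right_op simp: L2_right_Lambda opc.diff_right Lambda_diff\<close>)
  then show "ract B (a - b) (t \<xi> \<eta>) = ract B a (t \<xi> \<eta>) - ract B b (t \<xi> \<eta>)"
    using a b x y by (simp add: coarse_ract tensor_diff_right[OF tensor L2N_subspace] L2N_right)
qed (use a b in auto)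

definition symmetries :: "('h \<Rightarrow>\<^sub>L 'h) set \<Rightarrow> ('h \<Rightarrow>\<^sub>L 'h) set" where
  "symmetries A = {v \<in> A. op_adj v = v \<and> v o\<^sub>L v = id_blinfun}"

lemma coarse_symmetry_norm:
  assumes v: "v \<in> symmetries N" and k: "\<kappa> \<in> bspace B"
  shows "norm (ract B v \<kappa>) = norm \<kappa>"
proof -
  have vN: "v \<in> N" and va: "op_adj v = v" and vv: "v o\<^sub>L v = id_blinfun"
    using v by (auto simp: symmetries_def)
  have "ract B v (ract B v \<kappa>) = \<kappa>"
  proof (rule coarse_agree[OF is_op_compose[OF coarse_ract(1) coarse_ract(1)] is_op_ident _ k])
    fix \<xi> \<eta> assume x: "\<xi> \<in> L2 \<Lambda> N" and y: "\<eta> \<in> L2 \<Lambda> N"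
    have op: "is_op (L2_right \<Lambda> N v)" using vN N_M by (auto intro: L2_right_op)
    have "L2_right \<Lambda> N v (L2_right \<Lambda> N v \<eta>) = \<eta>"
      using y unfolding L2_def
      by (rule closure_agree[OF is_op_compose[OF op op] is_op_ident, rotated])
        (use vN N_M vv in \<open>auto simp: L2_right_Lambda opc_assoc\<close>)
    then show "ract B v (ract B v (t \<xi> \<eta>)) = t \<xi> \<eta>"
      using x y vN by (simp add: coarse_ract L2N_right)
  qed (use vN in auto)
  then have "cinner (ract B v \<kappa>) (ract B v \<kappa>) = cinner \<kappa> \<kappa>"
    using coarse_closed_under(4)[OF vN k coarse_closed_under(2)[OF vN k]] va by simp
  then have "(norm (ract B v \<kappa>))\<^sup>2 = (norm \<kappa>)\<^sup>2" by (simp only: cinner_self of_real_eq_iff)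
  then show ?thesis by simp
qed

section \<open>Mixing of the coarse bimodule\<close>

text \<open>This filter plays the role of a sequence of unitaries tending weakly to \<open>0\<close>.  It is proper because
  finitely many coefficients can be made small at a time, and \<^const>\<open>eventually\<close> takes care of
  combining them.\<close>

definition weakly_null :: "('h \<Rightarrow>\<^sub>L 'h) set \<Rightarrow> ('h \<Rightarrow>\<^sub>L 'h) filter" where
  "weakly_null A = (INF p\<in>M \<times> {0<..}. principal {v \<in> symmetries A. cmod (\<tau> (v o\<^sub>L fst p)) < snd p})"

lemma eventually_weakly_null:
  "z \<in> M \<Longrightarrow> 0 < e \<Longrightarrow> \<forall>\<^sub>F v in weakly_null A. v \<in> symmetries A \<and> cmod (\<tau> (v o\<^sub>L z)) < e"
  unfolding weakly_null_def by (rule eventually_INF1[of "(z, e)"]) (auto simp: eventually_principal)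

lemma weakly_null_not_bot:
  assumes A: "von_neumann_algebra A" "A \<subseteq> M" "diffuse A"
  shows "weakly_null A \<noteq> bot"
  unfolding weakly_null_def
proof (rule INF_filter_not_bot)
  fix X :: "(('h \<Rightarrow>\<^sub>L 'h) \<times> real) set" assume X: "X \<subseteq> M \<times> {0<..}" "finite X"
  define S where "S p = {v \<in> symmetries A. cmod (\<tau> (v o\<^sub>L fst p)) < snd p}" for p
  have "(\<Inter>p\<in>X. S p) \<noteq> {}"
  proof (cases "X = {}")
    case False
    define d where "d = Min (snd ` X)"
    have d: "0 < d" "\<And>p. p \<in> X \<Longrightarrow> d \<le> snd p" using X False by (auto simp: d_def)
    obtain v where v: "v \<in> A" "op_adj v = v" "v o\<^sub>L v = id_blinfun"
      "\<forall>z\<in>fst ` X. cmod (\<tau> (v o\<^sub>L z)) < d"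
    proof -
      have "fst ` X \<subseteq> M" "finite (fst ` X)" using X by auto
      then show ?thesis using weakly_small_unitary[OF A _ _ d(1), of "fst ` X"] that by blast
    qed
    then have "v \<in> S p" if "p \<in> X" for p
      using that d(2)[OF that] by (force simp: S_def symmetries_def)
    then show ?thesis by blast
  qed simp
  then show "(INF p\<in>X. principal {v \<in> symmetries A. cmod (\<tau> (v o\<^sub>L fst p)) < snd p}) \<noteq> bot"
    using X(2) by (simp add: INF_principal_finite principal_eq_bot_iff S_def)
qed

text \<open>The smallness is uniform over the ball of radius \<open>C\<close>, because it will be applied to coefficients
  \<open>a\<close> that depend on \<open>v\<close>.\<close>

definition mixing :: "('h \<Rightarrow>\<^sub>L 'h) set \<Rightarrow> real \<Rightarrow> 't \<Rightarrow> 't \<Rightarrow> bool" where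
  "mixing A C \<zeta> \<zeta>' \<longleftrightarrow> (\<forall>e>0. \<forall>\<^sub>F v in weakly_null A.
     \<forall>a\<in>N. norm a < C \<longrightarrow> cmod (cinner (lact B a \<zeta>') (ract B v \<zeta>)) \<le> e)"

lemma eventually_symmetry: "\<forall>\<^sub>F v in weakly_null A. v \<in> symmetries A"
  using eventually_weakly_null[of 0 1 A] by (auto elim: eventually_mono)

context
  fixes A and C :: real
  assumes AN: "A \<subseteq> N" and C: "0 < C"
begin

lemma symmetries_N: "v \<in> symmetries A \<Longrightarrow> v \<in> symmetries N"
  using AN by (auto simp: symmetries_def)

text \<open>The coefficient splits as \<open>\<langle>a \<xi>', \<xi>\<rangle> \<tau>(v y\<^sup>* y')\<close>.\<close>

lemma mixing_elementary:
  assumes "\<xi> \<in> L2 \<Lambda> N" "y \<in> N" "\<xi>' \<in> L2 \<Lambda> N" "y' \<in> N"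
  shows "mixing A C (t \<xi> (\<Lambda> y)) (t \<xi>' (\<Lambda> y'))"
  unfolding mixing_def
proof (intro allI impI)
  fix e :: real assume e: "0 < e"
  define D where "D = C * norm \<xi>' * norm \<xi>"
  have D: "0 \<le> D" using C by (simp add: D_def)
  define d where "d = e / (D + 1)"
  have d: "0 < d" using e D by (simp add: d_def add_nonneg_pos)
  have "op_adj y o\<^sub>L y' \<in> M" using assms by simp
  from eventually_weakly_null[OF this d, of A]
  show "\<forall>\<^sub>F v in weakly_null A. \<forall>a\<in>N. norm a < C \<longrightarrow>
      cmod (cinner (lact B a (t \<xi>' (\<Lambda> y'))) (ract B v (t \<xi> (\<Lambda> y)))) \<le> e"
  proof eventually_elim
    case (elim v)
    then have v: "v \<in> N" "op_adj v = v" using AN by (auto simp: symmetries_def)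
    show ?case
    proof (intro ballI impI)
      fix a assume a: "a \<in> N" "norm a < C"
      have aL: "L2_left \<Lambda> N a \<xi>' \<in> L2 \<Lambda> N" using a assms L2N_left by blast
      have "cinner (\<Lambda> y') (\<Lambda> (y o\<^sub>L v)) = \<tau> (v o\<^sub>L (op_adj y o\<^sub>L y'))"
        using assms v N_bounded by (simp add: Lambda_cinner opc_assoc)
      then have eq: "cinner (lact B a (t \<xi>' (\<Lambda> y'))) (ract B v (t \<xi> (\<Lambda> y)))
          = cinner (L2_left \<Lambda> N a \<xi>') \<xi> * \<tau> (v o\<^sub>L (op_adj y o\<^sub>L y'))"
        using assms v a aL N_M
        by (simp add: coarse_lact coarse_ract Lambda_L2N L2_right_Lambda tensor_cinner[OF tensor])
      have "norm (L2_left \<Lambda> N a \<xi>') \<le> norm a * norm \<xi>'"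
        using a assms N_M by (intro L2_left_norm) auto
      also have "\<dots> \<le> C * norm \<xi>'" using a by (intro mult_right_mono) auto
      finally have "norm (L2_left \<Lambda> N a \<xi>') * norm \<xi> \<le> D" unfolding D_def by (rule mult_right_mono) simp
      then have "cmod (cinner (L2_left \<Lambda> N a \<xi>') \<xi>) \<le> D"
        using complex_Cauchy_Schwarz order_trans by blast
      then have "cmod (cinner (L2_left \<Lambda> N a \<xi>') \<xi>) * cmod (\<tau> (v o\<^sub>L (op_adj y o\<^sub>L y'))) \<le> D * d"
        using elim D by (intro mult_mono) auto
      also have "\<dots> \<le> e" using e D by (simp add: d_def field_simps)
      finally show "cmod (cinner (lact B a (t \<xi>' (\<Lambda> y'))) (ract B v (t \<xi> (\<Lambda> y)))) \<le> e"
        by (simp add: eq norm_mult)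
    qed
  qed
qed

lemma mixing_add_left:
  assumes "mixing A C \<zeta> \<kappa>" "mixing A C \<zeta>' \<kappa>"
  shows "mixing A C (\<zeta> + \<zeta>') \<kappa>"
  unfolding mixing_def
proof (intro allI impI)
  fix e :: real assume "0 < e"
  then have e: "0 < e / 2" by simp
  show "\<forall>\<^sub>F v in weakly_null A. \<forall>a\<in>N. norm a < C \<longrightarrow> cmod (cinner (lact B a \<kappa>) (ract B v (\<zeta> + \<zeta>'))) \<le> e"
    using assms[unfolded mixing_def, rule_format, OF e] eventually_symmetry[of A]
  proof eventually_elim
    case (elim v)
    then have vN: "v \<in> N" using AN by (auto simp: symmetries_def)
    show ?case
    proof (intro ballI impI)
      fix a assume a: "a \<in> N" "norm a < C"
      show "cmod (cinner (lact B a \<kappa>) (ract B v (\<zeta> + \<zeta>'))) \<le> e"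
        using elim(1)[rule_format, OF a] elim(2)[rule_format, OF a]
          norm_triangle_ineq[of "cinner (lact B a \<kappa>) (ract B v \<zeta>)" "cinner (lact B a \<kappa>) (ract B v \<zeta>')"]
        by (simp add: is_op_add[OF coarse_ract(1)[OF vN]] cinner.add_right)
    qed
  qed
qed

lemma mixing_add_right:
  assumes "mixing A C \<zeta> \<kappa>" "mixing A C \<zeta> \<kappa>'"
  shows "mixing A C \<zeta> (\<kappa> + \<kappa>')"
  unfolding mixing_def
proof (intro allI impI)
  fix e :: real assume "0 < e"
  then have e: "0 < e / 2" by simp
  show "\<forall>\<^sub>F v in weakly_null A. \<forall>a\<in>N. norm a < C \<longrightarrow> cmod (cinner (lact B a (\<kappa> + \<kappa>')) (ract B v \<zeta>)) \<le> e"
    using assms[unfolded mixing_def, rule_format, OF e]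
  proof eventually_elim
    case (elim v)
    show ?case
    proof (intro ballI impI)
      fix a assume a: "a \<in> N" "norm a < C"
      show "cmod (cinner (lact B a (\<kappa> + \<kappa>')) (ract B v \<zeta>)) \<le> e"
        using elim(1)[rule_format, OF a] elim(2)[rule_format, OF a]
          norm_triangle_ineq[of "cinner (lact B a \<kappa>) (ract B v \<zeta>)" "cinner (lact B a \<kappa>') (ract B v \<zeta>)"]
        by (simp add: is_op_add[OF coarse_lact(1)[OF a(1)]] cinner.add_left)
    qed
  qed
qed

text \<open>The hypothesis allows to move either vector; \<open>\<zeta>'\<close> in the second summand is what remains after the
  first one has been moved.\<close>

lemma mixing_limit:
  assumes z: "\<zeta> \<in> bspace B" and k: "\<kappa> \<in> bspace B"
    and app: "\<And>d. 0 < d \<Longrightarrow> \<exists>\<zeta>' \<kappa>'. \<zeta>' \<in> bspace B \<and> \<kappa>' \<in> bspace B \<and> mixing A C \<zeta>' \<kappa>' \<and>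
        norm (\<zeta> - \<zeta>') * norm \<kappa> + norm (\<kappa> - \<kappa>') * norm \<zeta>' \<le> d"
  shows "mixing A C \<zeta> \<kappa>"
  unfolding mixing_def
proof (intro allI impI)
  fix e :: real assume e: "0 < e"
  then have e2: "0 < e / 2" and d: "0 < e / (2 * C)" using C by auto
  obtain \<zeta>' \<kappa>' where z': "\<zeta>' \<in> bspace B" and k': "\<kappa>' \<in> bspace B" and m: "mixing A C \<zeta>' \<kappa>'"
    and near: "norm (\<zeta> - \<zeta>') * norm \<kappa> + norm (\<kappa> - \<kappa>') * norm \<zeta>' \<le> e / (2 * C)"
    using app[OF d] by blast
  note sub = complex_subspaceD(4)[OF coarse_subspace]
  show "\<forall>\<^sub>F v in weakly_null A. \<forall>a\<in>N. norm a < C \<longrightarrow> cmod (cinner (lact B a \<kappa>) (ract B v \<zeta>)) \<le> e"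
    using m[unfolded mixing_def, rule_format, OF e2] eventually_symmetry[of A]
  proof eventually_elim
    case (elim v)
    then have vs: "v \<in> symmetries N" and vN: "v \<in> N" using AN by (auto simp: symmetries_def)
    show ?case
    proof (intro ballI impI)
      fix a assume a: "a \<in> N" "norm a < C"
      note L = coarse_lact(1)[OF a(1)] and R = coarse_ract(1)[OF vN]
      have "cinner (lact B a \<kappa>) (ract B v \<zeta>) = cinner (lact B a \<kappa>) (ract B v (\<zeta> - \<zeta>'))
          + cinner (lact B a (\<kappa> - \<kappa>')) (ract B v \<zeta>') + cinner (lact B a \<kappa>') (ract B v \<zeta>')"
        by (simp add: is_op_diff[OF L] is_op_diff[OF R] cinner.diff_left cinner.diff_right)
      moreover have "cmod (cinner (lact B a \<kappa>) (ract B v (\<zeta> - \<zeta>'))) \<le> (C * norm \<kappa>) * norm (\<zeta> - \<zeta>')"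
        using coarse_lact(3)[OF a(1,2) k] coarse_symmetry_norm[OF vs sub[OF z z']]
        by (intro order_trans[OF complex_Cauchy_Schwarz]) (simp add: mult_right_mono)
      moreover have "cmod (cinner (lact B a (\<kappa> - \<kappa>')) (ract B v \<zeta>')) \<le> (C * norm (\<kappa> - \<kappa>')) * norm \<zeta>'"
        using coarse_lact(3)[OF a(1,2) sub[OF k k']] coarse_symmetry_norm[OF vs z']
        by (intro order_trans[OF complex_Cauchy_Schwarz]) (simp add: mult_right_mono)
      moreover have "cmod (cinner (lact B a \<kappa>') (ract B v \<zeta>')) \<le> e / 2"
        using elim a by blast
      moreover have "(C * norm \<kappa>) * norm (\<zeta> - \<zeta>') + (C * norm (\<kappa> - \<kappa>')) * norm \<zeta>' \<le> e / 2"
      proof -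
        have "C * (norm (\<zeta> - \<zeta>') * norm \<kappa> + norm (\<kappa> - \<kappa>') * norm \<zeta>') \<le> C * (e / (2 * C))"
          using near C by (intro mult_left_mono) auto
        then show ?thesis using C by (simp add: algebra_simps)
      qed
      ultimately show "cmod (cinner (lact B a \<kappa>) (ract B v \<zeta>)) \<le> e"
        by (smt (verit) field_sum_of_halves norm_triangle_ineq)
    qed
  qed
qed

lemma mixing_coarse:
  assumes z: "\<zeta> \<in> bspace B" and k: "\<kappa> \<in> bspace B"
  shows "mixing A C \<zeta> \<kappa>"
proof -
  have 1: "mixing A C (t \<xi> (\<Lambda> y)) \<kappa>" if x: "\<xi> \<in> L2 \<Lambda> N" "y \<in> N" for \<xi> y
    using k
  proof (rule coarse_induct)
    fix S \<kappa> assume S: "S \<subseteq> bspace B" "\<And>s. s \<in> S \<Longrightarrow> mixing A C (t \<xi> (\<Lambda> y)) s" "\<kappa> \<in> closure S"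
    let ?z = "t \<xi> (\<Lambda> y)"
    have zB: "?z \<in> bspace B" using x by (simp add: coarse_elementary Lambda_L2N)
    show "mixing A C ?z \<kappa>"
    proof (rule mixing_limit[OF zB])
      show "\<kappa> \<in> bspace B" using S(1,3) closure_minimal[OF S(1) coarse_closed] by blast
      fix d :: real assume d: "0 < d"
      obtain s where s: "s \<in> S" "norm (\<kappa> - s) * norm ?z \<le> d"
        using closure_near[OF S(3) d norm_ge_zero] by blast
      have "norm (?z - ?z) * norm \<kappa> + norm (\<kappa> - s) * norm ?z \<le> d" using s by simp
      then show "\<exists>\<zeta>' \<kappa>'. \<zeta>' \<in> bspace B \<and> \<kappa>' \<in> bspace B \<and> mixing A C \<zeta>' \<kappa>' \<and>
          norm (?z - \<zeta>') * norm \<kappa> + norm (\<kappa> - \<kappa>') * norm \<zeta>' \<le> d"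
        using zB S s(1) by blast
    qed
  qed (use x in \<open>auto intro: mixing_elementary mixing_add_right\<close>)
  show ?thesis
    using z
  proof (rule coarse_induct)
    fix S \<zeta> assume S: "S \<subseteq> bspace B" "\<And>s. s \<in> S \<Longrightarrow> mixing A C s \<kappa>" "\<zeta> \<in> closure S"
    show "mixing A C \<zeta> \<kappa>"
    proof (rule mixing_limit[OF _ k])
      show "\<zeta> \<in> bspace B" using S(1,3) closure_minimal[OF S(1) coarse_closed] by blast
      fix d :: real assume d: "0 < d"
      obtain s where s: "s \<in> S" "norm (\<zeta> - s) * norm \<kappa> \<le> d"
        using closure_near[OF S(3) d norm_ge_zero] by blast
      have "norm (\<zeta> - s) * norm \<kappa> + norm (\<kappa> - \<kappa>) * norm s \<le> d" using s by simp
      then show "\<exists>\<zeta>' \<kappa>'. \<zeta>' \<in> bspace B \<and> \<kappa>' \<in> bspace B \<and> mixing A C \<zeta>' \<kappa>' \<and>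
          norm (\<zeta> - \<zeta>') * norm \<kappa> + norm (\<kappa> - \<kappa>') * norm \<zeta>' \<le> d"
        using k S s(1) by blast
    qed
  qed (auto intro: 1 mixing_add_left)
qed

text \<open>Mixing makes \<open>\<parallel>\<zeta>\<parallel>\<^sup>2 = \<langle>\<zeta> v, \<zeta> v\<rangle> \<approx> \<Sum>\<^sub>j \<langle>a\<^sub>j \<zeta>\<^sub>j, \<zeta> v\<rangle>\<close> small.  The relation for \<open>\<zeta> v\<close> may hold
  up to a small change \<open>v'\<close> of \<open>v\<close> in norm, but the bound \<open>C\<close> must be the same for all \<open>v\<close>.\<close>

lemma coarse_vanish:
  fixes n :: nat
  assumes A: "von_neumann_algebra A" "diffuse A"
    and z: "\<zeta> \<in> bspace B" and Z: "\<And>j. j < n \<Longrightarrow> Z j \<in> bspace B"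
    and rel: "\<And>v d. v \<in> symmetries A \<Longrightarrow> 0 < d \<Longrightarrow> \<exists>v'\<in>N. \<exists>a. norm (v - v') < d \<and>
        (\<forall>j<n. a j \<in> N \<and> norm (a j) < C) \<and> ract B v' \<zeta> = (\<Sum>j<n. lact B (a j) (Z j))"
  shows "\<zeta> = 0"
proof (rule ccontr)
  assume "\<zeta> \<noteq> 0"
  define D where "D = real n + (norm \<zeta>)\<^sup>2"
  have D: "0 \<le> D" by (simp add: D_def)
  \<comment> \<open>The estimate below gives \<open>\<parallel>\<zeta>\<parallel>\<^sup>2 \<le> e D\<close>, which this choice of \<open>e\<close> contradicts.\<close>
  define e where "e = (norm \<zeta>)\<^sup>2 / (D + 1)"
  have e: "0 < e" using \<open>\<zeta> \<noteq> 0\<close> D by (simp add: e_def add_nonneg_pos)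
  have AM: "A \<subseteq> M" using AN N_M by blast
  have "\<forall>\<^sub>F v in weakly_null A. \<forall>j\<in>{..<n}. \<forall>a\<in>N. norm a < C \<longrightarrow>
      cmod (cinner (lact B a (Z j)) (ract B v \<zeta>)) \<le> e"
    by (rule eventually_ball_finite)
      (use mixing_coarse[OF z Z] e in \<open>auto simp: mixing_def\<close>)
  then have "\<forall>\<^sub>F v in weakly_null A. v \<in> symmetries A \<and> (\<forall>j\<in>{..<n}. \<forall>a\<in>N. norm a < C \<longrightarrow>
      cmod (cinner (lact B a (Z j)) (ract B v \<zeta>)) \<le> e)"
    using eventually_symmetry[of A] by (rule eventually_conj[rotated])
  then obtain v where v: "v \<in> symmetries A" and small: "\<And>j a. j < n \<Longrightarrow> a \<in> N \<Longrightarrow> norm a < C \<Longrightarrow>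
      cmod (cinner (lact B a (Z j)) (ract B v \<zeta>)) \<le> e"
    using eventually_happens'[OF weakly_null_not_bot[OF A(1) AM A(2)]] by blast
  obtain v' a where v': "v' \<in> N" "norm (v - v') < e" and a: "\<And>j. j < n \<Longrightarrow> a j \<in> N \<and> norm (a j) < C"
    and eq: "ract B v' \<zeta> = (\<Sum>j<n. lact B (a j) (Z j))"
    using rel[OF v e] by blast
  have vN: "v \<in> N" using v AN by (auto simp: symmetries_def)
  have nv: "norm (ract B v \<zeta>) = norm \<zeta>"
    by (rule coarse_symmetry_norm[OF symmetries_N[OF v] z])
  have "ract B v \<zeta> = ract B (v - v') \<zeta> + ract B v' \<zeta>"
    using coarse_ract_diff[OF vN v'(1) z] by simp
  then have "cinner (ract B v \<zeta>) w
      = cinner (ract B (v - v') \<zeta>) w + (\<Sum>j<n. cinner (lact B (a j) (Z j)) w)" for w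
    by (simp only: eq cinner.add_left cinner.sum_left)
  from this[of "ract B v \<zeta>"]
  have "cmod (cinner (ract B v \<zeta>) (ract B v \<zeta>)) = cmod (cinner (ract B (v - v') \<zeta>) (ract B v \<zeta>)
      + (\<Sum>j<n. cinner (lact B (a j) (Z j)) (ract B v \<zeta>)))" by (rule arg_cong)
  then have "(norm \<zeta>)\<^sup>2 = cmod (cinner (ract B (v - v') \<zeta>) (ract B v \<zeta>)
      + (\<Sum>j<n. cinner (lact B (a j) (Z j)) (ract B v \<zeta>)))"
    by (simp only: cinner_self nv norm_of_real abs_power2)
  also have "\<dots> \<le> (e * norm \<zeta>) * norm \<zeta> + real n * e"
  proof (rule order_trans[OF norm_triangle_ineq add_mono])
    have "norm (ract B (v - v') \<zeta>) \<le> e * norm \<zeta>"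
      using vN v' z by (intro coarse_ract) auto
    then show "cmod (cinner (ract B (v - v') \<zeta>) (ract B v \<zeta>)) \<le> (e * norm \<zeta>) * norm \<zeta>"
      using complex_Cauchy_Schwarz[of "ract B (v - v') \<zeta>" "ract B v \<zeta>"]
      unfolding nv by (meson mult_right_mono norm_ge_zero order_trans)
    have "cmod (\<Sum>j<n. cinner (lact B (a j) (Z j)) (ract B v \<zeta>)) \<le> (\<Sum>j<n. e)"
      by (rule sum_norm_le) (use a small in auto)
    then show "cmod (\<Sum>j<n. cinner (lact B (a j) (Z j)) (ract B v \<zeta>)) \<le> real n * e" by simp
  qed
  also have "\<dots> = e * D" by (simp add: D_def algebra_simps power2_eq_square)
  also have "\<dots> < (norm \<zeta>)\<^sup>2"
  proof -
    have "e * (D + 1) = (norm \<zeta>)\<^sup>2" using D by (simp add: e_def)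
    then show ?thesis using e by (simp add: algebra_simps)
  qed
  finally show False by simp
qed

end

text \<open>For a bimodular \<open>T\<close> from the coarse bimodule, the vector \<open>\<zeta>\<close> which represents
  \<open>\<kappa> \<mapsto> \<langle>T \<kappa>, x\<rangle>\<close> inherits the relations \<open>x v' = \<Sum>\<^sub>j a\<^sub>j X\<^sub>j\<close>, so it vanishes by mixing.  Then the
  range of \<open>T\<close> is orthogonal to \<open>x\<close>, hence to \<open>N x N\<close>.\<close>

lemma singular_criterion:
  fixes n :: nat
  assumes A: "von_neumann_algebra A" "A \<subseteq> N" "diffuse A" and C: "0 < C"
    and x: "x \<in> M" and X: "\<And>j. j < n \<Longrightarrow> X j \<in> M"
    and rel: "\<And>v d. v \<in> symmetries A \<Longrightarrow> 0 < d \<Longrightarrow> \<exists>v'\<in>N. \<exists>a. norm (v - v') < d \<and>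
        (\<forall>j<n. a j \<in> N \<and> norm (a j) < C) \<and> x o\<^sub>L v' = (\<Sum>j<n. a j o\<^sub>L X j)"
  shows "\<Lambda> x \<in> singular_subspace \<Lambda> t N M"
proof -
  let ?L = "cyclic_bimodule \<Lambda> M N (\<Lambda> x)"
  note Lstar = cyclic_star_bimodule(1)[OF sub x] and LM = cyclic_star_bimodule(2)[OF sub x]
  have act: "lact ?L = L2_left \<Lambda> M" "ract ?L = L2_right \<Lambda> M" by (simp_all add: cyclic_bimodule_def)
  have LamM: "\<Lambda> y \<in> L2 \<Lambda> M" if "y \<in> M" for y
    unfolding L2_def using that by (intro subsetD[OF closure_subset]) simp
  have "T \<kappa> = 0" if T: "bounded_bimodular_map N B ?L T" and k: "\<kappa> \<in> bspace B" for T \<kappa>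
  proof -
    have T1: "\<And>\<xi>. \<xi> \<in> bspace B \<Longrightarrow> T \<xi> \<in> bspace ?L"
      and T2: "\<And>\<xi> \<eta>. \<xi> \<in> bspace B \<Longrightarrow> \<eta> \<in> bspace B \<Longrightarrow> T (\<xi> + \<eta>) = T \<xi> + T \<eta>"
      and T3: "\<And>c \<xi>. \<xi> \<in> bspace B \<Longrightarrow> T (c *\<^sub>C \<xi>) = c *\<^sub>C T \<xi>"
      and T5: "\<And>a \<xi>. a \<in> N \<Longrightarrow> \<xi> \<in> bspace B \<Longrightarrow> T (lact B a \<xi>) = L2_left \<Lambda> M a (T \<xi>)"
        "\<And>a \<xi>. a \<in> N \<Longrightarrow> \<xi> \<in> bspace B \<Longrightarrow> T (ract B a \<xi>) = L2_right \<Lambda> M a (T \<xi>)"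
      using T unfolding bounded_bimodular_map_def act by blast+
    have "\<exists>D. \<forall>\<xi>\<in>bspace B. norm (T \<xi>) \<le> D * norm \<xi>"
      using T by (simp add: bounded_bimodular_map_def)
    then obtain D where T4: "\<And>\<xi>. \<xi> \<in> bspace B \<Longrightarrow> norm (T \<xi>) \<le> D * norm \<xi>" by blast
    have TM: "T \<xi> \<in> L2 \<Lambda> M" if "\<xi> \<in> bspace B" for \<xi> using T1[OF that] LM by blast
    define G where "G = (\<lambda>\<xi>. (\<xi>, T \<xi>)) ` bspace B"
    have T0: "T 0 = 0" using T3[of 0 0] complex_subspaceD(1)[OF coarse_subspace] by simp
    have "bounded_graph D G"
      unfolding bounded_graph_def G_def
      using complex_subspaceD[OF coarse_subspace] by (auto simp: image_iff T0 T2 T3 T4)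
    from adjoint_vector[OF this]
    have "\<exists>z\<in>bspace B. \<forall>\<xi>\<in>bspace B. cinner (T \<xi>) w = cinner \<xi> z" for w
      using coarse_closed by (simp add: G_def image_image closure_closed)
    \<comment> \<open>\<open>R\<close> is the adjoint of \<open>T\<close>, and the \<open>\<zeta>\<close>, \<open>\<zeta>\<^sub>j\<close> are \<open>R x\<close>, \<open>R X\<^sub>j\<close>.\<close>
    then obtain R where R: "\<And>w. R w \<in> bspace B" "\<And>w \<xi>. \<xi> \<in> bspace B \<Longrightarrow> cinner (T \<xi>) w = cinner \<xi> (R w)"
      by metis
    have "R (\<Lambda> x) = 0"
    proof (rule coarse_vanish[OF A(2) C A(1,3) R(1), of n "\<lambda>j. R (\<Lambda> (X j))"])
      fix v d assume "v \<in> symmetries A" "(0::real) < d"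
      from rel[OF this] obtain v' a where v': "v' \<in> N" "norm (v - v') < d"
        and a: "\<And>j. j < n \<Longrightarrow> a j \<in> N \<and> norm (a j) < C" and eq: "x o\<^sub>L v' = (\<Sum>j<n. a j o\<^sub>L X j)"
        by blast
      have "ract B v' (R (\<Lambda> x)) = (\<Sum>j<n. lact B (a j) (R (\<Lambda> (X j))))"
      proof (rule closed_subspace_eqI[OF coarse_closed coarse_subspace])
        show "ract B v' (R (\<Lambda> x)) \<in> bspace B" using v' R by (simp add: coarse_closed_under)
        show "(\<Sum>j<n. lact B (a j) (R (\<Lambda> (X j)))) \<in> bspace B"
          by (rule complex_subspace_sum[OF coarse_subspace]) (use a R in \<open>simp add: coarse_closed_under\<close>)
        fix s assume s: "s \<in> bspace B"
        have move: "cinner s (k (R w)) = cinner (T s) (l w)"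
          if k: "\<And>\<kappa>. \<kappa> \<in> bspace B \<Longrightarrow> k' \<kappa> \<in> bspace B \<and> cinner (k' s) \<kappa> = cinner s (k \<kappa>)"
            and l: "cinner (l' (T s)) w = cinner (T s) (l w)" and Tk: "T (k' s) = l' (T s)"
          for k k' l l' w
        proof -
          have "cinner s (k (R w)) = cinner (k' s) (R w)" using k[OF R(1)] by simp
          also have "\<dots> = cinner (l' (T s)) w" using R(2)[of "k' s" w] k[OF s] Tk by simp
          finally show ?thesis by (simp only: l)
        qed
        have inv: "op_adj b \<in> N" "op_adj (op_adj b) = b" if "b \<in> N" for b
          using that N_bounded by simp_all
        have l: "cinner s (lact B b (R w)) = cinner (T s) (L2_left \<Lambda> M b w)"
          if "b \<in> N" "w \<in> L2 \<Lambda> M" for b w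
          by (rule move[of "lact B (op_adj b)" "lact B b" "L2_left \<Lambda> M (op_adj b)" _ "L2_left \<Lambda> M b"])
            (use that s inv[OF that(1)] TM in \<open>simp_all add: coarse_closed_under L2_left_adjoint T5\<close>)
        have r: "cinner s (ract B b (R w)) = cinner (T s) (L2_right \<Lambda> M b w)"
          if "b \<in> N" "w \<in> L2 \<Lambda> M" for b w
          by (rule move[of "ract B (op_adj b)" "ract B b" "L2_right \<Lambda> M (op_adj b)" _ "L2_right \<Lambda> M b"])
            (use that s inv[OF that(1)] TM in \<open>simp_all add: coarse_closed_under L2_right_adjoint T5\<close>)
        have "cinner s (ract B v' (R (\<Lambda> x))) = cinner (T s) (\<Lambda> (x o\<^sub>L v'))"
          using r[OF v'(1) LamM[OF x]] v' x by (simp add: L2_right_Lambda)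
        also have "\<dots> = (\<Sum>j<n. cinner (T s) (\<Lambda> (a j o\<^sub>L X j)))"
          unfolding eq by (subst Lambda_sum) (use a X in \<open>auto simp: cinner.sum_right\<close>)
        also have "\<dots> = (\<Sum>j<n. cinner s (lact B (a j) (R (\<Lambda> (X j)))))"
          by (rule sum.cong) (use a X l LamM in \<open>auto simp: L2_left_Lambda\<close>)
        finally show "cinner s (ract B v' (R (\<Lambda> x))) = cinner s (\<Sum>j<n. lact B (a j) (R (\<Lambda> (X j))))"
          by (simp add: cinner.sum_right)
      qed
      then show "\<exists>v'\<in>N. \<exists>a. norm (v - v') < d \<and> (\<forall>j<n. a j \<in> N \<and> norm (a j) < C) \<and>
          ract B v' (R (\<Lambda> x)) = (\<Sum>j<n. lact B (a j) (R (\<Lambda> (X j))))"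
        using v' a by blast
    qed (rule R(1))
    then have Tx: "cinner (T \<xi>) (\<Lambda> x) = 0" if "\<xi> \<in> bspace B" for \<xi> using R(2)[OF that] by simp
    have gen: "cinner (\<Lambda> (a o\<^sub>L (x o\<^sub>L b))) (T \<kappa>) = 0" if a: "a \<in> N" and b: "b \<in> N" for a b
    proof -
      have ab: "op_adj a \<in> N" "op_adj b \<in> N" using a b by simp_all
      note kk = coarse_closed_under(1)[OF ab(1) k]
      have "cinner (\<Lambda> (a o\<^sub>L (x o\<^sub>L b))) (T \<kappa>) = cinner (L2_left \<Lambda> M a (\<Lambda> (x o\<^sub>L b))) (T \<kappa>)"
        using a b x by (simp add: L2_left_Lambda)
      also have "\<dots> = cinner (\<Lambda> (x o\<^sub>L b)) (T (lact B (op_adj a) \<kappa>))"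
        using a b x TM[OF k] T5(1)[OF ab(1) k] by (simp add: L2_left_adjoint LamM)
      also have "\<dots> = cinner (L2_right \<Lambda> M b (\<Lambda> x)) (T (lact B (op_adj a) \<kappa>))"
        using b x by (simp add: L2_right_Lambda)
      also have "\<dots> = cinner (\<Lambda> x) (T (ract B (op_adj b) (lact B (op_adj a) \<kappa>)))"
        using b x TM[OF kk] T5(2)[OF ab(2) kk] by (simp add: L2_right_adjoint LamM)
      also have "\<dots> = cnj (cinner (T (ract B (op_adj b) (lact B (op_adj a) \<kappa>))) (\<Lambda> x))"
        by (rule cinner_commute)
      also have "\<dots> = 0" using Tx[OF coarse_closed_under(2)[OF ab(2) kk]] by simp
      finally show ?thesis .
    qed
    have "cinner s (T \<kappa>) = 0" if "s \<in> bspace ?L" for s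
      using that unfolding cyclic_bimodule_Lambda[OF sub x]
    proof (rule closure_induct)
      show "closed {s. cinner s (T \<kappa>) = 0}"
        by (intro closed_Collect_eq continuous_intros cinner.continuous_on)
      fix s assume "s \<in> fsums (\<lambda>(a, b). \<Lambda> (a o\<^sub>L (x o\<^sub>L b))) (N \<times> N)"
      then show "cinner s (T \<kappa>) = 0"
        by (induction rule: fsums_induct) (auto simp: cinner.add_left gen)
    qed
    from this[OF T1[OF k]] show ?thesis by (simp add: cinner_self)
  qed
  then have "disjoint_bimodules N ?L B"
    by (intro disjoint_bimodulesI[OF Lstar coarse_star_bimodule]) auto
  then show ?thesis using LamM[OF x] by (simp add: singular_subspace_def)
qed

end

section \<open>Bounded coefficients for the one-sided quasi-normalizer\<close>

text \<open>The elements of \<open>N\<close> whose coefficients can be bounded by \<open>k\<close> form an increasing sequence of sets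
  with union \<open>N\<close>.  By the Baire category theorem one of them is dense in a ball, and its
  differences, rescaled, are dense in the unit ball.\<close>

lemma bounded_coefficients:
  fixes N :: "('h::chilbert_space \<Rightarrow>\<^sub>L 'h) set" and n :: nat
  assumes N: "von_neumann_algebra N"
    and x: "\<And>y. y \<in> N \<Longrightarrow> \<exists>a. (\<forall>j<n. a j \<in> N) \<and> x o\<^sub>L y = (\<Sum>j<n. a j o\<^sub>L X j)"
  shows "\<exists>C>0. \<forall>v\<in>N. norm v \<le> 1 \<longrightarrow> (\<forall>d>0. \<exists>v'\<in>N. \<exists>a. norm (v - v') < d \<and>
    (\<forall>j<n. a j \<in> N \<and> norm (a j) < C) \<and> x o\<^sub>L v' = (\<Sum>j<n. a j o\<^sub>L X j))"
proof -
  note Nc = vN_closed[OF N] and Ncl = vN_norm_closed[OF N]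
  define S where "S k = {y\<in>N. \<exists>a. (\<forall>j<n. a j \<in> N \<and> norm (a j) \<le> real k) \<and> x o\<^sub>L y = (\<Sum>j<n. a j o\<^sub>L X j)}"
    for k :: nat
  have SN: "closure (S k) \<subseteq> N" for k by (rule closure_minimal[OF _ Ncl]) (auto simp: S_def)
  have cover: "y \<in> (\<Union>k. S k)" if y: "y \<in> N" for y
  proof -
    obtain a where a: "\<forall>j<n. a j \<in> N" "x o\<^sub>L y = (\<Sum>j<n. a j o\<^sub>L X j)" using x[OF y] by blast
    obtain k :: nat where k: "(\<Sum>j<n. norm (a j)) \<le> real k" using real_arch_simple by blast
    have "norm (a j) \<le> real k" if "j < n" for j
      using member_le_sum[of j "{..<n}" "\<lambda>j. norm (a j)"] that k by simp
    then have "y \<in> S k" using a y by (auto simp: S_def)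
    then show ?thesis by blast
  qed
  have "\<exists>k. top_of_set N interior_of closure (S k) \<noteq> {}"
  proof (rule ccontr)
    assume neg: "\<nexists>k. top_of_set N interior_of closure (S k) \<noteq> {}"
    have "top_of_set N interior_of \<Union>(range (\<lambda>k. closure (S k))) = {}"
    proof (rule Baire_category_alt)
      show "completely_metrizable_space (top_of_set N) \<or>
          locally_compact_space (top_of_set N) \<and> regular_space (top_of_set N)"
        using completely_metrizable_space_closedin[OF completely_metrizable_space_euclidean, of N]
          Ncl unfolding closed_closedin by blast
      show "closedin (top_of_set N) T \<and> top_of_set N interior_of T = {}"
        if T: "T \<in> range (\<lambda>k. closure (S k))" for T
      proof -
        obtain k where k: "T = closure (S k)" using T by blast
        show ?thesis using closed_subset[OF SN closed_closure, of k] neg unfolding k by blast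
      qed
    qed simp
    moreover have "\<Union>(range (\<lambda>k. closure (S k))) = N"
    proof
      show "\<Union>(range (\<lambda>k. closure (S k))) \<subseteq> N" using SN by blast
      show "N \<subseteq> \<Union>(range (\<lambda>k. closure (S k)))" using cover closure_subset by blast
    qed
    moreover have "top_of_set N interior_of N = N"
      using interior_of_topspace[of "top_of_set N"] by simp
    ultimately show False using Nc(1) by auto
  qed
  then obtain k y0 T where T: "openin (top_of_set N) T" "y0 \<in> T" "T \<subseteq> closure (S k)"
    by (auto simp: interior_of_def)
  then obtain r where r: "0 < r" "ball y0 r \<inter> N \<subseteq> T" and y0: "y0 \<in> N"
    unfolding openin_contains_ball by blast
  have near: "\<exists>y'\<in>S k. norm (y - y') < e" if "y \<in> N" "norm (y - y0) < r" "0 < e" for y e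
  proof -
    have "y \<in> closure (S k)" using that r T by (auto simp: dist_norm norm_minus_commute)
    then show ?thesis
      using that(3) unfolding closure_approachable by (auto simp: dist_norm norm_minus_commute)
  qed
  define C where "C = 4 * real k / r + 1"
  have C: "0 < C" using r by (simp add: C_def add_nonneg_pos)
  show ?thesis
  proof (rule exI[of _ C], intro conjI ballI impI allI C)
    fix v and d :: real assume v: "v \<in> N" "norm v \<le> 1" and d: "0 < d"
    have e: "0 < d * r / 4" using d r by simp
    have "norm ((y0 + (r/2) *\<^sub>R v) - y0) \<le> (r / 2) * 1"
      using v r by (simp only: add_diff_cancel_left' norm_scaleR) (intro mult_mono, auto)
    also have "\<dots> < r" using r by simp
    finally have "norm ((y0 + (r/2) *\<^sub>R v) - y0) < r" .
    moreover have "y0 + (r/2) *\<^sub>R v \<in> N" by (intro Nc y0 v)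
    ultimately obtain y1 where y1: "y1 \<in> S k" "norm ((y0 + (r/2) *\<^sub>R v) - y1) < d * r / 4"
      using near[OF _ _ e] by blast
    obtain y2 where y2: "y2 \<in> S k" "norm (y0 - y2) < d * r / 4"
      using near[OF y0 _ e] r by auto
    obtain a1 where a1: "\<And>j. j < n \<Longrightarrow> a1 j \<in> N \<and> norm (a1 j) \<le> real k"
      "x o\<^sub>L y1 = (\<Sum>j<n. a1 j o\<^sub>L X j)" using y1 by (auto simp: S_def)
    obtain a2 where a2: "\<And>j. j < n \<Longrightarrow> a2 j \<in> N \<and> norm (a2 j) \<le> real k"
      "x o\<^sub>L y2 = (\<Sum>j<n. a2 j o\<^sub>L X j)" using y2 by (auto simp: S_def)
    \<comment> \<open>Subtracting an approximation of the centre \<open>y0\<close> moves the ball to the origin.\<close>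
    define v' where "v' = (2/r) *\<^sub>R (y1 - y2)"
    define a where "a j = (2/r) *\<^sub>R (a1 j - a2 j)" for j
    have "v' \<in> N" using y1 y2 Nc by (simp add: v'_def S_def)
    moreover have "norm (v - v') < d"
    proof -
      have "v - v' = (2/r) *\<^sub>R (((y0 + (r/2) *\<^sub>R v) - y1) - (y0 - y2))"
        using r by (simp add: v'_def algebra_simps)
      then have "norm (v - v') = (2/r) * norm (((y0 + (r/2) *\<^sub>R v) - y1) - (y0 - y2))"
        using r by simp
      also have "\<dots> \<le> (2/r) * (norm ((y0 + (r/2) *\<^sub>R v) - y1) + norm (y0 - y2))"
        using r by (intro mult_left_mono norm_triangle_ineq4) simp
      also have "\<dots> < (2/r) * (d * r / 4 + d * r / 4)"
        using r y1(2) y2(2) by (intro mult_strict_left_mono add_strict_mono) auto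
      also have "\<dots> = d" using r by (simp add: field_simps)
      finally show ?thesis .
    qed
    moreover have "a j \<in> N \<and> norm (a j) < C" if "j < n" for j
    proof -
      have "norm (a j) = (2/r) * norm (a1 j - a2 j)" using r by (simp add: a_def)
      also have "\<dots> \<le> (2/r) * (real k + real k)"
        using r a1(1)[OF that] a2(1)[OF that]
        by (intro mult_left_mono order_trans[OF norm_triangle_ineq4] add_mono) auto
      also have "\<dots> < C" by (simp add: C_def)
      finally show ?thesis using a1(1)[OF that] a2(1)[OF that] Nc by (simp add: a_def)
    qed
    moreover have "x o\<^sub>L v' = (\<Sum>j<n. a j o\<^sub>L X j)"
      by (simp add: v'_def a_def opc.scaleR_left opc.scaleR_right opc.diff_left opc.diff_right a1 a2
          sum_subtractf scaleR_sum_right[symmetric])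
    ultimately show "\<exists>v'\<in>N. \<exists>a. norm (v - v') < d \<and>
        (\<forall>j<n. a j \<in> N \<and> norm (a j) < C) \<and> x o\<^sub>L v' = (\<Sum>j<n. a j o\<^sub>L X j)" by blast
  qed
qed

lemma isometry_norm_le:
  assumes w: "w \<in> bounded_ops" "op_adj w o\<^sub>L w = id_blinfun"
  shows "norm w \<le> 1"
proof (rule norm_blinfun_bound)
  fix \<xi>
  have "(op_adj w) (w \<xi>) = \<xi>"
    using arg_cong[OF w(2), of "\<lambda>z. z \<xi>"] by simp
  then have "cinner (w \<xi>) (w \<xi>) = cinner \<xi> \<xi>"
    using cinner_op_adj[OF w(1), of \<xi> "w \<xi>"] by simp
  then have "(norm (w \<xi>))\<^sup>2 = (norm \<xi>)\<^sup>2" by (simp only: cinner_self of_real_eq_iff)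
  then show "norm (w \<xi>) \<le> 1 * norm \<xi>" by simp
qed simp


section \<open>Conjugation by a unitary\<close>

lemma conjugate_commutant:
  assumes u: "u \<in> bounded_ops" "op_adj u o\<^sub>L u = id_blinfun" "u o\<^sub>L op_adj u = id_blinfun"
  shows "{op_adj u o\<^sub>L y o\<^sub>L u | y. y \<in> commutant S} = commutant {op_adj u o\<^sub>L z o\<^sub>L u | z. z \<in> S}"
    (is "?A = ?B")
proof -
  have c1: "u o\<^sub>L (op_adj u o\<^sub>L w) = w" "op_adj u o\<^sub>L (u o\<^sub>L w) = w" for w
    by (simp_all add: opc_assoc[symmetric] u)
  have "op_adj u o\<^sub>L y o\<^sub>L u \<in> ?B" if y: "y \<in> commutant S" for y
  proof -
    have yb: "y \<in> bounded_ops" and yz: "\<And>z. z \<in> S \<Longrightarrow> y o\<^sub>L z = z o\<^sub>L y"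
      using y by (auto simp: commutant_def)
    have "y o\<^sub>L (z o\<^sub>L u) = z o\<^sub>L (y o\<^sub>L u)" if "z \<in> S" for z
      using yz[OF that] by (simp add: opc_assoc[symmetric])
    then show ?thesis using yb u(1) by (auto simp: commutant_def opc_assoc c1)
  qed
  moreover have "w \<in> ?A" if w: "w \<in> ?B" for w
  proof -
    have wb: "w \<in> bounded_ops"
      and wz: "\<And>z. z \<in> S \<Longrightarrow> w o\<^sub>L (op_adj u o\<^sub>L z o\<^sub>L u) = (op_adj u o\<^sub>L z o\<^sub>L u) o\<^sub>L w"
      using w by (auto simp: commutant_def)
    define y where "y = u o\<^sub>L (w o\<^sub>L op_adj u)"
    have "y o\<^sub>L z = z o\<^sub>L y" if z: "z \<in> S" for z
    proof -
      have "y o\<^sub>L z = u o\<^sub>L ((w o\<^sub>L (op_adj u o\<^sub>L z o\<^sub>L u)) o\<^sub>L op_adj u)"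
        by (simp add: y_def opc_assoc u)
      also have "\<dots> = z o\<^sub>L y" unfolding wz[OF z] by (simp add: y_def opc_assoc c1)
      finally show ?thesis .
    qed
    moreover have "y \<in> bounded_ops" using wb u(1) by (simp add: y_def)
    ultimately have "y \<in> commutant S" by (simp add: commutant_def)
    moreover have "w = op_adj u o\<^sub>L y o\<^sub>L u" by (simp add: y_def opc_assoc c1 u)
    ultimately show ?thesis by blast
  qed
  ultimately show ?thesis by blast
qed

text \<open>Both \<open>u\<^sup>* N u\<close> and \<open>N\<close> are commutants, and an intersection of commutants is the commutant of a union.\<close>

lemma vN_conjugate_Int:
  assumes N: "von_neumann_algebra N"
    and u: "u \<in> bounded_ops" "op_adj u o\<^sub>L u = id_blinfun" "u o\<^sub>L op_adj u = id_blinfun"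
  shows "von_neumann_algebra ({op_adj u o\<^sub>L y o\<^sub>L u | y. y \<in> N} \<inter> N)" (is "von_neumann_algebra ?Q")
proof -
  define Z where "Z = {op_adj u o\<^sub>L z o\<^sub>L u | z. z \<in> commutant N} \<union> commutant N"
  have Zb: "Z \<subseteq> bounded_ops" using u(1) commutant_subset[of N] by (auto simp: Z_def)
  have "?Q = commutant {op_adj u o\<^sub>L z o\<^sub>L u | z. z \<in> commutant N} \<inter> commutant (commutant N)"
    using conjugate_commutant[OF u, of "commutant N"] vN_bicommutant[OF N] by simp
  also have "\<dots> = commutant Z" by (auto simp: commutant_def Z_def)
  finally have Q: "?Q = commutant Z" .
  have "op_adj x \<in> ?Q" if x: "x \<in> ?Q" for x
  proof -
    obtain y where y: "y \<in> N" "x = op_adj u o\<^sub>L y o\<^sub>L u" using x by blast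
    have "op_adj x = op_adj u o\<^sub>L op_adj y o\<^sub>L u"
      using y u(1) vN_bounded[OF N] by (simp add: opc_assoc)
    then show ?thesis using x y vN_closed(3)[OF N] by blast
  qed
  then show ?thesis
    unfolding von_neumann_algebra_def using commutant_bicommutant[OF Zb] commutant_subset[of Z] Q
    by auto
qed

section \<open>Singularity of the normalizers\<close>

context coarse_setting
begin

lemma symmetries_norm_le: "v \<in> symmetries N \<Longrightarrow> norm v \<le> 1"
  using isometry_norm_le[of v] N_bounded by (auto simp: symmetries_def)

lemma quasi_normalizer_singular:
  assumes dN: "diffuse N" and x: "x \<in> one_sided_quasi_normalizer M N"
  shows "\<Lambda> x \<in> singular_subspace \<Lambda> t N M"
proof -
  obtain n :: nat and X where xM: "x \<in> M" and X: "\<forall>j<n. X j \<in> M"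
    and sub: "{x o\<^sub>L y | y. y \<in> N} \<subseteq> {\<Sum>j<n. a j o\<^sub>L X j | a. \<forall>j<n. a j \<in> N}"
    using x unfolding one_sided_quasi_normalizer_def by blast
  have "\<exists>a. (\<forall>j<n. a j \<in> N) \<and> x o\<^sub>L y = (\<Sum>j<n. a j o\<^sub>L X j)" if "y \<in> N" for y
    using sub that by blast
  from bounded_coefficients[OF vN_N this] obtain C where C: "0 < C"
    and rel: "\<And>v d. v \<in> N \<Longrightarrow> norm v \<le> 1 \<Longrightarrow> 0 < d \<Longrightarrow> \<exists>v'\<in>N. \<exists>a. norm (v - v') < d \<and>
    (\<forall>j<n. a j \<in> N \<and> norm (a j) < C) \<and> x o\<^sub>L v' = (\<Sum>j<n. a j o\<^sub>L X j)"
    by blast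
  show ?thesis
  proof (rule singular_criterion[OF vN_N order_refl dN C xM])
    show "X j \<in> M" if "j < n" for j using X that by blast
    show "\<exists>v'\<in>N. \<exists>a. norm (v - v') < d \<and> (\<forall>j<n. a j \<in> N \<and> norm (a j) < C) \<and>
        x o\<^sub>L v' = (\<Sum>j<n. a j o\<^sub>L X j)" if "v \<in> symmetries N" "0 < d" for v d
      using that symmetries_norm_le by (intro rel) (auto simp: symmetries_def)
  qed
qed

text \<open>Here \<open>u v = (u v u\<^sup>*) u\<close> with \<open>u v u\<^sup>* \<in> N\<close> for all \<open>v \<in> u\<^sup>* N u \<inter> N\<close>.\<close>

lemma wq_normalizer_singular:
  assumes u: "u \<in> wq_normalizer M N"
  shows "\<Lambda> u \<in> singular_subspace \<Lambda> t N M"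
proof -
  define Q where "Q = {op_adj u o\<^sub>L y o\<^sub>L u | y. y \<in> N} \<inter> N"
  have uM: "u \<in> M" and uu: "op_adj u o\<^sub>L u = id_blinfun" "u o\<^sub>L op_adj u = id_blinfun"
    and dQ: "diffuse Q"
    using u by (auto simp: wq_normalizer_def unitaries_def Q_def)
  have ub: "u \<in> bounded_ops" using uM M_bounded by blast
  have vQ: "von_neumann_algebra Q" unfolding Q_def by (rule vN_conjugate_Int[OF vN_N ub uu])
  show ?thesis
  proof (rule singular_criterion[OF vQ _ dQ, where C = 2 and n = 1 and X = "\<lambda>_. u"])
    show "Q \<subseteq> N" by (simp add: Q_def)
    fix v and d :: real assume v: "v \<in> symmetries Q" and d: "0 < d"
    then have vN: "v \<in> N" and va: "op_adj v = v" and vv: "v o\<^sub>L v = id_blinfun"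
      by (auto simp: symmetries_def Q_def)
    obtain y where y: "y \<in> N" "v = op_adj u o\<^sub>L y o\<^sub>L u" using v by (auto simp: symmetries_def Q_def)
    have uv: "u o\<^sub>L v = y o\<^sub>L u"
      unfolding y(2) by (simp add: opc_assoc[symmetric] uu)
    have yv: "y = u o\<^sub>L (v o\<^sub>L op_adj u)"
      using uu(2) by (simp add: opc_assoc[symmetric] uv) (simp add: opc_assoc)
    have vb: "v \<in> bounded_ops" using vN N_bounded by blast
    have "op_adj y o\<^sub>L y = (u o\<^sub>L v) o\<^sub>L ((op_adj u o\<^sub>L u) o\<^sub>L (v o\<^sub>L op_adj u))"
      unfolding yv using ub vb va by (simp add: opc_assoc)
    also have "\<dots> = u o\<^sub>L ((v o\<^sub>L v) o\<^sub>L op_adj u)" unfolding uu by (simp add: opc_assoc)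
    also have "\<dots> = id_blinfun" unfolding vv using uu by simp
    finally have "norm y \<le> 1" using isometry_norm_le[of y] y N_bounded by blast
    then show "\<exists>v'\<in>N. \<exists>a. norm (v - v') < d \<and> (\<forall>j<1::nat. a j \<in> N \<and> norm (a j) < 2) \<and>
        u o\<^sub>L v' = (\<Sum>j<1. a j o\<^sub>L u)"
      using vN d y(1) uv by (intro bexI[of _ v] exI[of _ "\<lambda>_. y"]) (auto simp: lessThan_Suc)
  qed (use uM in auto)
qed

end

theorem proposition1p2:
  fixes M N :: "('h::chilbert_space \<Rightarrow>\<^sub>L 'h) set"
    and \<tau> :: "('h \<Rightarrow>\<^sub>L 'h) \<Rightarrow> complex"
    and \<Lambda> :: "('h \<Rightarrow>\<^sub>L 'h) \<Rightarrow> 'l::chilbert_space"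
    and t :: "'l \<Rightarrow> 'l \<Rightarrow> 't::chilbert_space"
  assumes "tracial_von_neumann_algebra M \<tau>"
    and "von_neumann_subalgebra N M"
    and "diffuse N"
    and "L2_embedding M \<tau> \<Lambda>"
    and "tensor_map (L2 \<Lambda> N) (L2 \<Lambda> N) t"
  shows "\<Lambda> ` one_sided_quasi_normalizer M N \<subseteq> singular_subspace \<Lambda> t N M \<and>
         \<Lambda> ` wq_normalizer M N \<subseteq> singular_subspace \<Lambda> t N M"
proof -
  interpret coarse_setting M \<tau> \<Lambda> N t
    by unfold_locales (use assms in auto)
  show ?thesis using quasi_normalizer_singular[OF assms(3)] wq_normalizer_singular by blast
qed

end
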